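(* Let $\Bbbk$ be a commutative ring. The Hopf algebra $\mathcal{P}=\bigoplus_{n\ge0}\Bbbk P_n$ of uniform block permutations is free as an algebra and cofree as a graded coalgebra.
   Context: **Uniform block permutations.** For $n\ge 0$ let $[n]=\{1,\dots,n\}$. A set partition of $[n]$ is a collection of non-empty disjoint subsets (blocks) of $[n]$ with union $[n]$. A uniform block permutation of $[n]$ is a bijection $f:\mathcal{A}\to\mathcal{B}$ between two set partitions of $[n]$ such that $|f(A)|=|A|$ for every $A\in\mathcal{A}$; $\mathcal A$ is its domain and $\mathcal B$ its codomain. $P_n$ is the (finite) set of uniform block permutations of $[n]$; $P_0=\{\emptyset\}$, where $\emptyset$ denotes the empty uniform block permutation. **Monoid structure.** For $f:\mathcal{A}\to\mathcal{B}$ and $g:\mathcal{C}\to\mathcal{D}$ in $P_n$, the product $g\cdot f$ ("first $f$, then $g$") is defined as follows: let $\mathcal{E}$ be the finest set partition of $[n]$ such that every block of $\mathcal{B}$ and every block of $\mathcal{C}$ is contained in a block of $\mathcal{E}$; for each $E\in\mathcal{E}$, $g\cdot f$ has the domain block $\bigcup\{f^{-1}(B): B\in\mathcal{B}, B\subseteq E\}$ and sends it to $\bigcup\{g(C): C\in\mathcal{C}, C\subseteq E\}$. A permutation $\sigma\in S_n$ is identified with the uniform block permutation $\{i\}\mapsto\{\sigma(i)\}$; thus $S_n$ is a submonoid of $P_n$. $\Bbbk P_n$ is the monoid algebra (free $\Bbbk$-module on $P_n$, product extended bilinearly). **Concatenation.** For $f\in P_n$, $g\in P_m$, $f\times g\in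 P_{n+m}$ is the uniform block permutation whose domain blocks are the domain blocks $A$ of $f$, with $A\mapsto f(A)$, and the sets $A'+n=\{a+n: a\in A'\}$ for $A'$ a domain block of $g$, with $A'+n\mapsto g(A')+n$. **The Hopf algebra $\mathcal{P}$.** An $(n,m)$-shuffle is $\xi\in S_{n+m}$ with $\xi(1)<\cdots<\xi(n)$ and $\xi(n+1)<\cdots<\xi(n+m)$. $\mathrm{Sh}(n,m)$ is the set of these and $sh_{n,m}=\sum_{\xi\in \mathrm{Sh}(n,m)}\xi$. The product of $\mathcal{P}$ is $f\ast g=sh_{n,m}\cdot(f\times g)$ for $f\in P_n$, $g\in P_m$, extended bilinearly. A breaking point of a set partition $\mathcal{B}$ of $[n]$ is $i\in\{0,\dots,n\}$ such that $\{1,\dots,i\}$ is a union of blocks of $\mathcal{B}$; for $f:\mathcal{A}\to\mathcal{B}$, $B(f)$ is the set of breaking points of $\mathcal{B}$. For each $i\in B(f)$ there are a unique $\xi\in\mathrm{Sh}(i,n-i)$ and unique $f_{(i)}\in P_i$, $f'_{(n-i)}\in P_{n-i}$ with $f=(f_{(i)}\times f'_{(n-i)})\cdot\xi^{-1}$. The coproduct is $\Delta(f)=\sum_{i\in B(f)}f_{(i)}\otimes f'_{(n-i)}$. The unit is $\emptyset$; the counit is $\varepsilon(\emptyset)=1$, $\varepsilon(f)=0$ for $f\in P_n$, $n\ge1$. With the grading in which $\Bbbk P_n$ has degree $n$, this is a graded connected Hopf algebra. **Terminology.** Free as an algebra: isomorphic to a free associative unital $\Bbbk$-algebra. Cofree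 as a graded coalgebra: isomorphic, as a graded coalgebra, to $\bigoplus_{k\ge0}V^{\otimes k}$ with the deconcatenation coproduct, for some graded $\Bbbk$-module $V$ concentrated in positive degrees. *)

theory Defs
  imports
    "HOL-Library.Poly_Mapping"
    "HOL-Library.Disjoint_Sets"
    "HOL-Combinatorics.Permutations"
    "HOL-Algebra.Module"
    "HOL-Algebra.AbelCoset"
    "HOL-Algebra.QuotRing"
begin

section \<open>Modules over a commutative ring\<close>

text \<open>
  The ground ring is a type of sort \<open>{comm_ring, comm_monoid_mult}\<close>: a commutative ring with
  unit. Unlike \<^class>\<open>comm_ring_1\<close> this does not exclude the zero ring. Modules and algebras are
  HOL-Algebra records over the ring \<open>scalars\<close>; where only a module is meant, the fields \<open>mult\<close> and
  \<open>one\<close> are irrelevant and left undefined.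
\<close>

definition scalars :: "'k::{comm_ring,comm_monoid_mult} ring" where
  "scalars = \<lparr>carrier = UNIV, mult = (*), one = 1, zero = 0, add = (+)\<rparr>"

definition scale :: "'k::{comm_ring,comm_monoid_mult} \<Rightarrow> ('x \<Rightarrow>\<^sub>0 'k) \<Rightarrow> ('x \<Rightarrow>\<^sub>0 'k)" where
  "scale c p = Poly_Mapping.map ((*) c) p"

definition free_module :: "'x set \<Rightarrow> ('k::{comm_ring,comm_monoid_mult}, 'x \<Rightarrow>\<^sub>0 'k) module" where
  "free_module X =
     \<lparr>carrier = {p. Poly_Mapping.keys p \<subseteq> X}, mult = undefined, one = undefined,
      zero = 0, add = (+), smult = scale\<rparr>"

text \<open>Linear extension of a map \<open>b\<close> from the basis of a free module to a module \<open>M\<close>.\<close>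

definition lin_ext ::
    "('k::{comm_ring,comm_monoid_mult}, 'm, 'z) module_scheme \<Rightarrow> ('x \<Rightarrow> 'm) \<Rightarrow> ('x \<Rightarrow>\<^sub>0 'k) \<Rightarrow> 'm" where
  "lin_ext M b p =
     (\<Oplus>\<^bsub>M\<^esub>x\<in>Poly_Mapping.keys p. Poly_Mapping.lookup p x \<odot>\<^bsub>M\<^esub> b x)"

definition bilin_ext ::
    "('x \<Rightarrow> 'y \<Rightarrow> 'z) \<Rightarrow> ('x \<Rightarrow>\<^sub>0 'k::{comm_ring,comm_monoid_mult}) \<Rightarrow> ('y \<Rightarrow>\<^sub>0 'k) \<Rightarrow> ('z \<Rightarrow>\<^sub>0 'k)" where
  "bilin_ext b p q =
     (\<Sum>x\<in>Poly_Mapping.keys p. \<Sum>y\<in>Poly_Mapping.keys q.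
        Poly_Mapping.single (b x y) (Poly_Mapping.lookup p x * Poly_Mapping.lookup q y))"

definition span_of :: "('k::{comm_ring,comm_monoid_mult}, 'm, 'z) module_scheme \<Rightarrow> 'm set \<Rightarrow> 'm set" where
  "span_of M S = \<Inter>{H. submodule H scalars M \<and> S \<subseteq> H}"

definition quotient_module ::
    "('k::{comm_ring,comm_monoid_mult}, 'm, 'z) module_scheme \<Rightarrow> 'm set \<Rightarrow> ('k, 'm set) module" where
  "quotient_module M H =
     \<lparr>carrier = a_rcosets\<^bsub>M\<^esub> H, mult = undefined, one = undefined,
      zero = H, add = set_add M, smult = (\<lambda>c X. \<Union>x\<in>X. H +>\<^bsub>M\<^esub> (c \<odot>\<^bsub>M\<^esub> x))\<rparr>"

definition linear_map ::
    "('k::{comm_ring,comm_monoid_mult}, 'm, 'y) module_scheme \<Rightarrow> ('k, 'n, 'z) module_scheme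
      \<Rightarrow> ('m \<Rightarrow> 'n) \<Rightarrow> bool" where
  "linear_map M N h \<longleftrightarrow>
     h \<in> carrier M \<rightarrow> carrier N \<and>
     (\<forall>x\<in>carrier M. \<forall>y\<in>carrier M. h (x \<oplus>\<^bsub>M\<^esub> y) = h x \<oplus>\<^bsub>N\<^esub> h y) \<and>
     (\<forall>c. \<forall>x\<in>carrier M. h (c \<odot>\<^bsub>M\<^esub> x) = c \<odot>\<^bsub>N\<^esub> h x)"

definition graded_module ::
    "('k::{comm_ring,comm_monoid_mult}, 'm, 'z) module_scheme \<Rightarrow> (nat \<Rightarrow> 'm set) \<Rightarrow> bool" where
  "graded_module M G \<longleftrightarrow>
     module scalars M \<and>
     (\<forall>d. submodule (G d) scalars M) \<and>
     (\<forall>x\<in>carrier M. \<exists>!c. (\<forall>d. c d \<in> G d) \<and> finite {d. c d \<noteq> \<zero>\<^bsub>M\<^esub>} \<and>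
        x = (\<Oplus>\<^bsub>M\<^esub>d\<in>{d. c d \<noteq> \<zero>\<^bsub>M\<^esub>}. c d))"


section \<open>Tensor products\<close>

definition tensor_rels ::
    "('k::{comm_ring,comm_monoid_mult}, 'm, 'y) module_scheme \<Rightarrow> ('k, 'n, 'z) module_scheme
      \<Rightarrow> ('m \<times> 'n \<Rightarrow>\<^sub>0 'k) set" where
  "tensor_rels M N =
     {Poly_Mapping.single (x \<oplus>\<^bsub>M\<^esub> x', y) 1
        - Poly_Mapping.single (x, y) 1 - Poly_Mapping.single (x', y) 1 | x x' y.
        x \<in> carrier M \<and> x' \<in> carrier M \<and> y \<in> carrier N} \<union>
     {Poly_Mapping.single (x, y \<oplus>\<^bsub>N\<^esub> y') 1
        - Poly_Mapping.single (x, y) 1 - Poly_Mapping.single (x, y') 1 | x y y'.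
        x \<in> carrier M \<and> y \<in> carrier N \<and> y' \<in> carrier N} \<union>
     {Poly_Mapping.single (c \<odot>\<^bsub>M\<^esub> x, y) 1 - Poly_Mapping.single (x, y) c | c x y.
        x \<in> carrier M \<and> y \<in> carrier N} \<union>
     {Poly_Mapping.single (x, c \<odot>\<^bsub>N\<^esub> y) 1 - Poly_Mapping.single (x, y) c | c x y.
        x \<in> carrier M \<and> y \<in> carrier N}"

definition tensor_kernel ::
    "('k::{comm_ring,comm_monoid_mult}, 'm, 'y) module_scheme \<Rightarrow> ('k, 'n, 'z) module_scheme
      \<Rightarrow> ('m \<times> 'n \<Rightarrow>\<^sub>0 'k) set" where
  "tensor_kernel M N = span_of (free_module (carrier M \<times> carrier N)) (tensor_rels M N)"

definition tensor ::
    "('k::{comm_ring,comm_monoid_mult}, 'm, 'y) module_scheme \<Rightarrow> ('k, 'n, 'z) module_scheme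
      \<Rightarrow> ('k, ('m \<times> 'n \<Rightarrow>\<^sub>0 'k) set) module" where
  "tensor M N = quotient_module (free_module (carrier M \<times> carrier N)) (tensor_kernel M N)"

definition pure_tensor ::
    "('k::{comm_ring,comm_monoid_mult}, 'm, 'y) module_scheme \<Rightarrow> ('k, 'n, 'z) module_scheme
      \<Rightarrow> 'm \<Rightarrow> 'n \<Rightarrow> ('m \<times> 'n \<Rightarrow>\<^sub>0 'k) set" where
  "pure_tensor M N x y =
     tensor_kernel M N +>\<^bsub>free_module (carrier M \<times> carrier N)\<^esub> Poly_Mapping.single (x, y) 1"

text \<open>
  For linear \<open>h\<close> the map \<open>h \<otimes> h\<close> from \<open>M \<otimes> M\<close> to \<open>N \<otimes> N\<close>: it is the factorisation through the
  quotient of a linear map that vanishes on the relations, i.e. is constant on each coset.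
\<close>

definition tensor_map ::
    "('k::{comm_ring,comm_monoid_mult}, 'm, 'y) module_scheme \<Rightarrow> ('k, 'n, 'z) module_scheme
      \<Rightarrow> ('m \<Rightarrow> 'n) \<Rightarrow> ('m \<times> 'm \<Rightarrow>\<^sub>0 'k) set \<Rightarrow> ('n \<times> 'n \<Rightarrow>\<^sub>0 'k) set" where
  "tensor_map M N h T =
     the_elem (lin_ext (tensor N N) (\<lambda>(x, y). pure_tensor N N (h x) (h y)) ` T)"


section \<open>Free algebras and cofree graded coalgebras\<close>

text \<open>
  The free associative unital algebra on \<open>X\<close>: noncommutative polynomials, that is, linear combinations
  of words over \<open>X\<close>.
\<close>

definition free_algebra :: "'x set \<Rightarrow> ('k::{comm_ring,comm_monoid_mult}, 'x list \<Rightarrow>\<^sub>0 'k) module" where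
  "free_algebra X =
     \<lparr>carrier = {p. Poly_Mapping.keys p \<subseteq> lists X}, mult = bilin_ext (@),
      one = Poly_Mapping.single [] 1, zero = 0, add = (+), smult = scale\<rparr>"

text \<open>
  Taking the generators \<open>X\<close> from the element type of \<open>A\<close> is no restriction: an isomorphism maps
  them injectively into \<open>A\<close> (unless \<open>'k\<close> is the zero ring, where \<open>X\<close> does not matter).
\<close>

definition free_as_algebra ::
    "('k::{comm_ring,comm_monoid_mult}, 'm, 'z) module_scheme \<Rightarrow> bool" where
  "free_as_algebra A \<longleftrightarrow>
     (\<exists>(X :: 'm set) h. h \<in> ring_iso (free_algebra X) A \<and> linear_map (free_algebra X) A h)"

record (overloaded) ('k, 'm) graded_coalgebra = "('k::{comm_ring,comm_monoid_mult}, 'm) module" +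
  grade :: "nat \<Rightarrow> 'm set"
  comult :: "'m \<Rightarrow> ('m \<times> 'm \<Rightarrow>\<^sub>0 'k) set"
  counit :: "'m \<Rightarrow> 'k"

definition graded_coalgebra_iso ::
    "('k::{comm_ring,comm_monoid_mult}, 'm, 'y) graded_coalgebra_scheme
      \<Rightarrow> ('k, 'n, 'z) graded_coalgebra_scheme \<Rightarrow> ('m \<Rightarrow> 'n) \<Rightarrow> bool" where
  "graded_coalgebra_iso C D h \<longleftrightarrow>
     linear_map C D h \<and>
     bij_betw h (carrier C) (carrier D) \<and>
     (\<forall>d. h ` grade C d = grade D d) \<and>
     (\<forall>x\<in>carrier C. comult D (h x) = tensor_map C D h (comult C x)) \<and>
     (\<forall>x\<in>carrier C. counit D (h x) = counit C x)"

text \<open>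
  The direct sum of all tensor powers of \<open>V\<close>. The relations relate words of the same length, so the
  quotient is the direct sum over \<open>k\<close> of the quotients of the span of the words of length \<open>k\<close> by
  the multilinearity relations.
\<close>

definition word_rels ::
    "('k::{comm_ring,comm_monoid_mult}, 'v, 'z) module_scheme \<Rightarrow> ('v list \<Rightarrow>\<^sub>0 'k) set" where
  "word_rels V =
     {Poly_Mapping.single (xs @ [u \<oplus>\<^bsub>V\<^esub> v] @ ys) 1
        - Poly_Mapping.single (xs @ [u] @ ys) 1 - Poly_Mapping.single (xs @ [v] @ ys) 1 | xs u v ys.
        xs \<in> lists (carrier V) \<and> u \<in> carrier V \<and> v \<in> carrier V \<and> ys \<in> lists (carrier V)} \<union>
     {Poly_Mapping.single (xs @ [c \<odot>\<^bsub>V\<^esub> v] @ ys) 1 - Poly_Mapping.single (xs @ [v] @ ys) c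
        | xs c v ys. xs \<in> lists (carrier V) \<and> v \<in> carrier V \<and> ys \<in> lists (carrier V)}"

definition word_kernel ::
    "('k::{comm_ring,comm_monoid_mult}, 'v, 'z) module_scheme \<Rightarrow> ('v list \<Rightarrow>\<^sub>0 'k) set" where
  "word_kernel V = span_of (free_module (lists (carrier V))) (word_rels V)"

definition tensor_powers ::
    "('k::{comm_ring,comm_monoid_mult}, 'v, 'z) module_scheme
      \<Rightarrow> ('k, ('v list \<Rightarrow>\<^sub>0 'k) set) module" where
  "tensor_powers V = quotient_module (free_module (lists (carrier V))) (word_kernel V)"

definition pure_word ::
    "('k::{comm_ring,comm_monoid_mult}, 'v, 'z) module_scheme \<Rightarrow> 'v list \<Rightarrow> ('v list \<Rightarrow>\<^sub>0 'k) set" where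
  "pure_word V vs =
     word_kernel V +>\<^bsub>free_module (lists (carrier V))\<^esub> Poly_Mapping.single vs 1"

text \<open>
  The deconcatenation coproduct is the linear map with
  \<open>v\<^sub>1\<cdots>v\<^sub>k \<mapsto> \<Sum>i\<le>k. v\<^sub>1\<cdots>v\<^sub>i \<otimes> v\<^sub>i\<^sub>+\<^sub>1\<cdots>v\<^sub>k\<close>, and the counit is the projection to the tensor power of
  exponent 0; both are factored through the quotient as in \<open>tensor_map\<close>. The degree of a pure
  tensor is the sum of the degrees of its entries.
\<close>

definition cotensor_coalgebra ::
    "('k::{comm_ring,comm_monoid_mult}, 'v, 'z) module_scheme \<Rightarrow> (nat \<Rightarrow> 'v set)
      \<Rightarrow> ('k, ('v list \<Rightarrow>\<^sub>0 'k) set) graded_coalgebra" where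
  "cotensor_coalgebra V G =
     \<lparr>carrier = carrier (tensor_powers V), mult = undefined, one = undefined,
      zero = zero (tensor_powers V), add = add (tensor_powers V), smult = smult (tensor_powers V),
      grade = (\<lambda>n. span_of (tensor_powers V)
        {pure_word V vs | vs. \<exists>ds. list_all2 (\<lambda>v d. v \<in> G d) vs ds \<and> sum_list ds = n}),
      comult = (\<lambda>T. the_elem
        (lin_ext (tensor (tensor_powers V) (tensor_powers V))
          (\<lambda>vs. \<Oplus>\<^bsub>tensor (tensor_powers V) (tensor_powers V)\<^esub>i\<in>{0..length vs}.
             pure_tensor (tensor_powers V) (tensor_powers V)
               (pure_word V (take i vs)) (pure_word V (drop i vs))) ` T)),
      counit = (\<lambda>T. the_elem ((\<lambda>p. Poly_Mapping.lookup p []) ` T))\<rparr>"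

text \<open>
  Taking \<open>V\<close> on the element type of \<open>C\<close> is no restriction: an isomorphism embeds \<open>V\<close>, the first
  tensor power, into \<open>C\<close>.
\<close>

definition cofree_as_graded_coalgebra ::
    "('k::{comm_ring,comm_monoid_mult}, 'm, 'z) graded_coalgebra_scheme \<Rightarrow> bool" where
  "cofree_as_graded_coalgebra C \<longleftrightarrow>
     (\<exists>(V :: ('k, 'm) module) G h.
        graded_module V G \<and> G 0 = {\<zero>\<^bsub>V\<^esub>} \<and> graded_coalgebra_iso (cotensor_coalgebra V G) C h)"


section \<open>Uniform block permutations\<close>

text \<open>A uniform block permutation is represented by its graph, a set of pairs of blocks.\<close>

type_synonym ubp = "(nat set \<times> nat set) set"

definition ubps :: "nat \<Rightarrow> ubp set" where
  "ubps n = {f. partition_on {1..n} (Domain f) \<and> partition_on {1..n} (Range f) \<and>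
     single_valued f \<and> single_valued (f\<inverse>) \<and> (\<forall>(A, B)\<in>f. card A = card B)}"

text \<open>The \<open>n\<close> with \<open>f \<in> ubps n\<close>.\<close>

definition ubp_deg :: "ubp \<Rightarrow> nat" where
  "ubp_deg f = card (\<Union>(Domain f))"

definition partition_join :: "nat set \<Rightarrow> nat set set \<Rightarrow> nat set set \<Rightarrow> nat set set" where
  "partition_join S \<B> \<C> =
     (THE \<E>. refines S \<B> \<E> \<and> refines S \<C> \<E> \<and>
        (\<forall>\<E>'. refines S \<B> \<E>' \<and> refines S \<C> \<E>' \<longrightarrow> refines S \<E> \<E>'))"

text \<open>\<open>ubp_comp g f\<close> is the product \<open>g \<cdot> f\<close>: first \<open>f\<close>, then \<open>g\<close>.\<close>

definition ubp_comp :: "ubp \<Rightarrow> ubp \<Rightarrow> ubp" where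
  "ubp_comp g f =
     (\<lambda>E. (\<Union>{A. \<exists>B. (A, B) \<in> f \<and> B \<subseteq> E}, \<Union>{D. \<exists>C. (C, D) \<in> g \<and> C \<subseteq> E})) `
       partition_join {1..ubp_deg f} (Range f) (Domain g)"

definition perm_ubp :: "nat \<Rightarrow> (nat \<Rightarrow> nat) \<Rightarrow> ubp" where
  "perm_ubp n \<sigma> = {({i}, {\<sigma> i}) | i. i \<in> {1..n}}"

definition ubp_concat :: "ubp \<Rightarrow> ubp \<Rightarrow> ubp" where
  "ubp_concat f g = f \<union> (\<lambda>(A, B). ((\<lambda>a. a + ubp_deg f) ` A, (\<lambda>b. b + ubp_deg f) ` B)) ` g"

definition Sh :: "nat \<Rightarrow> nat \<Rightarrow> (nat \<Rightarrow> nat) set" where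
  "Sh n m = {\<xi>. \<xi> permutes {1..n + m} \<and> strict_mono_on {1..n} \<xi> \<and> strict_mono_on {n + 1..n + m} \<xi>}"

definition sh :: "nat \<Rightarrow> nat \<Rightarrow> (ubp \<Rightarrow>\<^sub>0 'k::{comm_ring,comm_monoid_mult})" where
  "sh n m = (\<Sum>\<xi>\<in>Sh n m. Poly_Mapping.single (perm_ubp (n + m) \<xi>) 1)"

text \<open>The product of the monoid algebras, meaningful on elements of the same degree.\<close>

definition monoid_algebra_mult ::
    "(ubp \<Rightarrow>\<^sub>0 'k::{comm_ring,comm_monoid_mult}) \<Rightarrow> (ubp \<Rightarrow>\<^sub>0 'k) \<Rightarrow> (ubp \<Rightarrow>\<^sub>0 'k)" where
  "monoid_algebra_mult = bilin_ext ubp_comp"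

definition ubp_breaks :: "ubp \<Rightarrow> nat set" where
  "ubp_breaks f = {i \<in> {0..ubp_deg f}. \<exists>S\<subseteq>Range f. \<Union>S = {1..i}}"

text \<open>For a breaking point \<open>i\<close> of \<open>f\<close> of degree \<open>n\<close>, the pair of \<open>f\<^sub>(\<^sub>i\<^sub>)\<close> and \<open>f'\<^sub>(\<^sub>n\<^sub>-\<^sub>i\<^sub>)\<close>.\<close>

definition ubp_split :: "ubp \<Rightarrow> nat \<Rightarrow> ubp \<times> ubp" where
  "ubp_split f i = snd
     (THE (\<xi>, a, b). \<xi> \<in> Sh i (ubp_deg f - i) \<and> a \<in> ubps i \<and> b \<in> ubps (ubp_deg f - i) \<and>
        f = ubp_comp (ubp_concat a b) (perm_ubp (ubp_deg f) (inv_into UNIV \<xi>)))"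


section \<open>The Hopf algebra of uniform block permutations\<close>

definition ubp_module :: "('k::{comm_ring,comm_monoid_mult}, ubp \<Rightarrow>\<^sub>0 'k) module" where
  "ubp_module = free_module (\<Union>n. ubps n)"

definition ubp_mult ::
    "(ubp \<Rightarrow>\<^sub>0 'k::{comm_ring,comm_monoid_mult}) \<Rightarrow> (ubp \<Rightarrow>\<^sub>0 'k) \<Rightarrow> (ubp \<Rightarrow>\<^sub>0 'k)" where
  "ubp_mult p q =
     (\<Sum>f\<in>Poly_Mapping.keys p. \<Sum>g\<in>Poly_Mapping.keys q.
        scale (Poly_Mapping.lookup p f * Poly_Mapping.lookup q g)
          (monoid_algebra_mult (sh (ubp_deg f) (ubp_deg g))
             (Poly_Mapping.single (ubp_concat f g) 1)))"

definition ubp_comult ::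
    "(ubp \<Rightarrow>\<^sub>0 'k::{comm_ring,comm_monoid_mult}) \<Rightarrow> ((ubp \<Rightarrow>\<^sub>0 'k) \<times> (ubp \<Rightarrow>\<^sub>0 'k) \<Rightarrow>\<^sub>0 'k) set" where
  "ubp_comult =
     lin_ext (tensor ubp_module ubp_module)
       (\<lambda>f. \<Oplus>\<^bsub>tensor ubp_module ubp_module\<^esub>i\<in>ubp_breaks f.
          pure_tensor ubp_module ubp_module
            (Poly_Mapping.single (fst (ubp_split f i)) 1)
            (Poly_Mapping.single (snd (ubp_split f i)) 1))"

definition ubp_hopf_algebra ::
    "('k::{comm_ring,comm_monoid_mult}, ubp \<Rightarrow>\<^sub>0 'k) graded_coalgebra" where
  "ubp_hopf_algebra =
     \<lparr>carrier = carrier ubp_module, mult = ubp_mult, one = Poly_Mapping.single {} 1,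
      zero = zero ubp_module, add = add ubp_module, smult = smult ubp_module,
      grade = (\<lambda>n. carrier (free_module (ubps n))),
      comult = ubp_comult,
      counit = (\<lambda>p. Poly_Mapping.lookup p {})\<rparr>"

end

theory Submission
  imports Defs
begin

text \<open>
  A uniform block permutation \<open>f : \<A> \<rightarrow> \<B>\<close> of \<open>[n]\<close> is a word of length \<open>n\<close> whose letter at a position in
  \<open>A \<in> \<A>\<close> is \<open>f(A)\<close>. For a breaking point \<open>i\<close>, the words of \<open>f\<^sub>(\<^sub>i\<^sub>)\<close> and \<open>f'\<^sub>(\<^sub>n\<^sub>-\<^sub>i\<^sub>)\<close> (the latter shifted by \<open>i\<close>)
  consist of the letters of \<open>f\<close> inside and outside \<open>{1,\<dots>,i}\<close>; so the coproduct of \<open>u\<close> is the sum of all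
  \<open>a \<otimes> b\<close> such that \<open>u\<close> is a shuffle of \<open>a\<close> and the shifted \<open>b\<close>. In the basis of the inverses the product
  of \<open>a\<close> and \<open>b\<close> is dually the sum of all these shuffles. Words are a free monoid under shifted
  concatenation, and among the shuffles of \<open>a\<close> and the shifted \<open>b\<close> only the concatenation attains the least
  number of inversions. Hence the matrix whose entry at a word \<open>u\<close> and a sequence \<open>w\<close> of irreducible words
  tells whether \<open>u\<close> splits into \<open>w\<close> is unitriangular, so it is invertible over every commutative ring. Read by
  columns, this says that the products of irreducible elements are a basis; read by rows, that the
  iterated coproduct, restricted to irreducible components, is an isomorphism onto the cotensor coalgebra.
\<close>

text \<open>Every tensor product and tensor power is a quotient of a free module on all tuples of
  elements, and a map on it is \<open>the_elem\<close> of an image. Identities are therefore proved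
  on representatives: both sides become explicit finite sums, and their difference is shown to lie
  in the span of the relations. Cofreeness asks for a map out of the cotensor coalgebra, whereas the
  iterated coproduct maps into it. So the isomorphism is its inverse: \<open>expand\<close> writes a
  tensor in basis words over the irreducible elements, and \<open>concat_split\<close> picks the
  preimage of a basis word. Preimages are chosen within one degree, which makes the inverse graded.
  Both halves rest on the relation \<open>msplits\<close>, whose associativity comes from that of
  shuffles: it yields multiplicativity of the algebra map and compatibility of the coalgebra map
  with deconcatenation. The ground ring may be the zero ring, where all basis elements
  \<open>single x 1\<close> coincide. Generators are then no longer distinct, so freeness treats
  this ring apart; for cofreeness the argument is uniform.\<close>

abbreviation (input) single :: "'x \<Rightarrow> 'c \<Rightarrow> 'x \<Rightarrow>\<^sub>0 'c::zero" where
  "single \<equiv> Poly_Mapping.single"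

abbreviation (input) keys :: "('x \<Rightarrow>\<^sub>0 'c::zero) \<Rightarrow> 'x set" where
  "keys \<equiv> Poly_Mapping.keys"

abbreviation (input) lookup :: "('x \<Rightarrow>\<^sub>0 'c::zero) \<Rightarrow> 'x \<Rightarrow> 'c" where
  "lookup \<equiv> Poly_Mapping.lookup"

section \<open>Words of blocks\<close>

text \<open>The positions of a letter \<open>B\<close> are meant to form the domain block that is
  sent to \<open>B\<close>, so uniformity becomes the condition on multiplicities. The ground set is
  a parameter because the letters beyond a breaking point cover an interval that does not start at
  1.\<close>

definition code_on :: "nat set \<Rightarrow> nat set list \<Rightarrow> bool" where
  "code_on S u \<longleftrightarrow> partition_on S (set u) \<and> (\<forall>B\<in>set u. count (mset u) B = card B)"

definition codes :: "nat set list set" where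
  "codes = {u. code_on {1..length u} u}"

definition shift :: "nat \<Rightarrow> nat set list \<Rightarrow> nat set list" where
  "shift i = map ((`) ((+) i))"

lemma length_shift [simp]: "length (shift i u) = length u"
  by (simp add: shift_def)

lemma shift_simps [simp]:
  "shift i [] = []" "shift i (B # u) = ((+) i ` B) # shift i u" "shift i (u @ v) = shift i u @ shift i v"
  by (simp_all add: shift_def)

lemma shift_eq_Nil [simp]: "shift i u = [] \<longleftrightarrow> u = []"
  by (simp add: shift_def)

lemma shift_0 [simp]: "shift 0 u = u"
proof -
  have "(`) ((+) (0::nat)) = (\<lambda>B. B)"
    by (auto simp: image_def)
  then show ?thesis
    by (simp add: shift_def)
qed

lemma shift_shift: "shift i (shift j u) = shift (i + j) u"
  by (simp add: shift_def image_image add.assoc)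

lemma inj_image_plus: "inj ((`) ((+) (i::nat)))"
  by (simp add: inj_image_eq_iff inj_on_def)

lemma shift_eq_iff [simp]: "shift i u = shift i v \<longleftrightarrow> u = v"
  unfolding shift_def by (rule inj_map_eq_map) (rule inj_image_plus)

lemma set_shift: "set (shift i u) = (`) ((+) i) ` set u"
  by (simp add: shift_def)

lemma take_shift: "take k (shift i u) = shift i (take k u)"
  by (simp add: shift_def take_map)

section \<open>Shuffles of lists under maps, and their associativity\<close>

lemma map_in_shuffles: "w \<in> shuffles u v \<Longrightarrow> map f w \<in> shuffles (map f u) (map f v)"
proof (induct w arbitrary: u v)
  case (Cons z w)
  then show ?case
    unfolding Cons_in_shuffles_iff list.map(2) by (auto simp: hd_map simp flip: map_tl)
qed auto

text \<open>At each letter a shuffle takes the head of one of its two words; repeating the same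
  choices on the unmapped words lifts \<open>w\<close>.\<close>

lemma map_shufflesE:
  assumes "w \<in> shuffles (map f u) (map f v)"
  obtains w' where "w = map f w'" "w' \<in> shuffles u v"
  using assms
proof (induct w arbitrary: u v thesis)
  case Nil
  then show ?case by auto
next
  case (Cons z w)
  from Cons.prems(2) consider
      x us where "u = x # us" "z = f x" "w \<in> shuffles (map f us) (map f v)"
    | y vs where "v = y # vs" "z = f y" "w \<in> shuffles (map f u) (map f vs)"
    by (auto simp: Cons_in_shuffles_iff neq_Nil_conv)
  then show ?case
  proof cases
    case 1
    then obtain w' where "w = map f w'" "w' \<in> shuffles us v"
      using Cons.hyps by blast
    with 1 show ?thesis
      by (intro Cons.prems(1)[of "x # w'"]) (auto intro: Cons_in_shuffles_leftI)
  next
    case 2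
    then obtain w' where "w = map f w'" "w' \<in> shuffles u vs"
      using Cons.hyps by blast
    with 2 show ?thesis
      by (intro Cons.prems(1)[of "y # w'"]) (auto intro: Cons_in_shuffles_rightI)
  qed
qed

text \<open>Either side says that \<open>w\<close> is a shuffle of three words, so its first letter
  is the head of one of them and the rest is again such a shuffle.\<close>

lemma shuffles_assoc: "(\<exists>y\<in>shuffles b c. w \<in> shuffles a y) \<longleftrightarrow> (\<exists>x\<in>shuffles a b. w \<in> shuffles x c)"
proof (induct w arbitrary: a b c)
  case Nil
  then show ?case by auto
next
  case (Cons z w)
  have 1: "(\<exists>y\<in>shuffles b c. z # w \<in> shuffles a y) \<longleftrightarrow>
      (a \<noteq> [] \<and> hd a = z \<and> (\<exists>y\<in>shuffles b c. w \<in> shuffles (tl a) y)) \<or>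
      (b \<noteq> [] \<and> hd b = z \<and> (\<exists>y\<in>shuffles (tl b) c. w \<in> shuffles a y)) \<or>
      (c \<noteq> [] \<and> hd c = z \<and> (\<exists>y\<in>shuffles b (tl c). w \<in> shuffles a y))"
    (is "?l \<longleftrightarrow> ?r") for a b c
  proof
    assume ?l
    then obtain y where y: "y \<in> shuffles b c" "z # w \<in> shuffles a y" by blast
    then show ?r
      by (cases y) (auto simp: Cons_in_shuffles_iff)
  next
    have ?l if "b \<noteq> [] \<and> hd b = z \<and> y \<in> shuffles (tl b) c \<or> c \<noteq> [] \<and> hd c = z \<and> y \<in> shuffles b (tl c)"
      "w \<in> shuffles a y" for y
      using that by (intro bexI[of _ "z # y"]) (simp_all add: Cons_in_shuffles_iff)
    moreover have ?l if "a \<noteq> [] \<and> hd a = z \<and> y \<in> shuffles b c" "w \<in> shuffles (tl a) y" for y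
      using that by (intro bexI[of _ y]) (simp_all add: Cons_in_shuffles_iff)
    moreover assume ?r
    ultimately show ?l by blast
  qed
  \<comment> \<open>By commutativity the left bracketing is the right bracketing with the three
    words in reverse order, so \<open>1\<close> unfolds both sides.\<close>
  have comm: "(\<exists>x\<in>shuffles a b. v \<in> shuffles x c) \<longleftrightarrow> (\<exists>x\<in>shuffles b a. v \<in> shuffles c x)"
    for a b c v :: "'a list"
    unfolding shuffles_commutes[of a b] by (rule bex_cong[OF refl]) (subst shuffles_commutes, rule refl)
  note IH = Cons[unfolded comm]
  show ?case
    unfolding comm 1 using IH[of b c "tl a"] IH[of "tl b" c a] IH[of b "tl c" a] by blast
qed

lemma append_in_shuffles: "u @ v \<in> shuffles u v"
  by (induct u) (auto intro: Cons_in_shuffles_leftI)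

section \<open>Words over a set partition: length, shuffles, restriction\<close>

lemma code_on_length: "code_on S u \<Longrightarrow> finite S \<Longrightarrow> length u = card S"
proof -
  assume u: "code_on S u" and S: "finite S"
  have "length u = size (mset u)" by simp
  also have "\<dots> = (\<Sum>B\<in>set u. count (mset u) B)"
    by (simp add: size_multiset_overloaded_eq)
  also have "\<dots> = (\<Sum>B\<in>set u. card B)"
    using u by (simp add: code_on_def)
  also have "\<dots> = card (\<Union>(set u))"
    using u S by (intro card_Union_disjoint[symmetric])
      (auto simp: code_on_def partition_on_def intro: finite_subset)
  also have "\<Union>(set u) = S"
    using u by (simp add: code_on_def partition_on_def)
  finally show ?thesis .
qed

text \<open>Blocks are non-empty, so disjoint ground sets force disjoint sets of letters; each
  letter then has in \<open>w\<close> the multiplicity it has in its own factor.\<close>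

lemma code_on_shuffles:
  assumes "code_on S u" "code_on T v" "S \<inter> T = {}" "w \<in> shuffles u v"
  shows "code_on (S \<union> T) w"
proof -
  have "set u \<inter> set v = {}"
  proof (intro equals0I)
    fix B
    assume "B \<in> set u \<inter> set v"
    then have "B \<subseteq> S \<inter> T" "B \<noteq> {}"
      using assms by (auto simp: code_on_def partition_on_def)
    then show False
      using assms by simp
  qed
  then have "count (mset v) B = 0" if "B \<in> set u" for B
    using that by (auto simp: not_in_iff[symmetric])
  moreover have "count (mset u) B = 0" if "B \<in> set v" for B
    using that \<open>set u \<inter> set v = {}\<close> by (auto simp: not_in_iff[symmetric])
  moreover have "partition_on (S \<union> T) (set u \<union> set v)"
    using assms unfolding code_on_def partition_on_def disjoint_def by (auto 0 4)
  ultimately show ?thesis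
    using assms set_shuffles[OF assms(4)] mset_shuffles[OF assms(4)]
    by (auto simp: code_on_def)
qed

lemma code_on_filter:
  assumes "code_on S u"
  shows "code_on (\<Union>{B\<in>set u. P B}) (filter P u)"
proof -
  have "partition_on (\<Union>{B\<in>set u. P B}) {B\<in>set u. P B}"
    using assms by (auto simp: code_on_def partition_on_def disjoint_def)
  then show ?thesis
    using assms by (simp add: code_on_def)
qed

lemma code_on_shift: "code_on ((+) i ` S) (shift i u) \<longleftrightarrow> code_on S u"
proof -
  have inj: "inj ((+) i)" by simp
  have p: "partition_on ((+) i ` S) ((`) ((+) i) ` set u) \<longleftrightarrow> partition_on S (set u)"
    by (simp add: partition_on_def disjoint_def image_Int[OF inj, symmetric] inj_image_eq_iff[OF inj]
        image_Union[symmetric] image_iff)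
  have "count (mset (shift i u)) ((+) i ` B) = count (mset u) B" for B
    by (induct u) (auto simp: inj_image_eq_iff)
  then show ?thesis
    by (simp add: code_on_def set_shift p card_image)
qed

text \<open>A letter \<open>B\<close> of \<open>u\<close> occurs \<open>card B\<close> times in
  \<open>u\<close> and no more often in \<open>w\<close>, so none is left for \<open>v\<close>.
  Hence \<open>v\<close> is obtained from \<open>w\<close> by filtering out the letters of
  \<open>u\<close>.\<close>

lemma code_on_shuffles_right:
  assumes "code_on (S \<union> T) w" "code_on S u" "S \<inter> T = {}" "w \<in> shuffles u v"
  shows "code_on T v"
proof -
  have "B \<notin> set u" if "B \<in> set v" for B
  proof
    assume B: "B \<in> set u"
    then have "B \<in> set w"
      using set_shuffles[OF assms(4)] by simp
    then have "count (mset w) B = card B" "count (mset u) B = card B"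
      using assms B by (auto simp: code_on_def)
    then have "count (mset v) B = 0"
      using mset_shuffles[OF assms(4)] by simp
    then show False
      using that by simp
  qed
  then have disj: "set u \<inter> set v = {}" by blast
  have v: "filter (\<lambda>B. B \<notin> set u) w = v"
    using filter_shuffles_disjoint1(2)[OF disj assms(4)] .
  have "\<Union>{B\<in>set w. B \<notin> set u} = T"
  proof -
    have "set w = set u \<union> set v"
      by (rule set_shuffles) fact
    have "\<Union>(set w) = S \<union> T" "\<Union>(set u) = S" "disjoint (set w)"
      using assms by (auto simp: code_on_def partition_on_def)
    have "x \<notin> S" if "B \<in> set v" "x \<in> B" for x B
    proof
      assume "x \<in> S"
      then obtain C where "C \<in> set u" "x \<in> C"
        using \<open>\<Union>(set u) = S\<close> by blast
      moreover have "B \<noteq> C"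
        using disj that \<open>C \<in> set u\<close> by blast
      ultimately show False
        using \<open>disjoint (set w)\<close> \<open>set w = _\<close> that unfolding disjoint_def by blast
    qed
    then have "\<Union>(set v) \<inter> S = {}"
      by blast
    moreover have "S \<union> \<Union>(set v) = S \<union> T"
      using \<open>\<Union>(set w) = S \<union> T\<close> \<open>\<Union>(set u) = S\<close> \<open>set w = _\<close> by simp
    ultimately have "\<Union>(set v) = T"
      using assms(3) by blast
    moreover have "{B\<in>set w. B \<notin> set u} = set v"
      using disj \<open>set w = _\<close> by blast
    ultimately show ?thesis by simp
  qed
  with code_on_filter[OF assms(1), of "\<lambda>B. B \<notin> set u"] v show ?thesis
    by simp
qed

lemma codesI: "code_on {1..n} u \<Longrightarrow> u \<in> codes"
  using code_on_length[of "{1..n}" u] by (simp add: codes_def)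

lemma code_on_shift_codes: "u \<in> codes \<Longrightarrow> code_on {i + 1..i + length u} (shift i u)"
  using code_on_shift[of i "{1..length u}" u] by (simp add: codes_def add.commute)

lemma codes_block:
  assumes "u \<in> codes" "B \<in> set u"
  shows "B \<noteq> {}" "B \<subseteq> {1..length u}" "finite B"
proof -
  show "B \<noteq> {}" "B \<subseteq> {1..length u}"
    using assms by (auto simp: codes_def code_on_def partition_on_def)
  then show "finite B"
    using finite_subset by blast
qed

lemma shift_codes_block:
  assumes "u \<in> codes" "B \<in> set (shift i u)"
  shows "B \<noteq> {}" "B \<subseteq> {i + 1..i + length u}" "finite B"
proof -
  show "B \<noteq> {}" "B \<subseteq> {i + 1..i + length u}"
    using code_on_shift_codes[OF assms(1), of i] assms(2) by (auto simp: code_on_def partition_on_def)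
  then show "finite B"
    using finite_subset by blast
qed

lemma Nil_codes [simp]: "[] \<in> codes"
  by (simp add: codes_def code_on_def partition_on_def)

section \<open>Shifted concatenation and splitting at a breaking point\<close>

definition conc :: "nat set list \<Rightarrow> nat set list \<Rightarrow> nat set list" where
  "conc a b = a @ shift (length a) b"

text \<open>The pair of \<open>f\<^sub>(\<^sub>i\<^sub>)\<close> and \<open>f'\<^sub>(\<^sub>n\<^sub>-\<^sub>i\<^sub>)\<close> in terms of words.\<close>

definition splits :: "nat set list \<Rightarrow> nat set list \<Rightarrow> nat set list \<Rightarrow> bool" where
  "splits u a b \<longleftrightarrow> a \<in> codes \<and> b \<in> codes \<and> u \<in> shuffles a (shift (length a) b)"

lemma splits_length: "splits u a b \<Longrightarrow> length u = length a + length b"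
  by (auto simp: splits_def length_shuffles)

lemma splits_codes: "splits u a b \<Longrightarrow> u \<in> codes \<and> a \<in> codes \<and> b \<in> codes"
proof -
  assume s: "splits u a b"
  have "{1..length a} \<union> {length a + 1..length a + length b} = {1..length u}"
    using splits_length[OF s] by auto
  moreover have "code_on ({1..length a} \<union> {length a + 1..length a + length b}) u"
    by (rule code_on_shuffles[of _ a _ "shift (length a) b"])
       (use s code_on_shift_codes[of b "length a"] in \<open>auto simp: splits_def codes_def\<close>)
  ultimately show ?thesis
    using s by (auto simp: splits_def codes_def)
qed

text \<open>Letters of \<open>a\<close> lie in the initial segment, while shifted letters of
  \<open>b\<close> are non-empty and lie beyond it. So \<open>u\<close> and the length of
  \<open>a\<close> alone determine both factors; the extra element 0 of \<open>{..length a}\<close>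
  lies in no block.\<close>

lemma splits_filter:
  assumes "splits u a b"
  shows "filter (\<lambda>B. B \<subseteq> {..length a}) u = a" "filter (\<lambda>B. \<not> B \<subseteq> {..length a}) u = shift (length a) b"
proof -
  have a: "\<forall>B\<in>set a. B \<subseteq> {..length a}"
    using assms codes_block(2)[of a] by (fastforce simp: splits_def)
  have b: "\<forall>B\<in>set (shift (length a) b). \<not> B \<subseteq> {..length a}"
  proof
    fix B
    assume "B \<in> set (shift (length a) b)"
    with shift_codes_block[of b B "length a"] assms
    have "B \<noteq> {}" "B \<subseteq> {length a + 1..}"
      by (auto simp: splits_def)
    then show "\<not> B \<subseteq> {..length a}" by fastforce
  qed
  have u: "u \<in> shuffles a (shift (length a) b)"
    using assms by (simp add: splits_def)
  have *: "filter P u \<in> shuffles (filter P a) (filter P (shift (length a) b))" for P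
    using u filter_shuffles by blast
  show "filter (\<lambda>B. B \<subseteq> {..length a}) u = a"
    using *[of "\<lambda>B. B \<subseteq> {..length a}"] a b by (simp add: filter_False cong: filter_cong)
  show "filter (\<lambda>B. \<not> B \<subseteq> {..length a}) u = shift (length a) b"
    using *[of "\<lambda>B. \<not> B \<subseteq> {..length a}"] a b by (simp add: filter_False cong: filter_cong)
qed

lemma splits_unique:
  assumes "splits u a b" "splits u a' b'" "length a = length a'"
  shows "a = a' \<and> b = b'"
  using splits_filter[OF assms(1)] splits_filter[OF assms(2)] assms(3)
  by (metis shift_eq_iff)

lemma splits_break:
  assumes "splits u a b"
  shows "length a \<le> length u \<and> (\<exists>S\<subseteq>set u. \<Union>S = {1..length a})"
proof -
  have "\<Union>(set a) = {1..length a}"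
    using assms by (auto simp: splits_def codes_def code_on_def partition_on_def)
  moreover have "set a \<subseteq> set u"
    using assms set_shuffles by (fastforce simp: splits_def)
  ultimately show ?thesis
    using splits_length[OF assms] by auto
qed

text \<open>The blocks in \<open>S\<close> are exactly the letters inside the initial segment, so
  filtering by that segment gives a word on \<open>{1..i}\<close>, and
  \<open>code_on_shuffles_right\<close> takes care of the remaining letters.\<close>

lemma splits_exists:
  assumes u: "u \<in> codes" and i: "i \<le> length u" and S: "S \<subseteq> set u" "\<Union>S = {1..i}"
  obtains a b where "splits u a b" "length a = i"
proof -
  have part: "partition_on {1..length u} (set u)"
    using u by (simp add: codes_def code_on_def)
  \<comment> \<open>A letter inside the segment meets some block of \<open>S\<close>; two blocks of
    one partition that meet are equal.\<close>
  have S_iff: "B \<in> S \<longleftrightarrow> B \<subseteq> {..i}" if B: "B \<in> set u" for B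
  proof
    assume "B \<subseteq> {..i}"
    then obtain x where x: "x \<in> B" "x \<in> {1..i}"
      using codes_block[OF u B] by fastforce
    then obtain B' where B': "B' \<in> S" "x \<in> B'"
      using S by blast
    then have "B = B'"
      using part x S(1) B unfolding partition_on_def disjoint_def by blast
    then show "B \<in> S"
      using B' by simp
  qed (use S(2) in fastforce)
  define a where "a = filter (\<lambda>B. B \<subseteq> {..i}) u"
  define c where "c = filter (\<lambda>B. \<not> B \<subseteq> {..i}) u"
  \<comment> \<open>Subtraction of naturals truncates, but all elements of letters of
    \<open>c\<close> exceed \<open>i\<close>, so \<open>shift i\<close> recovers \<open>c\<close>
    from \<open>b\<close>.\<close>
  define b where "b = map ((`) (\<lambda>x. x - i)) c"
  have "{B\<in>set u. B \<subseteq> {..i}} = S"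
    using S_iff S(1) by blast
  then have "code_on {1..i} a"
    using code_on_filter[of "{1..length u}" u "\<lambda>B. B \<subseteq> {..i}"] u S(2)
    by (simp add: a_def codes_def)
  then have a: "a \<in> codes" "length a = i"
    using codesI code_on_length[of "{1..i}" a] by auto
  have uac: "u \<in> shuffles a c"
    unfolding a_def c_def by (rule partition_in_shuffles)
  have "{1..i} \<union> {i + 1..i + (length u - i)} = {1..length u}"
    using i by auto
  then have "code_on ({1..i} \<union> {i + 1..i + (length u - i)}) u"
    using u by (simp add: codes_def)
  from code_on_shuffles_right[OF this \<open>code_on {1..i} a\<close> _ uac]
  have c: "code_on {i + 1..i + (length u - i)} c" by auto
  have "(+) i ` (\<lambda>x. x - i) ` B = B" if "B \<in> set c" for B
  proof -
    have "B \<subseteq> {i + 1..}"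
      using c that by (auto simp: code_on_def partition_on_def)
    then show ?thesis
      by (force simp: image_image)
  qed
  then have bc: "shift i b = c"
    by (simp add: shift_def b_def map_idI)
  have "code_on ((+) i ` {1..length u - i}) (shift i b)"
    using c bc by (simp add: add.commute)
  then have "code_on {1..length u - i} b"
    by (simp only: code_on_shift)
  then have "b \<in> codes"
    by (rule codesI)
  then show ?thesis
    using that[of a b] a uac bc by (simp add: splits_def)
qed

lemma shuffles_shiftE:
  assumes "w \<in> shuffles (shift i u) (shift i v)"
  obtains w' where "w = shift i w'" "w' \<in> shuffles u v"
  using assms unfolding shift_def by (elim map_shufflesE) blast

lemma shift_in_shuffles: "w \<in> shuffles u v \<Longrightarrow> shift i w \<in> shuffles (shift i u) (shift i v)"
  unfolding shift_def by (rule map_in_shuffles)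

text \<open>Coassociativity on words: either side says that \<open>u\<close> is a shuffle of
  \<open>c\<close>, of \<open>a\<close> shifted by \<open>length c\<close>, and of \<open>b\<close>
  shifted by \<open>length c + length a\<close>. The intermediate word of either bracketing is a
  code by \<open>splits_codes\<close>.\<close>

lemma splits_assoc: "(\<exists>y. splits u c y \<and> splits y a b) \<longleftrightarrow> (\<exists>x. splits x c a \<and> splits u x b)"
proof
  assume "\<exists>y. splits u c y \<and> splits y a b"
  then obtain y where y: "splits u c y" "splits y a b" by blast
  have "shift (length c) y \<in> shuffles (shift (length c) a) (shift (length c + length a) b)"
    using y(2) shift_in_shuffles[of y a "shift (length a) b" "length c"] by (simp add: splits_def shift_shift)
  moreover have "u \<in> shuffles c (shift (length c) y)"
    using y(1) by (simp add: splits_def)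
  ultimately have "\<exists>z\<in>shuffles (shift (length c) a) (shift (length c + length a) b). u \<in> shuffles c z"
    by blast
  then obtain x where x: "x \<in> shuffles c (shift (length c) a)"
    "u \<in> shuffles x (shift (length c + length a) b)"
    unfolding shuffles_assoc by blast
  have "splits x c a"
    using x(1) y by (simp add: splits_def)
  moreover have "x \<in> codes" "length x = length c + length a" "b \<in> codes"
    using splits_codes[OF \<open>splits x c a\<close>] splits_length[OF \<open>splits x c a\<close>] splits_codes[OF y(2)]
    by simp_all
  then have "splits u x b"
    using x(2) by (simp add: splits_def)
  ultimately show "\<exists>x. splits x c a \<and> splits u x b"
    by blast
next
  assume "\<exists>x. splits x c a \<and> splits u x b"
  then obtain x where x: "splits x c a" "splits u x b" by blast
  have "x \<in> shuffles c (shift (length c) a)"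
    using x(1) by (simp add: splits_def)
  moreover have "u \<in> shuffles x (shift (length c) (shift (length a) b))"
    using x(2) splits_length[OF x(1)] by (simp add: splits_def shift_shift)
  ultimately have "\<exists>x\<in>shuffles c (shift (length c) a). u \<in> shuffles x (shift (length c) (shift (length a) b))"
    by blast
  then obtain z where z: "z \<in> shuffles (shift (length c) a) (shift (length c) (shift (length a) b))"
    "u \<in> shuffles c z"
    using shuffles_assoc by blast
  from z(1) obtain y where y: "z = shift (length c) y" "y \<in> shuffles a (shift (length a) b)"
    by (rule shuffles_shiftE)
  have c: "a \<in> codes" "b \<in> codes" "c \<in> codes"
    using splits_codes[OF x(1)] splits_codes[OF x(2)] by simp_all
  then have "splits y a b"
    using y(2) by (simp add: splits_def)
  moreover from this have "y \<in> codes"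
    using splits_codes by blast
  then have "splits u c y"
    using z(2) y(1) c by (simp add: splits_def)
  ultimately show "\<exists>y. splits u c y \<and> splits y a b" by blast
qed

lemma splits_Nil_left [simp]: "splits u [] b \<longleftrightarrow> u = b \<and> u \<in> codes"
  by (auto simp: splits_def)

lemma splits_conc: "a \<in> codes \<Longrightarrow> b \<in> codes \<Longrightarrow> splits (conc a b) a b"
  by (simp add: splits_def conc_def append_in_shuffles)

lemma conc_codes: "a \<in> codes \<Longrightarrow> b \<in> codes \<Longrightarrow> conc a b \<in> codes"
  using splits_conc splits_codes by blast

lemma length_conc [simp]: "length (conc a b) = length a + length b"
  by (simp add: conc_def)

lemma conc_Nil [simp]: "conc [] b = b" "conc a [] = a"
  by (simp_all add: conc_def)

lemma conc_assoc: "conc (conc a b) c = conc a (conc b c)"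
  by (simp add: conc_def shift_shift)

lemma conc_left_cancel [simp]: "conc a b = conc a c \<longleftrightarrow> b = c"
  by (simp add: conc_def)

lemma conc_codes_right: "conc a b \<in> codes \<Longrightarrow> a \<in> codes \<Longrightarrow> b \<in> codes"
proof -
  assume *: "conc a b \<in> codes" "a \<in> codes"
  have "{1..length a} \<union> {length a + 1..length a + length b} = {1..length (conc a b)}"
    by auto
  then have "code_on ({1..length a} \<union> {length a + 1..length a + length b}) (conc a b)"
    using * by (simp add: codes_def)
  then have "code_on {length a + 1..length a + length b} (shift (length a) b)"
    by (rule code_on_shuffles_right[where u = a])
       (use * in \<open>auto simp: conc_def append_in_shuffles codes_def\<close>)
  moreover have "{length a + 1..length a + length b} = (+) (length a) ` {1..length b}"
    by simp
  ultimately show ?thesis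
    using codesI[of "length b" b] code_on_shift[of "length a" "{1..length b}" b] by (simp add: add.commute)
qed

text \<open>Levi's property, the source of unique factorisation: of two prefixes the shorter begins
  the longer. The overlap \<open>e\<close> is cut out of \<open>x\<close> and is a code by
  \<open>conc_codes_right\<close>.\<close>

lemma conc_levi:
  assumes eq: "conc a x = conc a' x'" and le: "length a \<le> length a'" and codes: "a \<in> codes" "a' \<in> codes"
  obtains e where "e \<in> codes" "a' = conc a e" "x = conc e x'"
proof -
  define k where "k = length a' - length a"
  have "a' = take (length a') (conc a x)"
    by (simp add: eq) (simp add: conc_def)
  also have "\<dots> = a @ shift (length a) (take k x)"
    using le by (simp add: conc_def k_def take_shift)
  finally have a': "a' = conc a (take k x)"
    by (simp add: conc_def)
  with codes have e: "take k x \<in> codes"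
    using conc_codes_right by blast
  have "conc a x = conc a (conc (take k x) x')"
    using eq a' by (simp add: conc_assoc[symmetric])
  then have "x = conc (take k x) x'"
    by simp
  with a' e that show ?thesis by blast
qed

section \<open>Iterated splitting and unique factorisation\<close>

primrec msplits :: "nat set list \<Rightarrow> nat set list list \<Rightarrow> bool" where
  "msplits u [] \<longleftrightarrow> u = []"
| "msplits u (a # w) \<longleftrightarrow> (\<exists>b. splits u a b \<and> msplits b w)"

lemma msplits_codes: "msplits u w \<Longrightarrow> u \<in> codes \<and> w \<in> lists codes"
  by (induct w arbitrary: u) (auto dest: splits_codes)

text \<open>The recursion brackets to the right; by \<open>splits_assoc\<close> the sequence may be
  cut anywhere. Read for fixed \<open>w\<close> and \<open>w'\<close> this makes
  \<open>word_product\<close> multiplicative, read for fixed \<open>u\<close> it describes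
  deconcatenation of the splittings of \<open>u\<close>.\<close>

lemma msplits_append: "msplits u (w @ w') \<longleftrightarrow> (\<exists>a b. splits u a b \<and> msplits a w \<and> msplits b w')"
proof (induct w arbitrary: u)
  case Nil
  then show ?case
    using msplits_codes by auto
next
  case (Cons c w)
  have "msplits u ((c # w) @ w') \<longleftrightarrow>
      (\<exists>a b. (\<exists>y. splits u c y \<and> splits y a b) \<and> msplits a w \<and> msplits b w')"
    using Cons by auto
  also have "\<dots> \<longleftrightarrow> (\<exists>a b. (\<exists>x. splits x c a \<and> splits u x b) \<and> msplits a w \<and> msplits b w')"
    by (simp only: splits_assoc)
  also have "\<dots> \<longleftrightarrow> (\<exists>a b. splits u a b \<and> msplits a (c # w) \<and> msplits b w')"
    by auto
  finally show ?case .
qed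

lemma msplits_length: "msplits u w \<Longrightarrow> length u = (\<Sum>a\<leftarrow>w. length a)"
  by (induct w arbitrary: u) (auto dest: splits_length)

primrec concs :: "nat set list list \<Rightarrow> nat set list" where
  "concs [] = []"
| "concs (a # w) = conc a (concs w)"

lemma concs_codes: "w \<in> lists codes \<Longrightarrow> concs w \<in> codes"
  by (induct w) (auto simp: conc_codes)

lemma msplits_concs: "w \<in> lists codes \<Longrightarrow> msplits (concs w) w"
  by (induct w) (auto intro: splits_conc concs_codes)

lemma length_concs: "length (concs w) = (\<Sum>a\<leftarrow>w. length a)"
  by (induct w) auto

text \<open>Letters are sets, compared by their maxima: maxima grow by \<open>i\<close> under
  \<open>shift i\<close>, and they separate the letters of \<open>a\<close> from those of
  \<open>shift (length a) b\<close>.\<close>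

primrec inversions :: "nat set list \<Rightarrow> nat" where
  "inversions [] = 0"
| "inversions (B # u) = length (filter (\<lambda>C. Max C < Max B) u) + inversions u"

text \<open>Pairs inside \<open>u\<close> and inside \<open>v\<close> keep their order in a shuffle,
  so only a letter of \<open>v\<close> in front of a letter of \<open>u\<close> adds an
  inversion.\<close>

lemma inversions_shuffles:
  assumes "w \<in> shuffles u v" "\<forall>B\<in>set u. \<forall>C\<in>set v. Max B < Max C"
  shows "inversions u + inversions v \<le> inversions w \<and>
    (inversions w = inversions u + inversions v \<longrightarrow> w = u @ v)"
  using assms
proof (induct w arbitrary: u v)
  case Nil
  then show ?case by auto
next
  case (Cons z w)
  have filter_w: "length (filter P w) = length (filter P u') + length (filter P v')"
    if "w \<in> shuffles u' v'" for P u' v'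
    using that filter_shuffles[of P u' v'] length_shuffles by blast
  from Cons.prems(1) consider
      us where "u = z # us" "w \<in> shuffles us v"
    | vs where "v = z # vs" "w \<in> shuffles u vs"
    by (auto simp: Cons_in_shuffles_iff neq_Nil_conv)
  then show ?case
  proof cases
    case 1
    have "filter (\<lambda>C. Max C < Max z) v = []"
      using Cons.prems(2) 1 by (fastforce simp: filter_empty_conv)
    then have "length (filter (\<lambda>C. Max C < Max z) w) = length (filter (\<lambda>C. Max C < Max z) us)"
      using filter_w[OF 1(2), of "\<lambda>C. Max C < Max z"] by simp
    then show ?thesis
      using Cons.hyps[OF 1(2)] Cons.prems(2) 1 by simp
  next
    case 2
    \<comment> \<open>The head comes from \<open>v\<close> and exceeds every letter of
      \<open>u\<close>. This adds \<open>length u\<close> inversions, so equality can hold only if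
      \<open>u\<close> is empty.\<close>
    have "filter (\<lambda>C. Max C < Max z) u = u"
      using Cons.prems(2) 2 by simp
    then have f: "length (filter (\<lambda>C. Max C < Max z) w) = length u + length (filter (\<lambda>C. Max C < Max z) vs)"
      using filter_w[OF 2(2), of "\<lambda>C. Max C < Max z"] by simp
    have IH: "inversions u + inversions vs \<le> inversions w"
      using Cons.hyps[OF 2(2)] Cons.prems(2) 2 by simp
    show ?thesis
    proof (cases "u = []")
      case True
      then show ?thesis
        using Cons.prems(1) by simp
    next
      case False
      then show ?thesis
        using f IH 2 by (cases u) auto
    qed
  qed
qed

lemma inversions_shift:
  assumes "\<forall>B\<in>set u. finite B \<and> B \<noteq> {}"
  shows "inversions (shift i u) = inversions u"
proof -
  have Max: "Max ((+) i ` B) = i + Max B" if "finite B \<and> B \<noteq> {}" for B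
    using that mono_Max_commute[of "(+) i" B] by (simp add: monoI)
  have "length (filter (\<lambda>C. Max C < Max ((+) i ` B)) (shift i u)) = length (filter (\<lambda>C. Max C < Max B) u)"
    if "finite B \<and> B \<noteq> {}" "\<forall>B\<in>set u. finite B \<and> B \<noteq> {}" for B u
    using that(2) by (induct u) (simp_all add: Max[OF that(1)] Max)
  with assms show ?thesis
    by (induct u) simp_all
qed

lemma Max_less_Max_shift:
  assumes "a \<in> codes" "b \<in> codes" "B \<in> set a" "C \<in> set (shift (length a) b)"
  shows "Max B < Max C"
proof -
  have "Max B \<in> {1..length a}"
    using codes_block[OF assms(1,3)] Max_in by blast
  moreover have "Max C \<in> {length a + 1..length a + length b}"
    using shift_codes_block[OF assms(2,4)] Max_in by blast
  ultimately show ?thesis by simp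
qed

lemma inversions_splits:
  assumes "splits u a b"
  shows "inversions a + inversions b \<le> inversions u"
    and "inversions u = inversions a + inversions b \<Longrightarrow> u = conc a b"
proof -
  have a: "a \<in> codes" and b: "b \<in> codes" and u: "u \<in> shuffles a (shift (length a) b)"
    using assms by (auto simp: splits_def)
  have "inversions a + inversions (shift (length a) b) \<le> inversions u \<and>
    (inversions u = inversions a + inversions (shift (length a) b) \<longrightarrow> u = a @ shift (length a) b)"
    by (intro inversions_shuffles[OF u]) (use Max_less_Max_shift[OF a b] in blast)
  moreover have "inversions (shift (length a) b) = inversions b"
    using codes_block[OF b] by (intro inversions_shift) blast
  ultimately show "inversions a + inversions b \<le> inversions u"
    and "inversions u = inversions a + inversions b \<Longrightarrow> u = conc a b"
    by (auto simp: conc_def)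
qed

lemma inversions_append:
  assumes "\<forall>B\<in>set u. \<forall>C\<in>set v. Max B < Max C"
  shows "inversions (u @ v) = inversions u + inversions v"
  using assms
proof (induct u)
  case (Cons B u)
  have "filter (\<lambda>C. Max C < Max B) v = []"
    using Cons.prems by (fastforce simp: filter_empty_conv)
  with Cons show ?case by simp
qed simp

lemma inversions_conc:
  assumes a: "a \<in> codes" and b: "b \<in> codes"
  shows "inversions (conc a b) = inversions a + inversions b"
proof -
  have "inversions (conc a b) = inversions a + inversions (shift (length a) b)"
    unfolding conc_def by (intro inversions_append) (use Max_less_Max_shift[OF a b] in blast)
  also have "inversions (shift (length a) b) = inversions b"
    using codes_block[OF b] by (intro inversions_shift) blast
  finally show ?thesis .
qed

text \<open>Splitting off a factor never raises the total number of inversions and keeps it only for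
  a concatenation; equality for the whole sequence forces equality at each step. This strictness is
  what makes the matrix triangular.\<close>

lemma inversions_msplits:
  assumes "msplits u w" "u \<noteq> concs w"
  shows "inversions (concs w) < inversions u"
proof -
  have "inversions (concs w) \<le> inversions u \<and> (inversions u = inversions (concs w) \<longrightarrow> u = concs w)"
    using assms(1)
  proof (induct w arbitrary: u)
    case (Cons a w)
    then obtain b where b: "splits u a b" "msplits b w" by auto
    have "inversions (concs (a # w)) = inversions a + inversions (concs w)"
      using msplits_codes[OF Cons.prems] by (simp add: inversions_conc concs_codes)
    with Cons.hyps[OF b(2)] inversions_splits[OF b(1)] show ?case
      by auto
  qed simp
  with assms(2) show ?thesis by auto
qed

text \<open>A crude bound, used to keep the subtraction in the rank function of the freeness proof
  from truncating.\<close>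

lemma inversions_le: "inversions u \<le> length u * length u"
proof (induct u)
  case (Cons B u)
  have "length (filter (\<lambda>C. Max C < Max B) u) \<le> length u"
    by (rule length_filter_le)
  with Cons show ?case by (simp only: inversions.simps list.size mult_Suc mult_Suc_right add_Suc_right add_0_right)
qed simp

section \<open>Irreducible words and unique factorisation\<close>

definition irreducibles :: "nat set list set" where
  "irreducibles = {u\<in>codes. u \<noteq> [] \<and> (\<forall>a\<in>codes. \<forall>b\<in>codes. u = conc a b \<longrightarrow> a = [] \<or> b = [])}"

lemma irreducibles_codes: "irreducibles \<subseteq> codes"
  by (auto simp: irreducibles_def)

lemma concs_append: "concs (w @ w') = conc (concs w) (concs w')"
  by (induct w) (auto simp: conc_assoc)

lemma factorisation_exists:
  assumes "u \<in> codes"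
  shows "\<exists>w\<in>lists irreducibles. concs w = u"
  using assms
proof (induct "length u" arbitrary: u rule: less_induct)
  case less
  show ?case
  proof (cases "u = [] \<or> u \<in> irreducibles")
    case True
    then have "[] \<in> lists irreducibles \<and> concs [] = u \<or> [u] \<in> lists irreducibles \<and> concs [u] = u"
      by auto
    then show ?thesis by blast
  next
    case False
    then obtain a b where ab: "a \<in> codes" "b \<in> codes" "u = conc a b" "a \<noteq> []" "b \<noteq> []"
      using less.prems by (auto simp: irreducibles_def)
    then obtain v w where "v \<in> lists irreducibles" "concs v = a" "w \<in> lists irreducibles" "concs w = b"
      using less.hyps[of a] less.hyps[of b] by auto
    then show ?thesis
      using ab by (intro bexI[of _ "v @ w"]) (auto simp: concs_append)
  qed
qed

text \<open>By Levi's property \<open>a'\<close> is \<open>conc a e\<close>; irreducibility of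
  \<open>a'\<close> leaves only \<open>e = []\<close>, since \<open>a\<close> is not empty.\<close>

lemma conc_irreducible_eq:
  assumes "a \<in> irreducibles" "a' \<in> irreducibles" "conc a x = conc a' x'" "length a \<le> length a'"
  shows "a = a' \<and> x = x'"
proof -
  obtain e where e: "e \<in> codes" "a' = conc a e" "x = conc e x'"
    using assms conc_levi[of a x a' x'] by (auto simp: irreducibles_def)
  then have "e = []"
    using assms(1,2) by (auto simp: irreducibles_def)
  with e show ?thesis by simp
qed

lemma factorisation_unique:
  assumes "w \<in> lists irreducibles" "w' \<in> lists irreducibles" "concs w = concs w'"
  shows "w = w'"
  using assms
proof (induct w arbitrary: w')
  case Nil
  then show ?case
    by (cases w') (auto simp: irreducibles_def conc_def)
next
  case (Cons a w)
  then have "w' \<noteq> []"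
    by (auto simp: irreducibles_def conc_def)
  then obtain a' v where w': "w' = a' # v" by (auto simp: neq_Nil_conv)
  have irr: "a \<in> irreducibles" "a' \<in> irreducibles"
    using Cons.hyps(1) Cons.prems(1) w' by simp_all
  have eq: "conc a (concs w) = conc a' (concs v)"
    using Cons.prems(2) w' by simp
  have "a = a' \<and> concs w = concs v"
  proof (cases "length a \<le> length a'")
    case True
    with conc_irreducible_eq[OF irr eq] show ?thesis by blast
  next
    case False
    with conc_irreducible_eq[OF irr(2,1) eq[symmetric]] show ?thesis by auto
  qed
  moreover have "v \<in> lists irreducibles"
    using Cons.prems w' by simp
  ultimately show ?case
    using Cons.hyps(3)[of v] w' by simp
qed

lemma bij_betw_concs: "bij_betw concs (lists irreducibles) codes"
proof (rule bij_betwI')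
  show "\<And>w. w \<in> lists irreducibles \<Longrightarrow> concs w \<in> codes"
    using concs_codes lists_mono[OF irreducibles_codes] by blast
  show "\<And>u. u \<in> codes \<Longrightarrow> \<exists>w\<in>lists irreducibles. u = concs w"
    using factorisation_exists by fastforce
qed (use factorisation_unique in blast)

section \<open>Finiteness of the rows and columns of the splitting matrix\<close>

lemma finite_codes_length: "finite {u\<in>codes. length u \<le> n}"
proof (rule finite_subset)
  show "{u\<in>codes. length u \<le> n} \<subseteq> {u. set u \<subseteq> Pow {1..n} \<and> length u \<le> n}"
  proof
    fix u
    assume "u \<in> {u\<in>codes. length u \<le> n}"
    then show "u \<in> {u. set u \<subseteq> Pow {1..n} \<and> length u \<le> n}"
      using codes_block(2)[of u] by fastforce
  qed
  show "finite {u. set u \<subseteq> Pow {1..n} \<and> length u \<le> n}"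
    by (rule finite_lists_length_le) simp
qed

lemma finite_msplits_left: "finite {u. msplits u w}"
proof (rule finite_subset)
  show "{u. msplits u w} \<subseteq> {u\<in>codes. length u \<le> (\<Sum>a\<leftarrow>w. length a)}"
    using msplits_codes msplits_length by fastforce
qed (rule finite_codes_length)

text \<open>Irreducible words are not empty, so a sequence cannot be padded: it has at most
  \<open>length u\<close> entries, each of length at most \<open>length u\<close>.\<close>

lemma finite_msplits_right: "finite {w\<in>lists irreducibles. msplits u w}"
proof (rule finite_subset)
  show "{w\<in>lists irreducibles. msplits u w} \<subseteq>
      {w. set w \<subseteq> {u'\<in>codes. length u' \<le> length u} \<and> length w \<le> length u}"
  proof
    fix w
    assume w: "w \<in> {w\<in>lists irreducibles. msplits u w}"
    then have u: "length u = (\<Sum>a\<leftarrow>w. length a)"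
      using msplits_length by blast
    have "length a \<ge> 1" if "a \<in> set w" for a
    proof -
      have "a \<in> irreducibles" using w that by auto
      then show ?thesis
        by (cases a) (auto simp: irreducibles_def)
    qed
    then have "(\<Sum>a\<leftarrow>w. 1) \<le> (\<Sum>a\<leftarrow>w. length a)"
      by (intro sum_list_mono) auto
    then have "length w \<le> length u"
      using u by (simp add: sum_list_triv)
    moreover have "length a \<le> length u" if "a \<in> set w" for a
      using that u member_le_sum_list[of "length a" "map length w"] by auto
    ultimately show "w \<in> {w. set w \<subseteq> {u'\<in>codes. length u' \<le> length u} \<and> length w \<le> length u}"
      using w msplits_codes by fastforce
  qed
  show "finite {w. set w \<subseteq> {u'\<in>codes. length u' \<le> length u} \<and> length w \<le> length u}"
    by (rule finite_lists_length_le) (rule finite_codes_length)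
qed

section \<open>Shuffles and shuffle permutations\<close>

lemma nths_eq_map_filter: "nths w S = map ((!) w) (filter (\<lambda>k. k \<in> S) [0..<length w])"
proof (induct w rule: rev_induct)
  case (snoc x w)
  have "map ((!) (w @ [x])) (filter (\<lambda>k. k \<in> S) [0..<length w]) = map ((!) w) (filter (\<lambda>k. k \<in> S) [0..<length w])"
    by (intro map_cong) (auto simp: nth_append)
  with snoc show ?case
    by (simp add: nths_append)
qed simp

lemma nths_eq_map:
  assumes "sorted_wrt (<) ns" "set ns = {k\<in>S. k < length w}"
  shows "nths w S = map ((!) w) ns"
proof -
  have "filter (\<lambda>k. k \<in> S) [0..<length w] = ns"
    by (rule sorted_distinct_set_unique) (use assms in \<open>auto simp: strict_sorted_iff sorted_wrt_filter\<close>)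
  then show ?thesis
    by (simp add: nths_eq_map_filter)
qed

lemma in_shuffles_nths: "w \<in> shuffles (nths w S) (nths w (- S))"
proof (induct w arbitrary: S)
  case (Cons x w)
  have "{j. Suc j \<in> - S} = - {j. Suc j \<in> S}" by auto
  then show ?case
    using Cons[of "{j. Suc j \<in> S}"]
    by (auto simp: nths_Cons intro: Cons_in_shuffles_leftI Cons_in_shuffles_rightI)
qed simp

text \<open>The set \<open>S\<close> records the positions, counted from 0, at which the shuffle
  takes a letter of \<open>u\<close>.\<close>

lemma shuffles_nthsE:
  assumes "w \<in> shuffles u v"
  obtains S where "u = nths w S" "v = nths w (- S)"
  using assms
proof (induct w arbitrary: u v thesis)
  case Nil
  then show ?case by auto
next
  case (Cons z w)
  \<comment> \<open>A new head moves the recorded positions up by one, and 0 is added exactly if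
    that head comes from \<open>u\<close>.\<close>
  have c: "{j. Suc j \<in> insert 0 (Suc ` T)} = T" "{j. Suc j \<in> - insert 0 (Suc ` T)} = - T"
    "{j. Suc j \<in> Suc ` T} = T" "{j. Suc j \<in> - Suc ` T} = - T" for T
    by auto
  from Cons.prems(2) consider
      us where "u = z # us" "w \<in> shuffles us v"
    | vs where "v = z # vs" "w \<in> shuffles u vs"
    by (auto simp: Cons_in_shuffles_iff neq_Nil_conv)
  then show ?case
  proof cases
    case 1
    then obtain S where "us = nths w S" "v = nths w (- S)"
      using Cons.hyps by blast
    with 1 show ?thesis
      by (intro Cons.prems(1)[of "insert 0 (Suc ` S)"]) (simp_all only: nths_Cons c, auto)
  next
    case 2
    then obtain S where "u = nths w S" "vs = nths w (- S)"
      using Cons.hyps by blast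
    with 2 show ?thesis
      by (intro Cons.prems(1)[of "Suc ` S"]) (simp_all only: nths_Cons c, auto)
  qed
qed

text \<open>The letter at position \<open>k\<close> moves to position \<open>\<xi> k\<close>.
  Permutations act on positions counted from 1 and lists are indexed from 0, hence the subtraction
  of 1.\<close>

definition permute_word :: "(nat \<Rightarrow> nat) \<Rightarrow> nat set list \<Rightarrow> nat set list" where
  "permute_word \<xi> v = map (\<lambda>x. v ! (inv_into UNIV \<xi> x - 1)) [1..<Suc (length v)]"

lemma length_permute_word [simp]: "length (permute_word \<xi> v) = length v"
  by (simp add: permute_word_def del: upt_Suc)

lemma permute_word_nth:
  assumes "\<xi> permutes {1..length v}" "k \<in> {1..length v}"
  shows "permute_word \<xi> v ! (\<xi> k - 1) = v ! (k - 1)"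
proof -
  have "\<xi> k \<in> {1..length v}"
    using permutes_in_image[OF assms(1)] assms(2) by simp
  then obtain j where j: "\<xi> k = Suc j" "j < length v"
    by (cases "\<xi> k") auto
  have "permute_word \<xi> v ! j = v ! (inv_into UNIV \<xi> (Suc j) - 1)"
    using j(2) by (simp add: permute_word_def del: upt_Suc)
  also have "inv_into UNIV \<xi> (Suc j) = k"
    using permutes_inverses(2)[OF assms(1), of k] j(1) by simp
  finally show ?thesis
    by (simp add: j(1))
qed

lemma permute_word_eqI:
  assumes \<xi>: "\<xi> permutes {1..length v}" and w: "length w = length v"
    and eq: "\<And>k. k \<in> {1..length v} \<Longrightarrow> w ! (\<xi> k - 1) = v ! (k - 1)"
  shows "permute_word \<xi> v = w"
proof (rule nth_equalityI)
  fix j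
  assume "j < length (permute_word \<xi> v)"
  then have "Suc j \<in> \<xi> ` {1..length v}"
    using permutes_image[OF \<xi>] by simp
  then obtain k where k: "k \<in> {1..length v}" "j = \<xi> k - 1"
    by (metis diff_Suc_1 imageE)
  then show "permute_word \<xi> v ! j = w ! j"
    using permute_word_nth[OF \<xi>, of k] eq by simp
qed (use w in simp)

text \<open>A strictly increasing function on an interval lists its image in sorted order, so the
  image determines it.\<close>

lemma strict_mono_on_eqI:
  assumes "strict_mono_on {a..b} f" "strict_mono_on {a..b} g" "f ` {a..b} = g ` {a..b}"
    "k \<in> {a..b::nat}"
  shows "f k = (g k :: nat)"
proof -
  have sorted: "sorted_wrt (<) (map h [a..<Suc b])" if "strict_mono_on {a..b} h" for h :: "nat \<Rightarrow> nat"
    unfolding sorted_wrt_map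
  proof (rule sorted_wrt_mono_rel[of _ "(<)"])
    show "h x < h y" if "x \<in> set [a..<Suc b]" "y \<in> set [a..<Suc b]" "x < y" for x y
      using that \<open>strict_mono_on {a..b} h\<close> by (auto simp: strict_mono_on_def simp del: upt_Suc)
  qed (rule sorted_wrt_upt)
  have "map f [a..<Suc b] = map g [a..<Suc b]"
    by (rule sorted_distinct_set_unique)
       (use sorted[OF assms(1)] sorted[OF assms(2)] assms(3) in
         \<open>auto simp: strict_sorted_iff atLeastLessThanSuc_atLeastAtMost simp del: upt_Suc\<close>)
  with assms(4) show ?thesis
    by (auto simp del: upt_Suc)
qed

lemma Sh_image:
  assumes "\<xi> \<in> Sh i m"
  shows "\<xi> ` {i + 1..i + m} = {1..i + m} - \<xi> ` {1..i}"
proof -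
  have \<xi>: "\<xi> permutes {1..i + m}"
    using assms by (simp add: Sh_def)
  have "{i + 1..i + m} = {1..i + m} - {1..i}" by auto
  then show ?thesis
    using image_set_diff[OF permutes_inj[OF \<xi>], of "{1..i + m}" "{1..i}"] permutes_image[OF \<xi>]
    by metis
qed

text \<open>The increasing positions \<open>\<xi> 1\<close>, ..., \<open>\<xi> i\<close> carry the
  letters of \<open>a\<close> in order, and the complementary positions, also increasing, those of
  \<open>b\<close>.\<close>

lemma permute_word_in_shuffles:
  assumes \<xi>: "\<xi> \<in> Sh (length a) (length b)"
  shows "permute_word \<xi> (a @ b) \<in> shuffles a b"
proof -
  define i m v w where "i = length a" and "m = length b" and "v = a @ b" and "w = permute_word \<xi> v"
  have perm: "\<xi> permutes {1..i + m}" and mono: "strict_mono_on {1..i} \<xi>" "strict_mono_on {i + 1..i + m} \<xi>"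
    using \<xi> by (auto simp: Sh_def i_def m_def)
  have len: "length v = i + m" "length w = i + m"
    by (simp_all add: v_def w_def i_def m_def)
  define S where "S = (\<lambda>k. \<xi> k - 1) ` {1..i}"
  have pos: "\<xi> k \<in> {1..i + m}" if "k \<in> {1..i + m}" for k
    using that permutes_in_image[OF perm] by simp
  have sorted: "sorted_wrt (<) (map (\<lambda>k. \<xi> k - 1) [l..<Suc h])"
    if mono: "strict_mono_on {l..h} \<xi>" and lh: "1 \<le> l" "h \<le> i + m" for l h
    unfolding sorted_wrt_map
  proof (rule sorted_wrt_mono_rel[of _ "(<)"])
    fix x y
    assume xy: "x \<in> set [l..<Suc h]" "y \<in> set [l..<Suc h]" "x < y"
    then have "\<xi> x < \<xi> y"
      using mono by (auto simp: strict_mono_on_def simp del: upt_Suc)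
    moreover have "\<xi> x \<ge> 1"
      using pos[of x] xy lh by (auto simp del: upt_Suc)
    ultimately show "\<xi> x - 1 < \<xi> y - 1" by simp
  qed (rule sorted_wrt_upt)
  have nth: "map ((!) w) (map (\<lambda>k. \<xi> k - 1) [l..<Suc h]) = map (\<lambda>k. v ! (k - 1)) [l..<Suc h]"
    if "1 \<le> l" "h \<le> i + m" for l h
    using that permute_word_nth[of \<xi> v] perm len by (auto simp: w_def simp del: upt_Suc)
  have "nths w S = map ((!) w) (map (\<lambda>k. \<xi> k - 1) [1..<Suc i])"
  proof (rule nths_eq_map)
    show "set (map (\<lambda>k. \<xi> k - 1) [1..<Suc i]) = {k \<in> S. k < length w}"
      using pos len by (force simp: S_def simp del: upt_Suc)
  qed (rule sorted[OF mono(1)], auto)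
  also have "\<dots> = map (\<lambda>k. v ! (k - 1)) [1..<Suc i]"
    by (rule nth) auto
  also have "\<dots> = a"
    by (rule nth_equalityI) (auto simp: v_def i_def nth_append simp del: upt_Suc)
  finally have a: "nths w S = a" .
  have "nths w (- S) = map ((!) w) (map (\<lambda>k. \<xi> k - 1) [i + 1..<Suc (i + m)])"
  proof (rule nths_eq_map)
    have "(\<lambda>k. k - 1) ` (\<xi> ` {i + 1..i + m}) = (\<lambda>k. k - 1) ` ({1..i + m} - \<xi> ` {1..i})"
      using Sh_image[OF \<xi>] by (simp add: i_def m_def)
    also have "\<dots> = (\<lambda>k. k - 1) ` {1..i + m} - (\<lambda>k. k - 1) ` \<xi> ` {1..i}"
      by (rule inj_on_image_set_diff[where C = "{1..i + m}"]) (use pos in \<open>auto simp: inj_on_def\<close>)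
    also have "(\<lambda>k. k - 1) ` {1..i + m} = {..<i + m}"
      by (force simp: image_iff intro: bexI[of _ "Suc _"])
    finally have "(\<lambda>k. \<xi> k - 1) ` {i + 1..i + m} = {..<i + m} - S"
      by (simp add: S_def image_image)
    then show "set (map (\<lambda>k. \<xi> k - 1) [i + 1..<Suc (i + m)]) = {k \<in> - S. k < length w}"
      using len by (auto simp: atLeastLessThanSuc_atLeastAtMost simp del: upt_Suc)
  qed (rule sorted[OF mono(2)], auto)
  also have "\<dots> = map (\<lambda>k. v ! (k - 1)) [i + 1..<Suc (i + m)]"
    by (rule nth) auto
  also have "\<dots> = b"
    by (rule nth_equalityI) (auto simp: v_def i_def m_def nth_append simp del: upt_Suc)
  finally have b: "nths w (- S) = b" .
  show ?thesis
    using in_shuffles_nths[of w S] a b by (simp add: w_def v_def)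
qed

lemma shuffles_permute_wordE:
  assumes "w \<in> shuffles a b"
  obtains \<xi> where "\<xi> \<in> Sh (length a) (length b)" "permute_word \<xi> (a @ b) = w"
proof -
  obtain S where S: "a = nths w S" "b = nths w (- S)"
    using assms by (rule shuffles_nthsE)
  define n where "n = length w"
  define ns where "ns = filter (\<lambda>k. k \<in> S) [0..<n]"
  define ms where "ms = filter (\<lambda>k. k \<notin> S) [0..<n]"
  \<comment> \<open>The shuffle permutation as a list: positions of \<open>w\<close> counted from 0,
    first those filled from \<open>a\<close> and then those filled from \<open>b\<close>, each group
    increasing.\<close>
  define L where "L = ns @ ms"
  have a: "a = map ((!) w) ns" and b: "b = map ((!) w) ms"
    unfolding S ns_def ms_def nths_eq_map_filter n_def by simp_all
  have len: "length L = n" "length ns = length a" "length ms = length b" "n = length a + length b"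
    using length_shuffles[OF assms] by (simp_all add: L_def a b n_def)
  have sorted: "sorted_wrt (<) ns" "sorted_wrt (<) ms"
    by (simp_all add: ns_def ms_def sorted_wrt_filter)
  have L: "distinct L" "set L = {..<n}"
    by (auto simp: L_def ns_def ms_def)
  \<comment> \<open>The identity outside \<open>{1..n}\<close> is demanded by
    \<open>permutes\<close>; \<open>Suc\<close> and \<open>k - 1\<close> pass between counting from
    1 and from 0.\<close>
  define \<xi> where "\<xi> k = (if k \<in> {1..n} then Suc (L ! (k - 1)) else k)" for k
  have L': "bij_betw ((!) L) {..<n} {..<n}"
    using bij_betw_nth[OF L(1), of "{..<n}" "{..<n}"] len L(2) by simp
  have pred: "bij_betw (\<lambda>k. k - 1) {1..n} {..<n}"
    by (rule bij_betw_byWitness[where f' = Suc]) auto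
  have suc: "bij_betw Suc {..<n} {1..n}"
    by (rule bij_betw_byWitness[where f' = "\<lambda>k. k - 1"]) auto
  have "bij_betw (Suc \<circ> ((!) L \<circ> (\<lambda>k. k - 1))) {1..n} {1..n}"
    using bij_betw_trans[OF bij_betw_trans[OF pred L'] suc] .
  then have "bij_betw \<xi> {1..n} {1..n}"
    by (rule bij_betw_cong[THEN iffD1, rotated]) (simp add: \<xi>_def)
  then have perm: "\<xi> permutes {1..n}"
    by (rule bij_imp_permutes) (auto simp: \<xi>_def)
  have "strict_mono_on {1..length a} \<xi>"
  proof (rule strict_mono_onI)
    fix r s
    assume "r \<in> {1..length a}" "s \<in> {1..length a}" "r < s"
    then show "\<xi> r < \<xi> s"
      using sorted_wrt_nth_less[OF sorted(1), of "r - 1" "s - 1"] len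
      by (cases r; cases s) (auto simp: \<xi>_def L_def nth_append)
  qed
  moreover have "strict_mono_on {length a + 1..length a + length b} \<xi>"
  proof (rule strict_mono_onI)
    fix r s
    assume "r \<in> {length a + 1..length a + length b}" "s \<in> {length a + 1..length a + length b}" "r < s"
    then show "\<xi> r < \<xi> s"
      using sorted_wrt_nth_less[OF sorted(2), of "r - 1 - length a" "s - 1 - length a"] len
      by (cases r; cases s) (auto simp: \<xi>_def L_def nth_append)
  qed
  ultimately have "\<xi> \<in> Sh (length a) (length b)"
    using perm len by (simp add: Sh_def)
  moreover have "permute_word \<xi> (a @ b) = w"
  proof (rule permute_word_eqI)
    fix k
    assume k: "k \<in> {1..length (a @ b)}"
    have "(a @ b) ! (k - 1) = map ((!) w) L ! (k - 1)"
      by (simp add: a b L_def)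
    also have "\<dots> = w ! (L ! (k - 1))"
      using k len by (intro nth_map) auto
    finally show "w ! (\<xi> k - 1) = (a @ b) ! (k - 1)"
      using k len by (simp add: \<xi>_def)
  qed (use perm len n_def in simp_all)
  ultimately show ?thesis
    using that by blast
qed

text \<open>Disjoint letters reveal which positions of the permuted word come from \<open>a\<close>.
  This fixes the image of \<open>{1..i}\<close> and of its complement, and monotonicity does the
  rest.\<close>

lemma permute_word_inj:
  assumes disj: "set a \<inter> set b = {}"
    and \<xi>: "\<xi> \<in> Sh (length a) (length b)" and \<zeta>: "\<zeta> \<in> Sh (length a) (length b)"
    and eq: "permute_word \<xi> (a @ b) = permute_word \<zeta> (a @ b)"
  shows "\<xi> = \<zeta>"
proof -
  define i m where "i = length a" and "m = length b"
  have im: "length (a @ b) = i + m" by (simp add: i_def m_def)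
  have image: "\<xi> ` {1..i} = {x\<in>{1..i + m}. permute_word \<xi> (a @ b) ! (x - 1) \<in> set a}"
    if \<xi>: "\<xi> \<in> Sh i m" for \<xi>
  proof -
    have perm: "\<xi> permutes {1..i + m}"
      using \<xi> by (simp add: Sh_def)
    have nth: "permute_word \<xi> (a @ b) ! (\<xi> k - 1) \<in> set a \<longleftrightarrow> k \<le> i" if "k \<in> {1..i + m}" for k
    proof -
      have "permute_word \<xi> (a @ b) ! (\<xi> k - 1) = (a @ b) ! (k - 1)"
        using permute_word_nth[of \<xi> "a @ b" k] perm that im by simp
      moreover have "(a @ b) ! (k - 1) \<in> set b" if "\<not> k \<le> i"
        using that \<open>k \<in> _\<close> by (auto simp: nth_append i_def m_def)
      moreover have "(a @ b) ! (k - 1) \<in> set a" if "k \<le> i"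
        using that \<open>k \<in> _\<close> by (auto simp: nth_append i_def)
      ultimately show ?thesis
        using disj by auto
    qed
    have "{x\<in>{1..i + m}. permute_word \<xi> (a @ b) ! (x - 1) \<in> set a} =
        {x\<in>\<xi> ` {1..i + m}. permute_word \<xi> (a @ b) ! (x - 1) \<in> set a}"
      by (simp only: permutes_image[OF perm])
    also have "\<dots> = \<xi> ` {k\<in>{1..i + m}. permute_word \<xi> (a @ b) ! (\<xi> k - 1) \<in> set a}"
      by auto
    also have "{k\<in>{1..i + m}. permute_word \<xi> (a @ b) ! (\<xi> k - 1) \<in> set a} = {1..i}"
      using nth by auto
    finally show ?thesis by simp
  qed
  have 1: "\<xi> ` {1..i} = \<zeta> ` {1..i}"
    using image[of \<xi>] image[of \<zeta>] \<xi> \<zeta> eq by (simp add: i_def m_def)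
  have 2: "\<xi> ` {i + 1..i + m} = \<zeta> ` {i + 1..i + m}"
    using Sh_image[of \<xi> i m] Sh_image[of \<zeta> i m] \<xi> \<zeta> 1 by (simp add: i_def m_def)
  show ?thesis
  proof
    fix k
    consider "k \<in> {1..i}" | "k \<in> {i + 1..i + m}" | "k \<notin> {1..i + m}" by fastforce
    then show "\<xi> k = \<zeta> k"
    proof cases
      case 1
      then show ?thesis
        by (rule strict_mono_on_eqI[rotated 3]) (use \<xi> \<zeta> \<open>\<xi> ` {1..i} = _\<close> in \<open>auto simp: Sh_def i_def\<close>)
    next
      case 2
      then show ?thesis
        by (rule strict_mono_on_eqI[rotated 3])
           (use \<xi> \<zeta> \<open>\<xi> ` {i + 1..i + m} = _\<close> in \<open>auto simp: Sh_def i_def m_def\<close>)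
    next
      case 3
      then show ?thesis
        using \<xi> \<zeta> permutes_not_in[of \<xi> "{1..i + m}" k] permutes_not_in[of \<zeta> "{1..i + m}" k]
        by (simp add: Sh_def i_def m_def)
    qed
  qed
qed

text \<open>Turns the sum over \<open>Sh\<close> in the product of the Hopf algebra into a sum over
  shuffles of words.\<close>

lemma bij_betw_permute_word:
  assumes "set a \<inter> set b = {}"
  shows "bij_betw (\<lambda>\<xi>. permute_word \<xi> (a @ b)) (Sh (length a) (length b)) (shuffles a b)"
  by (rule bij_betwI')
     (use assms permute_word_inj permute_word_in_shuffles shuffles_permute_wordE in \<open>blast+\<close>)

section \<open>Uniform block permutations as words\<close>

definition positions :: "nat set list \<Rightarrow> nat set \<Rightarrow> nat set" where
  "positions u B = Suc ` {j. j < length u \<and> u ! j = B}"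

lemma positions_iff:
  "Suc j \<in> positions u B \<longleftrightarrow> j < length u \<and> u ! j = B" "x \<in> positions u B \<Longrightarrow> x > 0"
  by (auto simp: positions_def)

lemma positions_eq: "positions u B = {x\<in>{1..length u}. u ! (x - 1) = B}"
  by (force simp: positions_def image_iff intro: exI[of _ "_ - 1"])

definition ubp_of :: "nat set list \<Rightarrow> ubp" where
  "ubp_of u = (\<lambda>B. (positions u B, B)) ` set u"

lemma Range_ubp_of [simp]: "Range (ubp_of u) = set u"
  by (auto simp: ubp_of_def)

lemma Domain_ubp_of [simp]: "Domain (ubp_of u) = positions u ` set u"
  by (auto simp: ubp_of_def)

lemma positions_eq_empty: "positions u B = {} \<longleftrightarrow> B \<notin> set u"
  by (auto simp: positions_def in_set_conv_nth)

lemma positions_disjoint: "B \<noteq> C \<Longrightarrow> positions u B \<inter> positions u C = {}"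
  by (auto simp: positions_def)

lemma positions_subset_iff: "B \<in> set u \<Longrightarrow> positions u B \<subseteq> positions u C \<longleftrightarrow> B = C"
  using positions_disjoint[of B C u] positions_eq_empty[of u B] by blast

lemma Union_positions: "\<Union>(positions u ` set u) = {1..length u}"
proof -
  have "\<Union>(positions u ` set u) = Suc ` {..<length u}"
    by (force simp: positions_def)
  then show ?thesis
    by (simp only: image_Suc_lessThan)
qed

lemma card_positions: "card (positions u B) = count (mset u) B"
proof -
  have "card (positions u B) = card {j. j < length u \<and> u ! j = B}"
    by (simp add: positions_def card_image)
  also have "\<dots> = length (filter (\<lambda>C. C = B) u)"
    by (simp add: length_filter_conv_card)
  also have "\<dots> = count (mset u) B"
    by (induct u) auto
  finally show ?thesis .
qed

lemma partition_on_positions: "partition_on {1..length u} (positions u ` set u)"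
  unfolding partition_on_def disjoint_def
proof (intro conjI ballI impI)
  show "\<Union>(positions u ` set u) = {1..length u}"
    by (rule Union_positions)
  show "p \<inter> q = {}" if p: "p \<in> positions u ` set u" and q: "q \<in> positions u ` set u" and "p \<noteq> q" for p q
  proof -
    obtain B C where "p = positions u B" "q = positions u C"
      using p q by (elim imageE)
    then show ?thesis
      using \<open>p \<noteq> q\<close> positions_disjoint[of B C u] by auto
  qed
  show "{} \<notin> positions u ` set u"
    using positions_eq_empty by (metis imageE)
qed

lemma ubp_of_ubps:
  assumes u: "u \<in> codes"
  shows "ubp_of u \<in> ubps (length u)"
proof -
  have "partition_on {1..length u} (set u)" "\<forall>B\<in>set u. count (mset u) B = card B"
    using u by (simp_all add: codes_def code_on_def)
  moreover have "single_valued (ubp_of u)"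
    using positions_subset_iff by (fastforce simp: single_valued_def ubp_of_def)
  moreover have "single_valued ((ubp_of u)\<inverse>)"
    by (auto simp: single_valued_def ubp_of_def)
  ultimately show ?thesis
    using partition_on_positions[of u]
    by (auto simp: ubps_def ubp_of_def card_positions Domain_fst Range_snd image_image)
qed

lemma ubp_deg_ubps: "f \<in> ubps n \<Longrightarrow> ubp_deg f = n"
  by (auto simp: ubps_def ubp_deg_def partition_on_def)

lemma ubp_deg_ubp_of [simp]: "ubp_deg (ubp_of u) = length u"
  by (simp add: ubp_deg_def Union_positions)

lemma ubp_of_inj:
  assumes "ubp_of u = ubp_of v"
  shows "u = v"
proof (rule nth_equalityI)
  show len: "length u = length v"
    using assms ubp_deg_ubp_of by metis
  fix j
  assume j: "j < length u"
  then have "(positions u (u ! j), u ! j) \<in> ubp_of v"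
    unfolding assms[symmetric] by (simp add: ubp_of_def)
  then have "positions u (u ! j) = positions v (u ! j)"
    by (auto simp: ubp_of_def)
  moreover have "Suc j \<in> positions u (u ! j)"
    using j by (simp add: positions_iff)
  ultimately show "u ! j = v ! j"
    by (simp add: positions_iff)
qed

lemma ubps_converse [simp]: "f\<inverse> \<in> ubps n \<longleftrightarrow> f \<in> ubps n"
proof -
  have "f\<inverse> \<in> ubps n" if "f \<in> ubps n" for f
    using that by (fastforce simp: ubps_def)
  from this[of f] this[of "f\<inverse>"] show ?thesis by auto
qed

text \<open>The letter at position \<open>x\<close> is the image of the domain block containing
  \<open>x\<close>. Injectivity of \<open>f\<close> ensures that all positions of one letter lie in
  a single domain block.\<close>

lemma ubps_codeE:
  assumes f: "f \<in> ubps n"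
  obtains u where "u \<in> codes" "length u = n" "f = ubp_of u"
proof -
  have dom: "partition_on {1..n} (Domain f)" and ran: "partition_on {1..n} (Range f)"
    and sv: "single_valued f" "single_valued (f\<inverse>)" and card: "\<And>A B. (A, B) \<in> f \<Longrightarrow> card A = card B"
    using f by (auto simp: ubps_def)
  \<comment> \<open>The choice is unique on \<open>{1..n}\<close>: domain blocks are disjoint and
    \<open>f\<close> is single-valued.\<close>
  define b where "b x = (SOME B. \<exists>A. (A, B) \<in> f \<and> x \<in> A)" for x
  define u where "u = map b [1..<Suc n]"
  have len: "length u = n"
    by (simp add: u_def)
  have b_eq: "b x = B" if "(A, B) \<in> f" "x \<in> A" for x A B
  proof -
    have "\<exists>A. (A, b x) \<in> f \<and> x \<in> A"
      unfolding b_def by (rule someI_ex) (use that in blast)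
    then obtain A' where A': "(A', b x) \<in> f" "x \<in> A'" by blast
    then have "A' = A"
      using dom that unfolding partition_on_def disjoint_def by blast
    with A' that sv(1) show ?thesis
      by (auto simp: single_valued_def)
  qed
  have nth: "u ! (x - 1) = b x" if "x \<in> {1..n}" for x
    using that by (cases x) (auto simp: u_def simp del: upt_Suc)
  have ex: "\<exists>A B. (A, B) \<in> f \<and> x \<in> A" if "x \<in> {1..n}" for x
    using that partition_onD1[OF dom] by blast
  have pos: "positions u B = A" if AB: "(A, B) \<in> f" for A B
  proof
    show "A \<subseteq> positions u B"
    proof
      fix x
      assume x: "x \<in> A"
      then have "x \<in> {1..n}"
        using AB partition_onD1[OF dom] by blast
      then show "x \<in> positions u B"
        using b_eq[OF AB x] nth[of x] len by (simp add: positions_eq)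
    qed
    show "positions u B \<subseteq> A"
    proof
      fix x
      assume x: "x \<in> positions u B"
      then have x': "x \<in> {1..n}" "b x = B"
        using nth[of x] len by (auto simp: positions_eq)
      then obtain A' B' where "(A', B') \<in> f" "x \<in> A'"
        using ex by blast
      then have "B' = B"
        using b_eq[of A' B' x] x' by simp
      then have "A' = A"
        using AB sv(2) \<open>(A', B') \<in> f\<close> unfolding single_valued_def by blast
      then show "x \<in> A"
        using \<open>x \<in> A'\<close> by simp
    qed
  qed
  have set: "set u = Range f"
  proof
    show "set u \<subseteq> Range f"
    proof
      fix B
      assume "B \<in> set u"
      then obtain x where x: "x \<in> {1..n}" "B = b x"
        by (auto simp: u_def atLeastLessThanSuc_atLeastAtMost simp del: upt_Suc)
      with ex[OF x(1)] b_eq show "B \<in> Range f" by blast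
    qed
    show "Range f \<subseteq> set u"
    proof
      fix B
      assume "B \<in> Range f"
      then obtain A where A: "(A, B) \<in> f" by blast
      then have "A \<noteq> {}"
        using partition_onD3[OF dom] by blast
      then show "B \<in> set u"
        using pos[OF A] positions_eq_empty by blast
    qed
  qed
  have eq: "f = ubp_of u"
  proof
    show "f \<subseteq> ubp_of u"
    proof
      fix p
      assume "p \<in> f"
      then obtain A B where p: "p = (A, B)" "(A, B) \<in> f"
        by (cases p) blast
      then have "B \<in> set u"
        unfolding set by blast
      with p pos[OF p(2)] show "p \<in> ubp_of u"
        by (simp add: ubp_of_def image_iff)
    qed
    show "ubp_of u \<subseteq> f"
    proof
      fix p
      assume "p \<in> ubp_of u"
      then obtain B where B: "B \<in> set u" "p = (positions u B, B)"
        unfolding ubp_of_def by blast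
      then obtain A where "(A, B) \<in> f"
        unfolding set by blast
      with B pos show "p \<in> f" by auto
    qed
  qed
  have "count (mset u) B = card B" if B: "B \<in> set u" for B
  proof -
    obtain A where "(A, B) \<in> f"
      using B unfolding set by blast
    with pos[OF this] card[OF this] show ?thesis
      by (simp add: card_positions[symmetric])
  qed
  then have "u \<in> codes"
    using ran by (simp add: codes_def code_on_def len set)
  with len eq that show ?thesis by blast
qed

lemma bij_betw_ubp_of: "bij_betw ubp_of {u\<in>codes. length u = n} (ubps n)"
proof (rule bij_betwI')
  show "\<exists>u\<in>{u\<in>codes. length u = n}. f = ubp_of u" if "f \<in> ubps n" for f
    using that by (rule ubps_codeE) blast
qed (use ubp_of_inj ubp_of_ubps in auto)

lemma ubp_of_codes: "ubp_of ` codes = (\<Union>n. ubps n)"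
  using bij_betw_imp_surj_on[OF bij_betw_ubp_of] by blast

lemma positions_conc:
  assumes a: "a \<in> codes" and b: "b \<in> codes"
  shows "B \<in> set a \<Longrightarrow> positions (conc a b) B = positions a B"
    and "B \<in> set b \<Longrightarrow> positions (conc a b) ((+) (length a) ` B) = (+) (length a) ` positions b B"
proof -
  have disj: "B \<noteq> C" if "B \<in> set a" "C \<in> set (shift (length a) b)" for B C
    using codes_block[OF a that(1)] shift_codes_block[OF b that(2)] by fastforce
  have shift_nth: "shift (length a) b ! j = (+) (length a) ` (b ! j)" if "j < length b" for j
    using that by (simp add: shift_def)
  show "positions (conc a b) B = positions a B" if B: "B \<in> set a"
  proof -
    have "shift (length a) b ! j \<noteq> B" if "j < length b" for j
      using disj[OF B nth_mem[of j "shift (length a) b"]] that by auto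
    then have *: "conc a b ! j = B \<longleftrightarrow> j < length a \<and> a ! j = B" if "j < length (conc a b)" for j
      using that by (cases "j < length a") (auto simp: conc_def nth_append)
    have "j < length (conc a b) \<and> conc a b ! j = B \<longleftrightarrow> j < length a \<and> a ! j = B" for j
      using *[of j] by (cases "j < length (conc a b)") auto
    then show ?thesis
      by (simp add: positions_def)
  qed
  show "positions (conc a b) ((+) (length a) ` B) = (+) (length a) ` positions b B" if B: "B \<in> set b"
  proof -
    let ?i = "length a"
    have "(+) ?i ` B \<in> set (shift ?i b)"
      using B by (simp add: set_shift)
    then have *: "a ! j \<noteq> (+) ?i ` B" if "j < ?i" for j
      using disj[OF nth_mem[OF that]] by blast
    have eq: "(+) ?i ` C = (+) ?i ` B \<longleftrightarrow> C = B" for C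
      by (simp add: inj_image_eq_iff)
    have "{j. j < length (conc a b) \<and> conc a b ! j = (+) ?i ` B} = (+) ?i ` {j. j < length b \<and> b ! j = B}"
    proof (intro equalityI subsetI)
      fix j
      assume "j \<in> {j. j < length (conc a b) \<and> conc a b ! j = (+) ?i ` B}"
      then have j: "j < ?i + length b" "(a @ shift ?i b) ! j = (+) ?i ` B"
        by (auto simp: conc_def)
      then have "\<not> j < ?i"
        using * by (auto simp: nth_append)
      with j have "b ! (j - ?i) = B" "j - ?i < length b"
        using shift_nth[of "j - ?i"] eq by (auto simp: nth_append)
      with \<open>\<not> j < ?i\<close> show "j \<in> (+) ?i ` {j. j < length b \<and> b ! j = B}"
        by (intro image_eqI[of _ _ "j - ?i"]) auto
    qed (auto simp: conc_def nth_append shift_nth)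
    then have "positions (conc a b) ((+) ?i ` B) = Suc ` (+) ?i ` {j. j < length b \<and> b ! j = B}"
      by (simp add: positions_def)
    then show ?thesis
      by (simp add: positions_def image_image)
  qed
qed

lemma ubp_concat_ubp_of:
  assumes a: "a \<in> codes" and b: "b \<in> codes"
  shows "ubp_concat (ubp_of a) (ubp_of b) = ubp_of (conc a b)"
proof -
  have "set (conc a b) = set a \<union> (`) ((+) (length a)) ` set b"
    by (simp add: conc_def set_shift)
  then have "ubp_of (conc a b) = (\<lambda>B. (positions a B, B)) ` set a \<union>
      (\<lambda>B. ((+) (length a) ` positions b B, (+) (length a) ` B)) ` set b"
    using positions_conc[OF a b] by (simp add: ubp_of_def image_Un image_image)
  then show ?thesis
    unfolding ubp_concat_def ubp_deg_ubp_of
    by (simp add: ubp_of_def image_image add.commute[of _ "length a"])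
qed

lemma ubp_deg_converse: "f \<in> ubps n \<Longrightarrow> ubp_deg (f\<inverse>) = ubp_deg f"
  by (metis ubp_deg_ubps ubps_converse)

lemma ubp_concat_converse:
  "f \<in> ubps n \<Longrightarrow> ubp_concat (f\<inverse>) (g\<inverse>) = (ubp_concat f g)\<inverse>"
  by (simp add: ubp_concat_def ubp_deg_converse converse_Un) (force simp: image_iff)

section \<open>Products with permutations\<close>

text \<open>Singletons form the finest partition, so joining with them changes nothing. The product
  of the Hopf algebra and \<open>ubp_split\<close> use the monoid product only with a permutation as
  one factor, so these are the joins that have to be computed.\<close>

lemma partition_join_singletons:
  assumes "partition_on S P"
  shows "partition_join S P ((\<lambda>x. {x}) ` S) = P" "partition_join S ((\<lambda>x. {x}) ` S) P = P"
proof -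
  have "partition_on S ((\<lambda>x. {x}) ` S)"
    by (auto simp: partition_on_def disjoint_def)
  then have s: "refines S ((\<lambda>x. {x}) ` S) P"
    using assms by (auto simp: refines_def partition_on_def)
  have r: "refines S P P"
    using assms by (rule refines_refl)
  show "partition_join S P ((\<lambda>x. {x}) ` S) = P"
    unfolding partition_join_def
    by (rule the_equality) (use s r refines_asym in blast)+
  show "partition_join S ((\<lambda>x. {x}) ` S) P = P"
    unfolding partition_join_def
    by (rule the_equality) (use s r refines_asym in blast)+
qed

lemma perm_ubp_simps:
  assumes "\<sigma> permutes {1..n}"
  shows "Domain (perm_ubp n \<sigma>) = (\<lambda>x. {x}) ` {1..n}" "Range (perm_ubp n \<sigma>) = (\<lambda>x. {x}) ` {1..n}"
    "ubp_deg (perm_ubp n \<sigma>) = n"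
proof -
  show d: "Domain (perm_ubp n \<sigma>) = (\<lambda>x. {x}) ` {1..n}"
    by (auto simp: perm_ubp_def)
  have "Range (perm_ubp n \<sigma>) = (\<lambda>x. {x}) ` \<sigma> ` {1..n}"
    unfolding perm_ubp_def by blast
  then show "Range (perm_ubp n \<sigma>) = (\<lambda>x. {x}) ` {1..n}"
    by (simp only: permutes_image[OF assms])
  have "\<Union>((\<lambda>x. {x}) ` {1..n}) = {1..n}" by auto
  then show "ubp_deg (perm_ubp n \<sigma>) = n"
    by (simp add: ubp_deg_def d)
qed

lemma positions_permute_word:
  assumes \<xi>: "\<xi> permutes {1..length v}"
  shows "positions (permute_word \<xi> v) B = \<xi> ` positions v B"
proof -
  have "positions (permute_word \<xi> v) B = {x \<in> \<xi> ` {1..length v}. permute_word \<xi> v ! (x - 1) = B}"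
    by (simp only: positions_eq permutes_image[OF \<xi>] length_permute_word)
  also have "\<dots> = \<xi> ` {k\<in>{1..length v}. permute_word \<xi> v ! (\<xi> k - 1) = B}"
    by auto
  also have "{k\<in>{1..length v}. permute_word \<xi> v ! (\<xi> k - 1) = B} = positions v B"
    unfolding positions_eq using permute_word_nth[OF \<xi>] by auto
  finally show ?thesis .
qed

lemma set_permute_word:
  assumes \<xi>: "\<xi> permutes {1..length v}"
  shows "set (permute_word \<xi> v) = set v"
  unfolding set_eq_iff
proof
  fix B
  show "B \<in> set (permute_word \<xi> v) \<longleftrightarrow> B \<in> set v"
    using positions_permute_word[OF \<xi>, of B] positions_eq_empty[of v B]
      positions_eq_empty[of "permute_word \<xi> v" B] by simp
qed

lemma ubp_of_permute_word:
  assumes \<xi>: "\<xi> permutes {1..length v}"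
  shows "ubp_of (permute_word \<xi> v) = (\<lambda>B. (\<xi> ` positions v B, B)) ` set v"
  by (simp add: ubp_of_def set_permute_word[OF \<xi>] positions_permute_word[OF \<xi>])

text \<open>Applying the inverse of \<open>\<xi>\<close> first moves each domain block, a set of
  positions, by \<open>\<xi>\<close> and leaves its image alone. This identifies the factorisation
  behind \<open>ubp_split\<close> with a shuffle.\<close>

lemma ubp_comp_perm_right:
  assumes \<xi>: "\<xi> permutes {1..length v}"
  shows "ubp_comp (ubp_of v) (perm_ubp (length v) (inv_into UNIV \<xi>)) = ubp_of (permute_word \<xi> v)"
proof -
  define n where "n = length v"
  define \<sigma> where "\<sigma> = inv_into UNIV \<xi>"
  have \<sigma>: "\<sigma> permutes {1..n}"
    using permutes_inv[OF \<xi>] by (simp add: \<sigma>_def n_def)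
  have join: "partition_join {1..n} (Range (perm_ubp n \<sigma>)) (Domain (ubp_of v)) = positions v ` set v"
    unfolding perm_ubp_simps(2)[OF \<sigma>] Domain_ubp_of unfolding n_def
    by (rule partition_join_singletons(2)[OF partition_on_positions])
  have 1: "\<Union>{A. \<exists>B. (A, B) \<in> perm_ubp n \<sigma> \<and> B \<subseteq> positions v C} = \<xi> ` positions v C" for C
  proof -
    have "\<Union>{A. \<exists>B. (A, B) \<in> perm_ubp n \<sigma> \<and> B \<subseteq> positions v C} = {x\<in>{1..n}. \<sigma> x \<in> positions v C}"
      by (auto simp: perm_ubp_def)
    also have "\<dots> = \<xi> ` positions v C"
    proof (intro equalityI subsetI)
      fix x
      assume "x \<in> {x\<in>{1..n}. \<sigma> x \<in> positions v C}"
      then show "x \<in> \<xi> ` positions v C"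
        using permutes_inverses(1)[OF \<xi>, of x] by (intro image_eqI[of _ _ "\<sigma> x"]) (auto simp: \<sigma>_def)
    next
      fix x
      assume "x \<in> \<xi> ` positions v C"
      then obtain y where y: "x = \<xi> y" "y \<in> positions v C" by blast
      then show "x \<in> {x\<in>{1..n}. \<sigma> x \<in> positions v C}"
        using permutes_inverses(2)[OF \<xi>, of y] permutes_in_image[OF \<xi>, of y]
        by (auto simp: \<sigma>_def positions_eq n_def)
    qed
    finally show ?thesis .
  qed
  have 2: "\<Union>{D. \<exists>C. (C, D) \<in> ubp_of v \<and> C \<subseteq> positions v B} = B" if "B \<in> set v" for B
  proof -
    have "{D. \<exists>C. (C, D) \<in> ubp_of v \<and> C \<subseteq> positions v B} = {B}"
      using that positions_subset_iff by (auto simp: ubp_of_def)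
    then show ?thesis by simp
  qed
  have "ubp_comp (ubp_of v) (perm_ubp n \<sigma>) =
      (\<lambda>B. (\<xi> ` positions v B, \<Union>{D. \<exists>C. (C, D) \<in> ubp_of v \<and> C \<subseteq> positions v B})) ` set v"
    unfolding ubp_comp_def perm_ubp_simps(3)[OF \<sigma>] join 1 image_image ..
  also have "\<dots> = (\<lambda>B. (\<xi> ` positions v B, B)) ` set v"
    using 2 by (intro image_cong) auto
  finally show ?thesis
    by (simp add: ubp_of_permute_word[OF \<xi>] n_def \<sigma>_def)
qed

text \<open>In the converse the position sets are the codomain blocks, and these are what a
  permutation on the left moves. So left multiplication on converses acts on words just as right
  multiplication by the inverse permutation does on the elements themselves.\<close>

lemma ubp_comp_perm_left:
  assumes v: "v \<in> codes" and \<xi>: "\<xi> permutes {1..length v}"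
  shows "ubp_comp (perm_ubp (length v) \<xi>) ((ubp_of v)\<inverse>) = (ubp_of (permute_word \<xi> v))\<inverse>"
proof -
  define n where "n = length v"
  have deg: "ubp_deg ((ubp_of v)\<inverse>) = n"
    using ubp_deg_converse[OF ubp_of_ubps[OF v]] by (simp add: n_def)
  have \<xi>n: "\<xi> permutes {1..n}"
    using \<xi> by (simp add: n_def)
  have join: "partition_join {1..n} (positions v ` set v) (Domain (perm_ubp n \<xi>)) = positions v ` set v"
    unfolding perm_ubp_simps(1)[OF \<xi>n] unfolding n_def
    by (rule partition_join_singletons(1)[OF partition_on_positions])
  have 1: "\<Union>{D. \<exists>C. (C, D) \<in> perm_ubp n \<xi> \<and> C \<subseteq> positions v B} = \<xi> ` positions v B" for B
    by (auto simp: perm_ubp_def positions_eq n_def)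
  have 2: "\<Union>{A. \<exists>C. (A, C) \<in> (ubp_of v)\<inverse> \<and> C \<subseteq> positions v B} = B" if "B \<in> set v" for B
  proof -
    have "{A. \<exists>C. (A, C) \<in> (ubp_of v)\<inverse> \<and> C \<subseteq> positions v B} = {B}"
      using that positions_subset_iff by (auto simp: ubp_of_def)
    then show ?thesis by simp
  qed
  have "ubp_comp (perm_ubp n \<xi>) ((ubp_of v)\<inverse>) =
      (\<lambda>B. (\<Union>{A. \<exists>C. (A, C) \<in> (ubp_of v)\<inverse> \<and> C \<subseteq> positions v B}, \<xi> ` positions v B)) ` set v"
    unfolding ubp_comp_def deg Range_converse Domain_ubp_of join 1 image_image ..
  also have "\<dots> = (\<lambda>B. (B, \<xi> ` positions v B)) ` set v"
    using 2 by (intro image_cong) auto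
  also have "\<dots> = (ubp_of (permute_word \<xi> v))\<inverse>"
    by (auto simp: ubp_of_permute_word[OF \<xi>])
  finally show ?thesis
    by (simp add: n_def)
qed

lemma set_codes_disjoint:
  assumes "a \<in> codes" "b \<in> codes"
  shows "set a \<inter> set (shift (length a) b) = {}"
proof (intro equals0I)
  fix B
  assume "B \<in> set a \<inter> set (shift (length a) b)"
  then show False
    using codes_block[OF assms(1), of B] shift_codes_block[OF assms(2), of B "length a"] by fastforce
qed

text \<open>Justifies the \<open>THE\<close> in \<open>ubp_split\<close>. Any other candidate triple
  again yields a splitting of \<open>u\<close> at \<open>length a\<close>, so
  \<open>splits_unique\<close> fixes the two factors and \<open>permute_word_inj\<close> the
  shuffle.\<close>

lemma ubp_split_ubp_of:
  assumes s: "splits u a b"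
  shows "ubp_split (ubp_of u) (length a) = (ubp_of a, ubp_of b)"
proof -
  define n where "n = length u"
  have a: "a \<in> codes" and b: "b \<in> codes" and u: "u \<in> shuffles a (shift (length a) b)"
    using s by (auto simp: splits_def)
  have n: "n = length a + length b"
    using splits_length[OF s] by (simp add: n_def)
  obtain \<xi> where \<xi>: "\<xi> \<in> Sh (length a) (length b)" "permute_word \<xi> (conc a b) = u"
    using shuffles_permute_wordE[OF u] by (auto simp: conc_def)
  have comp: "ubp_comp (ubp_concat (ubp_of a') (ubp_of b')) (perm_ubp n (inv_into UNIV \<zeta>)) =
      ubp_of (permute_word \<zeta> (conc a' b'))"
    if "\<zeta> \<in> Sh (length a) (length b)" "a' \<in> codes" "b' \<in> codes" "length a' = length a" "length b' = length b"
    for \<zeta> a' b'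
    using that ubp_comp_perm_right[of \<zeta> "conc a' b'"] by (simp add: Sh_def n ubp_concat_ubp_of)
  have lenb: "ubp_deg (ubp_of u) - length a = length b"
    using n by (simp add: n_def)
  have "(THE (\<xi>, f, g). \<xi> \<in> Sh (length a) (ubp_deg (ubp_of u) - length a) \<and> f \<in> ubps (length a) \<and>
      g \<in> ubps (ubp_deg (ubp_of u) - length a) \<and>
      ubp_of u = ubp_comp (ubp_concat f g) (perm_ubp (ubp_deg (ubp_of u)) (inv_into UNIV \<xi>))) =
    (\<xi>, ubp_of a, ubp_of b)" (is "The ?P = _")
  proof (rule the_equality)
    show "?P (\<xi>, ubp_of a, ubp_of b)"
      using \<xi>(1) comp[OF \<xi>(1) a b refl refl] ubp_of_ubps[OF a] ubp_of_ubps[OF b]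
      unfolding prod.case lenb \<xi>(2) by (simp add: n_def)
  next
    fix t
    assume t: "?P t"
    obtain \<zeta> f g where t_eq: "t = (\<zeta>, f, g)" by (cases t)
    have \<zeta>: "\<zeta> \<in> Sh (length a) (length b)" and f: "f \<in> ubps (length a)" and g: "g \<in> ubps (length b)"
      and eq: "ubp_of u = ubp_comp (ubp_concat f g) (perm_ubp n (inv_into UNIV \<zeta>))"
      using t unfolding t_eq lenb by (auto simp: n_def)
    obtain a' where a': "a' \<in> codes" "length a' = length a" "f = ubp_of a'"
      using f by (rule ubps_codeE)
    obtain b' where b': "b' \<in> codes" "length b' = length b" "g = ubp_of b'"
      using g by (rule ubps_codeE)
    have u': "u = permute_word \<zeta> (conc a' b')"
      using eq comp[OF \<zeta> a'(1) b'(1) a'(2) b'(2)] a' b' by (auto intro: ubp_of_inj)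
    have "u \<in> shuffles a' (shift (length a') b')"
      unfolding u' conc_def by (rule permute_word_in_shuffles) (use \<zeta> a' b' in simp)
    then have "splits u a' b'"
      using a' b' by (simp add: splits_def)
    then have ab: "a = a'" "b = b'"
      using splits_unique[OF s _ a'(2)[symmetric]] by blast+
    have "\<xi> = \<zeta>"
    proof (rule permute_word_inj[OF set_codes_disjoint[OF a b]])
      show "permute_word \<xi> (a @ shift (length a) b) = permute_word \<zeta> (a @ shift (length a) b)"
        using u' \<xi> ab by (simp add: conc_def)
    qed (use \<xi> \<zeta> in simp_all)
    then show "t = (\<xi>, ubp_of a, ubp_of b)"
      using t_eq a' b' ab by simp
  qed
  then show ?thesis
    by (simp add: ubp_split_def)
qed

lemma ubp_breaks_ubp_of:
  assumes "u \<in> codes"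
  shows "ubp_breaks (ubp_of u) = {i. \<exists>a b. splits u a b \<and> i = length a}"
proof -
  have "i \<in> ubp_breaks (ubp_of u) \<longleftrightarrow> (\<exists>a b. splits u a b \<and> i = length a)" for i
  proof
    assume "i \<in> ubp_breaks (ubp_of u)"
    then obtain S where "i \<le> length u" "S \<subseteq> set u" "\<Union>S = {1..i}"
      by (auto simp: ubp_breaks_def)
    from splits_exists[OF assms this] show "\<exists>a b. splits u a b \<and> i = length a"
      by metis
  next
    assume "\<exists>a b. splits u a b \<and> i = length a"
    then show "i \<in> ubp_breaks (ubp_of u)"
      using splits_break by (auto simp: ubp_breaks_def)
  qed
  then show ?thesis by blast
qed

lemma ubp_of_Nil [simp]: "ubp_of [] = {}"
  by (simp add: ubp_of_def)

section \<open>Linear extensions\<close>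

lemma lookup_scale [simp]: "lookup (scale c p) x = c * lookup p x"
  by (simp add: scale_def Poly_Mapping.map.rep_eq when_def)

lemma scale_single [simp]: "scale c (single x d) = single x (c * d)"
  by (rule poly_mapping_eqI) (simp add: lookup_single when_def)

lemma scale_scale [simp]: "scale c (scale d p) = scale (c * d) p"
  by (rule poly_mapping_eqI) (simp add: mult.assoc)

lemma scale_1 [simp]: "scale 1 p = p"
  by (rule poly_mapping_eqI) simp

lemma scale_0 [simp]: "scale 0 p = 0" "scale c 0 = 0"
  by (rule poly_mapping_eqI; simp)+

lemma scale_add: "scale c (p + q) = scale c p + scale c q"
  by (rule poly_mapping_eqI) (simp add: lookup_add distrib_left)

lemma scale_add_left: "scale (c + d) p = scale c p + scale d p"
  by (rule poly_mapping_eqI) (simp add: lookup_add distrib_right)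

lemma scale_uminus: "scale (- c) p = - scale c p" "scale c (- p) = - scale c p"
  by (rule poly_mapping_eqI; simp)+

lemma scale_diff: "scale c (p - q) = scale c p - scale c q"
  by (rule poly_mapping_eqI) (simp add: lookup_minus right_diff_distrib)

lemma scale_sum: "scale c (sum f I) = (\<Sum>i\<in>I. scale c (f i))"
  by (induct I rule: infinite_finite_induct) (simp_all add: scale_add)

lemma keys_scale: "keys (scale c p) \<subseteq> keys p"
  by (auto simp: in_keys_iff)

lemma keys_add_subset: "keys p \<subseteq> X \<Longrightarrow> keys q \<subseteq> X \<Longrightarrow> keys (p + q) \<subseteq> X"
  using keys_add[of p q] by blast

lemma keys_uminus [simp]: "keys (- p) = keys (p :: 'x \<Rightarrow>\<^sub>0 'k::ab_group_add)"
  by (auto simp: in_keys_iff)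

lemma keys_diff_subset:
  fixes p q :: "'x \<Rightarrow>\<^sub>0 'k::ab_group_add"
  shows "keys p \<subseteq> X \<Longrightarrow> keys q \<subseteq> X \<Longrightarrow> keys (p - q) \<subseteq> X"
  using keys_add_subset[of p X "- q"] by simp

lemma keys_sum_subset:
  assumes "\<And>i. i \<in> I \<Longrightarrow> keys (f i) \<subseteq> X"
  shows "keys (sum f I) \<subseteq> X"
  using assms by (induct I rule: infinite_finite_induct) (simp_all add: keys_add_subset)

lemma keys_single_subset: "x \<in> X \<Longrightarrow> keys (single x c) \<subseteq> X"
  by (simp add: keys_single)

text \<open>Linear extension into a free module, with type class sums in place of
  \<open>finsum\<close> and its carrier conditions; \<open>lin_ext_Q\<close> connects it with
  \<open>lin_ext\<close> into a quotient.\<close>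

definition lin ::
    "('x \<Rightarrow> 'y \<Rightarrow>\<^sub>0 'k::{comm_ring,comm_monoid_mult}) \<Rightarrow> ('x \<Rightarrow>\<^sub>0 'k) \<Rightarrow> ('y \<Rightarrow>\<^sub>0 'k)" where
  "lin g p = (\<Sum>x\<in>keys p. scale (lookup p x) (g x))"

lemma lin_superset:
  "finite S \<Longrightarrow> keys p \<subseteq> S \<Longrightarrow> lin g p = (\<Sum>x\<in>S. scale (lookup p x) (g x))"
  unfolding lin_def by (rule sum.mono_neutral_left) (auto simp: in_keys_iff)

lemma lin_0 [simp]: "lin g 0 = 0"
  by (simp add: lin_def)

lemma lin_add: "lin g (p + q) = lin g p + lin g q"
proof -
  let ?S = "keys p \<union> keys q"
  have S: "finite ?S" by simp
  have "lin g p = (\<Sum>x\<in>?S. scale (lookup p x) (g x))"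
    by (rule lin_superset[OF S]) blast
  moreover have "lin g q = (\<Sum>x\<in>?S. scale (lookup q x) (g x))"
    by (rule lin_superset[OF S]) blast
  moreover have "lin g (p + q) = (\<Sum>x\<in>?S. scale (lookup (p + q) x) (g x))"
    by (rule lin_superset[OF S]) (rule keys_add)
  ultimately show ?thesis
    by (simp add: lookup_add scale_add_left sum.distrib)
qed

lemma lin_scale: "lin g (scale c p) = scale c (lin g p)"
  using lin_superset[OF finite_keys keys_scale, of g c p] by (simp add: lin_def scale_sum)

lemma lin_uminus: "lin g (- p) = - lin g p"
  by (simp add: lin_def scale_uminus sum_negf)

lemma lin_diff: "lin g (p - q) = lin g p - lin g q"
  using lin_add[of g p "- q"] by (simp add: lin_uminus)

lemma lin_single [simp]: "lin g (single x c) = scale c (g x)"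
  using lin_superset[of "{x}" "single x c" g] by (simp add: keys_single)

lemma lin_sum: "lin g (sum f I) = (\<Sum>i\<in>I. lin g (f i))"
  by (induct I rule: infinite_finite_induct) (simp_all add: lin_add)

lemma lin_cong: "(\<And>x. x \<in> keys p \<Longrightarrow> g x = g' x) \<Longrightarrow> lin g p = lin g' p"
  by (simp add: lin_def)

lemma lin_add_fun: "lin (\<lambda>x. f x + g x) p = lin f p + lin g p"
  by (simp add: lin_def scale_add sum.distrib)

lemma lin_diff_fun: "lin (\<lambda>x. f x - g x) p = lin f p - lin g p"
  by (simp add: lin_def scale_diff sum_subtractf)

lemma lin_scale_fun: "lin (\<lambda>x. scale c (f x)) p = scale c (lin f p)"
  by (simp add: lin_def scale_sum mult.commute)

lemma lin_sum_fun: "lin (\<lambda>x. \<Sum>i\<in>I. f i x) p = (\<Sum>i\<in>I. lin (f i) p)"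
  by (simp add: lin_def scale_sum) (rule sum.swap)

lemma lin_lin: "lin g (lin f p) = lin (\<lambda>x. lin g (f x)) p"
  by (simp add: lin_def[of f] lin_sum lin_scale) (simp add: lin_def)

lemma lin_id: "lin (\<lambda>x. single x 1) p = p"
proof (rule poly_mapping_eqI)
  fix x
  show "lookup (lin (\<lambda>x. single x 1) p) x = lookup p x"
    by (simp add: lin_def lookup_sum lookup_single when_def sum.delta in_keys_iff)
qed

lemma keys_lin:
  "(\<And>x. x \<in> keys p \<Longrightarrow> keys (g x) \<subseteq> X) \<Longrightarrow> keys (lin g p) \<subseteq> X"
  unfolding lin_def by (intro keys_sum_subset order_trans[OF keys_scale]) simp

lemma lookup_lin:
  "lookup (lin g p) y =
     (\<Sum>x\<in>keys p. lookup p x * lookup (g x) y)"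
  by (simp add: lin_def lookup_sum)

lemma bilin_ext_eq_lin:
  "bilin_ext b p q = lin (\<lambda>x. lin (\<lambda>y. single (b x y) 1) q) p"
  by (simp add: bilin_ext_def lin_def scale_sum)

lemma lin_swap:
  "lin (\<lambda>x. lin (\<lambda>y. g x y) q) p = lin (\<lambda>y. lin (\<lambda>x. g x y) p) q"
  by (simp add: lin_def scale_sum mult.commute) (rule sum.swap)

lemma lookup_indicator:
  "finite S \<Longrightarrow> lookup (\<Sum>x\<in>S. single x 1) y = (if y \<in> S then 1 else 0)"
  by (simp add: lookup_sum lookup_single when_def sum.delta)

text \<open>The matrix of \<open>lin g\<close> is unitriangular with respect to the rank \<open>r\<close>.\<close>

lemma unitriangular:
  fixes S :: "'x \<Rightarrow> 'z set" and r :: "'z \<Rightarrow> nat"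
  defines "g \<equiv> \<lambda>x. \<Sum>z\<in>S x. single z (1::'k::{comm_ring,comm_monoid_mult})"
  assumes c: "bij_betw c X Z"
    and S: "\<And>x. x \<in> X \<Longrightarrow> finite (S x)" "\<And>x. x \<in> X \<Longrightarrow> S x \<subseteq> Z" "\<And>x. x \<in> X \<Longrightarrow> c x \<in> S x"
    and r: "\<And>x z. x \<in> X \<Longrightarrow> z \<in> S x \<Longrightarrow> z \<noteq> c x \<Longrightarrow> r z < r (c x)"
  shows "keys p \<subseteq> X \<Longrightarrow> lin g p = 0 \<Longrightarrow> p = 0"
    and "z \<in> Z \<Longrightarrow> \<exists>p. keys p \<subseteq> X \<and> lin g p = single z 1"
proof -
  show "p = 0" if p: "keys p \<subseteq> X" "lin g p = 0"
  proof (rule ccontr)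
    assume "p \<noteq> 0"
    then have ne: "keys p \<noteq> {}" by simp
    \<comment> \<open>Take the key whose diagonal entry has maximal rank. No other key has an entry
      at \<open>c x0\<close>, so the coefficient of \<open>lin g p\<close> there is that of
      \<open>p\<close> at \<open>x0\<close>.\<close>
    obtain x0 where x0: "x0 \<in> keys p"
      "\<And>x. x \<in> keys p \<Longrightarrow> r (c x) \<le> r (c x0)"
    proof -
      have "Max ((\<lambda>x. r (c x)) ` keys p) \<in> (\<lambda>x. r (c x)) ` keys p"
        using ne by (intro Max_in) auto
      then obtain x0 where "x0 \<in> keys p" "r (c x0) = Max ((\<lambda>x. r (c x)) ` keys p)"
        by auto
      then show ?thesis
        using that[of x0] by simp
    qed
    have eq0: "lookup (g x) (c x0) = (if x = x0 then 1 else 0)" if x: "x \<in> keys p" for x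
    proof -
      have "c x0 \<notin> S x" if "x \<noteq> x0"
      proof
        assume "c x0 \<in> S x"
        moreover have "c x0 \<noteq> c x"
          using c that x x0(1) p(1) by (auto simp: bij_betw_def inj_on_def)
        ultimately show False
          using r[of x "c x0"] x0(2)[OF x] x p(1) by auto
      qed
      then show ?thesis
        using S x p(1) x0(1) by (auto simp: g_def lookup_indicator)
    qed
    have "0 = lookup (lin g p) (c x0)"
      using p(2) by simp
    also have "\<dots> = (\<Sum>x\<in>keys p. if x = x0 then lookup p x else 0)"
      unfolding lookup_lin by (rule sum.cong) (simp_all add: eq0)
    also have "\<dots> = lookup p x0"
      using x0(1) by (simp add: sum.delta)
    finally show False
      using x0(1) by (simp add: in_keys_iff)
  qed
  show "\<exists>p. keys p \<subseteq> X \<and> lin g p = single z 1" if "z \<in> Z"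
    using that
  proof (induct "r z" arbitrary: z rule: less_induct)
    case less
    then obtain x where x: "x \<in> X" "c x = z"
      using c by (auto simp: bij_betw_def)
    \<comment> \<open>Elimination: the off-diagonal entries of column \<open>x\<close> have smaller
      rank than \<open>z\<close>, so they have preimages, which are subtracted from
      \<open>single x 1\<close>. The diagonal entry is 1, so nothing is divided.\<close>
    have "\<forall>y\<in>S x - {z}. \<exists>p. keys p \<subseteq> X \<and> lin g p = single y 1"
      using less.hyps r[OF x(1)] S(2)[OF x(1)] x(2) by blast
    then obtain P where P: "\<And>y. y \<in> S x - {z} \<Longrightarrow> keys (P y) \<subseteq> X"
      "\<And>y. y \<in> S x - {z} \<Longrightarrow> lin g (P y) = single y 1"
      by metis
    have "lin g (single x 1 - (\<Sum>y\<in>S x - {z}. P y)) =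
        g x - (\<Sum>y\<in>S x - {z}. single y 1)"
      using P(2) by (simp add: lin_diff lin_sum)
    also have "\<dots> = single z 1"
      using S(1,3)[OF x(1)] x(2) by (simp add: g_def sum.remove[of "S x" z])
    finally have "lin g (single x 1 - (\<Sum>y\<in>S x - {z}. P y)) = single z 1" .
    moreover have "keys (single x 1 - (\<Sum>y\<in>S x - {z}. P y)) \<subseteq> X"
      by (intro keys_diff_subset keys_single_subset keys_sum_subset) (use P(1) x(1) in auto)
    ultimately show ?case by blast
  qed
qed

section \<open>Free modules and their quotients\<close>

lemma free_module_simps [simp]:
  "carrier (free_module X) = {p. keys p \<subseteq> X}" "zero (free_module X) = 0"
  "add (free_module X) = (+)" "smult (free_module X) = scale"
  by (simp_all add: free_module_def)

lemma scalars_simps [simp]: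
  "carrier scalars = UNIV" "zero scalars = 0" "add scalars = (+)" "mult scalars = (*)" "one scalars = 1"
  by (simp_all add: scalars_def)

lemma cring_scalars: "cring (scalars :: 'k::{comm_ring,comm_monoid_mult} ring)"
proof (rule cringI)
  show "abelian_group (scalars :: 'k ring)"
  proof (rule abelian_groupI)
    show "\<exists>y\<in>carrier scalars. y \<oplus>\<^bsub>scalars\<^esub> x = \<zero>\<^bsub>scalars\<^esub>" for x :: 'k
      by (auto intro: exI[of _ "- x"])
  qed (simp_all add: add.assoc add.commute)
  show "comm_monoid (scalars :: 'k ring)"
    by (rule comm_monoidI) (simp_all add: ac_simps)
qed (simp add: distrib_right)

lemma module_free_module: "module scalars (free_module X :: ('k::{comm_ring,comm_monoid_mult}, _) module)"
proof (rule moduleI)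
  show "abelian_group (free_module X :: ('k, _) module)"
  proof (rule abelian_groupI)
    fix p :: "'a \<Rightarrow>\<^sub>0 'k"
    assume "p \<in> carrier (free_module X)"
    then show "\<exists>q\<in>carrier (free_module X). q \<oplus>\<^bsub>free_module X\<^esub> p = \<zero>\<^bsub>free_module X\<^esub>"
      by (intro bexI[of _ "- p"]) auto
  qed (simp_all add: add.assoc add.commute keys_add_subset)
  show "c \<odot>\<^bsub>free_module X\<^esub> p \<in> carrier (free_module X)" if "p \<in> carrier (free_module X)" for c :: 'k and p
    using that keys_scale[of c p] by auto
qed (simp_all add: cring_scalars scale_add scale_add_left)

lemma finsum_free_module:
  assumes "\<And>i. i \<in> I \<Longrightarrow> keys (f i) \<subseteq> X"
  shows "(\<Oplus>\<^bsub>free_module X\<^esub>i\<in>I. f i) = (\<Sum>i\<in>I. f i)"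
proof -
  interpret module scalars "free_module X"
    by (rule module_free_module)
  show ?thesis
    using assms
    by (induct I rule: infinite_finite_induct) (simp_all add: M.finsum_infinite Pi_def)
qed

text \<open>Additive inverses come from scaling by \<open>- 1\<close>, which removes them from the
  closure conditions.\<close>

lemma free_submodule_iff:
  "submodule K scalars (free_module X :: ('k::{comm_ring,comm_monoid_mult}, _) module) \<longleftrightarrow>
     (\<forall>p\<in>K. keys p \<subseteq> X) \<and> 0 \<in> K \<and> (\<forall>p\<in>K. \<forall>q\<in>K. p + q \<in> K) \<and> (\<forall>c. \<forall>p\<in>K. scale c p \<in> K)"
  (is "?l \<longleftrightarrow> ?r")
proof -
  interpret module scalars "free_module X :: ('k, _) module"
    by (rule module_free_module)
  have inv: "a_inv (free_module X) p = - p" if "keys p \<subseteq> X" for p :: "_ \<Rightarrow>\<^sub>0 'k"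
    using that by (intro M.minus_equality) auto
  show ?thesis
  proof
    assume l: ?l
    then have "K \<subseteq> carrier (free_module X)" "K \<noteq> {}"
      using submoduleE[OF l] by simp_all
    moreover have "scale c p \<in> K" if "p \<in> K" for c p
      using submoduleE(4)[OF l, of c p] that by simp
    moreover from this have "0 \<in> K"
      using \<open>K \<noteq> {}\<close> scale_0(1) by (metis ex_in_conv)
    moreover have "p + q \<in> K" if "p \<in> K" "q \<in> K" for p q
      using submoduleE(5)[OF l, of p q] that by simp
    ultimately show ?r by auto
  next
    assume r: ?r
    show ?l
    proof (rule submoduleI)
      show "\<ominus>\<^bsub>free_module X\<^esub> p \<in> K" if "p \<in> K" for p
      proof -
        have "\<ominus>\<^bsub>free_module X\<^esub> p = scale (- 1) p"
          using inv[of p] r that by (simp add: scale_uminus)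
        with r that show ?thesis by simp
      qed
    qed (use r in auto)
  qed
qed

text \<open>The common setting of all quotients: \<open>K\<close> is a module of relations in the
  free module on \<open>X\<close>. Equality of cosets becomes membership of a difference in
  \<open>K\<close>, for which the rules \<open>K_trans\<close>, \<open>K_sum\<close> and
  \<open>K_lin_cong\<close> form a small calculus.\<close>

locale free_submodule =
  fixes K :: "('x \<Rightarrow>\<^sub>0 'k::{comm_ring,comm_monoid_mult}) set" and X :: "'x set"
  assumes submodule: "submodule K scalars (free_module X)"
begin

lemma
  shows K_keys: "p \<in> K \<Longrightarrow> keys p \<subseteq> X"
    and K_0 [simp]: "0 \<in> K"
    and K_add: "p \<in> K \<Longrightarrow> q \<in> K \<Longrightarrow> p + q \<in> K"
    and K_scale: "p \<in> K \<Longrightarrow> scale c p \<in> K"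
  using submodule by (simp_all add: free_submodule_iff)

lemma K_uminus: "p \<in> K \<Longrightarrow> - p \<in> K"
  using K_scale[of p "- 1"] by (simp add: scale_uminus)

lemma K_sum: "(\<And>i. i \<in> I \<Longrightarrow> f i \<in> K) \<Longrightarrow> sum f I \<in> K"
  by (induct I rule: infinite_finite_induct) (auto intro: K_add)

lemma K_lin: "(\<And>x. x \<in> keys p \<Longrightarrow> g x \<in> K) \<Longrightarrow> lin g p \<in> K"
  unfolding lin_def by (intro K_sum K_scale) auto

lemma K_lin_cong:
  "(\<And>x. x \<in> keys p \<Longrightarrow> f x - g x \<in> K) \<Longrightarrow> lin f p - lin g p \<in> K"
  using K_lin[of p "\<lambda>x. f x - g x"] by (simp add: lin_diff_fun)

lemma K_trans: "p - q \<in> K \<Longrightarrow> q - r \<in> K \<Longrightarrow> p - r \<in> K"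
  using K_add[of "p - q" "q - r"] by simp

lemma K_sym: "p - q \<in> K \<Longrightarrow> q - p \<in> K"
  using K_uminus[of "p - q"] by simp

abbreviation coset :: "('x \<Rightarrow>\<^sub>0 'k) \<Rightarrow> ('x \<Rightarrow>\<^sub>0 'k) set" where
  "coset p \<equiv> K +>\<^bsub>free_module X\<^esub> p"

abbreviation Q :: "('k, ('x \<Rightarrow>\<^sub>0 'k) set) module" where
  "Q \<equiv> quotient_module (free_module X) K"

lemma coset_eq: "coset p = {k + p | k. k \<in> K}"
  by (auto simp: a_r_coset_def r_coset_def)

lemma in_coset: "q \<in> coset p \<longleftrightarrow> q - p \<in> K"
proof
  assume "q - p \<in> K"
  then show "q \<in> coset p"
    unfolding coset_eq by (intro CollectI exI[of _ "q - p"]) simp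
qed (auto simp: coset_eq)

lemma coset_eq_iff: "coset p = coset q \<longleftrightarrow> p - q \<in> K"
proof
  assume "coset p = coset q"
  moreover have "p \<in> coset p" by (simp add: in_coset)
  ultimately show "p - q \<in> K" by (simp add: in_coset)
next
  assume pq: "p - q \<in> K"
  have "z - p \<in> K \<longleftrightarrow> z - q \<in> K" for z
    using K_trans[of z p q] K_trans[of z q p] pq K_sym[OF pq] by blast
  then show "coset p = coset q"
    by (simp add: set_eq_iff in_coset)
qed

lemma coset_0: "coset 0 = K"
  by (auto simp: set_eq_iff in_coset)

lemma coset_keys: "q \<in> coset p \<Longrightarrow> keys p \<subseteq> X \<Longrightarrow> keys q \<subseteq> X"
  using keys_add_subset[of "q - p" X p] K_keys by (simp add: in_coset)

lemma quotient_simps: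
  "carrier Q = coset ` {p. keys p \<subseteq> X}"
  "zero Q = coset 0"
  "add Q (coset p) (coset q) = coset (p + q)"
  "smult Q c (coset p) = coset (scale c p)"
proof -
  show "carrier Q = coset ` {p. keys p \<subseteq> X}"
    by (auto simp: quotient_module_def A_RCOSETS_def RCOSETS_def a_r_coset_def)
  show "zero Q = coset 0"
    by (simp add: quotient_module_def coset_0)
  show "add Q (coset p) (coset q) = coset (p + q)"
  proof -
    have "add Q (coset p) (coset q) = {x + y | x y. x \<in> coset p \<and> y \<in> coset q}"
      by (auto simp: quotient_module_def set_add_def set_mult_def)
    also have "\<dots> = coset (p + q)"
    proof (intro equalityI subsetI)
      fix z
      assume "z \<in> {x + y | x y. x \<in> coset p \<and> y \<in> coset q}"
      then obtain x y where "z = x + y" "x - p \<in> K" "y - q \<in> K"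
        by (auto simp: in_coset)
      then show "z \<in> coset (p + q)"
        using K_add[of "x - p" "y - q"] by (simp add: in_coset algebra_simps)
    next
      fix z
      assume "z \<in> coset (p + q)"
      then have "z = (z - q) + q" "z - q \<in> coset p" "q \<in> coset q"
        by (simp_all add: in_coset algebra_simps)
      then show "z \<in> {x + y | x y. x \<in> coset p \<and> y \<in> coset q}"
        by blast
    qed
    finally show ?thesis .
  qed
  show "smult Q c (coset p) = coset (scale c p)"
  proof -
    have "coset (scale c x) = coset (scale c p)" if "x \<in> coset p" for x
      using that K_scale[of "x - p" c] by (simp add: coset_eq_iff in_coset scale_diff)
    then have "(\<Union>x\<in>coset p. coset (scale c x)) = (\<Union>x\<in>coset p. coset (scale c p))"
      by (intro SUP_cong refl)
    moreover have "coset p \<noteq> {}"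
      using in_coset[of p p] by auto
    ultimately have "(\<Union>x\<in>coset p. coset (scale c x)) = coset (scale c p)"
      by (simp only: UN_constant if_False)
    then show ?thesis
      by (simp add: quotient_module_def)
  qed
qed

lemma coset_in_carrier: "keys p \<subseteq> X \<Longrightarrow> coset p \<in> carrier Q"
  by (auto simp: quotient_simps)

lemma module_Q: "module scalars Q"
proof (rule moduleI)
  show "abelian_group Q"
  proof (rule abelian_groupI)
    fix T
    assume "T \<in> carrier Q"
    then obtain p where "T = coset p" "keys p \<subseteq> X"
      by (auto simp: quotient_simps)
    then show "\<exists>U\<in>carrier Q. U \<oplus>\<^bsub>Q\<^esub> T = \<zero>\<^bsub>Q\<^esub>"
      by (intro bexI[of _ "coset (- p)"]) (auto simp: quotient_simps)
  qed (auto simp: quotient_simps(1,2,3) ac_simps keys_add_subset)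
  show "c \<odot>\<^bsub>Q\<^esub> T \<in> carrier Q" if "T \<in> carrier Q" for c :: 'k and T
    using that keys_scale[of c] by (fastforce simp: quotient_simps(1,4))
qed (auto simp: cring_scalars quotient_simps(1,3,4) scale_add scale_add_left)

lemma finsum_Q:
  assumes "\<And>i. i \<in> I \<Longrightarrow> keys (f i) \<subseteq> X"
  shows "(\<Oplus>\<^bsub>Q\<^esub>i\<in>I. coset (f i)) = coset (\<Sum>i\<in>I. f i)"
proof -
  interpret module scalars Q
    by (rule module_Q)
  show ?thesis
    using assms
    by (induct I rule: infinite_finite_induct)
       (simp_all add: M.finsum_infinite Pi_def quotient_simps(2,3) coset_in_carrier)
qed

lemma lin_ext_Q:
  assumes "\<And>x. x \<in> keys p \<Longrightarrow> keys (g x) \<subseteq> X"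
  shows "lin_ext Q (\<lambda>x. coset (g x)) p = coset (lin g p)"
  unfolding lin_ext_def lin_def quotient_simps(4)
  by (rule finsum_Q) (intro order_trans[OF keys_scale] assms)

text \<open>A map that is additive along \<open>K\<close> and vanishes there is constant on the
  coset, so its image is a singleton.\<close>

lemma the_elem_coset:
  assumes "\<And>k. k \<in> K \<Longrightarrow> L k = 0" "\<And>k. k \<in> K \<Longrightarrow> L (k + p) = L k + (L p :: 'm::monoid_add)"
  shows "the_elem (L ` coset p) = L p"
proof -
  have "L ` coset p = {L p}"
    using assms K_0 by (force simp: coset_eq)
  then show ?thesis by simp
qed

end

lemma span_of_mono: "submodule H scalars M \<Longrightarrow> S \<subseteq> H \<Longrightarrow> span_of M S \<subseteq> H"
  by (auto simp: span_of_def)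

lemma span_of_superset: "S \<subseteq> span_of M S"
  by (auto simp: span_of_def)

lemma span_of_closed:
  "\<zero>\<^bsub>M\<^esub> \<in> span_of M S"
  "p \<in> span_of M S \<Longrightarrow> q \<in> span_of M S \<Longrightarrow> p \<oplus>\<^bsub>M\<^esub> q \<in> span_of M S"
  "p \<in> span_of M S \<Longrightarrow> c \<odot>\<^bsub>M\<^esub> p \<in> span_of M S"
proof -
  have "\<zero>\<^bsub>M\<^esub> \<in> H" if "submodule H scalars M" for H
    using subgroup.one_closed[OF submodule.axioms(1)[OF that]] by simp
  then show "\<zero>\<^bsub>M\<^esub> \<in> span_of M S"
    by (auto simp: span_of_def)
  have "p \<oplus>\<^bsub>M\<^esub> q \<in> H" if "submodule H scalars M" "p \<in> H" "q \<in> H" for H p q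
    using subgroup.m_closed[OF submodule.axioms(1)[OF that(1)] that(2,3)] by simp
  then show "p \<in> span_of M S \<Longrightarrow> q \<in> span_of M S \<Longrightarrow> p \<oplus>\<^bsub>M\<^esub> q \<in> span_of M S"
    by (auto simp: span_of_def)
  have "c \<odot>\<^bsub>M\<^esub> p \<in> H" if "submodule H scalars M" "p \<in> H" for H p
    using submodule.smult_closed[OF that(1) _ that(2), of c] by simp
  then show "p \<in> span_of M S \<Longrightarrow> c \<odot>\<^bsub>M\<^esub> p \<in> span_of M S"
    by (auto simp: span_of_def)
qed

lemma free_submodule_span:
  fixes R :: "('x \<Rightarrow>\<^sub>0 'k::{comm_ring,comm_monoid_mult}) set"
  assumes "\<And>p. p \<in> R \<Longrightarrow> keys p \<subseteq> X"
  shows "free_submodule (span_of (free_module X) R) X"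
proof (rule free_submodule.intro)
  have "submodule (carrier (free_module X)) scalars (free_module X :: ('k, _) module)"
    by (rule module.carrier_is_submodule[OF module_free_module])
  then have "span_of (free_module X) R \<subseteq> carrier (free_module X)"
    using assms by (intro span_of_mono) auto
  then show "submodule (span_of (free_module X) R) scalars (free_module X)"
    using span_of_closed[where M = "free_module X" and S = R] by (auto simp: free_submodule_iff)
qed

text \<open>The elements that \<open>lin g\<close> sends into \<open>K\<close> form a submodule, so
  it is enough to check the generating relations.\<close>

lemma lin_span_subset:
  fixes R :: "('x \<Rightarrow>\<^sub>0 'k::{comm_ring,comm_monoid_mult}) set"
  assumes "free_submodule K Y" and R: "\<And>p. p \<in> R \<Longrightarrow> keys p \<subseteq> X"
    and g: "\<And>p. p \<in> R \<Longrightarrow> lin g p \<in> K"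
    and p: "p \<in> span_of (free_module X) R"
  shows "lin g p \<in> K"
proof -
  interpret free_submodule K Y by fact
  have "submodule {p. keys p \<subseteq> X \<and> lin g p \<in> K} scalars (free_module X)"
    unfolding free_submodule_iff
    by (auto simp: lin_add lin_scale K_add K_scale dest: keys_add[THEN subsetD] keys_scale[THEN subsetD])
  moreover have "R \<subseteq> {p. keys p \<subseteq> X \<and> lin g p \<in> K}"
    using R g by blast
  ultimately show ?thesis
    using span_of_mono p by blast
qed

section \<open>Freeness\<close>

lemma bij_betw_lin:
  fixes g :: "'x \<Rightarrow> 'z \<Rightarrow>\<^sub>0 'k::{comm_ring,comm_monoid_mult}"
  assumes inj: "\<And>p. keys p \<subseteq> X \<Longrightarrow> lin g p = 0 \<Longrightarrow> p = 0"
    and surj: "\<And>z. z \<in> Z \<Longrightarrow> \<exists>p. keys p \<subseteq> X \<and> lin g p = single z 1"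
    and g: "\<And>x. x \<in> X \<Longrightarrow> keys (g x) \<subseteq> Z"
  shows "bij_betw (lin g) {p. keys p \<subseteq> X} {p. keys p \<subseteq> Z}"
proof (rule bij_betwI')
  show "lin g p = lin g q \<longleftrightarrow> p = q"
    if "p \<in> {p. keys p \<subseteq> X}" "q \<in> {p. keys p \<subseteq> X}" for p q
    using that inj[of "p - q"] keys_diff_subset[of p X q] by (auto simp: lin_diff)
  show "lin g p \<in> {p. keys p \<subseteq> Z}" if "p \<in> {p. keys p \<subseteq> X}" for p
    using that g by (auto intro!: keys_lin)
  show "\<exists>p\<in>{p. keys p \<subseteq> X}. q = lin g p" if q: "q \<in> {p. keys p \<subseteq> Z}" for q
  proof -
    obtain P where P: "\<And>z. z \<in> Z \<Longrightarrow> keys (P z) \<subseteq> X"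
      "\<And>z. z \<in> Z \<Longrightarrow> lin g (P z) = single z 1"
      using surj by metis
    have "lin g (lin P q) = lin (\<lambda>z. single z 1) q"
      unfolding lin_lin using q P(2) by (intro lin_cong) auto
    then have "q = lin g (lin P q)"
      by (simp add: lin_id)
    moreover have "keys (lin P q) \<subseteq> X"
      using q P(1) by (intro keys_lin) auto
    ultimately show ?thesis by blast
  qed
qed

text \<open>For the zero ring, which the sort of the scalars admits.\<close>

lemma poly_mapping_trivial:
  fixes p q :: "'x \<Rightarrow>\<^sub>0 'k::{comm_ring,comm_monoid_mult}"
  assumes "(1::'k) = 0"
  shows "p = q"
proof -
  have "c = 0" for c :: 'k
    using assms mult_1_left[of c] by simp
  then show ?thesis
    by (intro poly_mapping_eqI) metis
qed

lemma ubp_hopf_algebra_simps [simp]: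
  "carrier ubp_hopf_algebra = {p. keys p \<subseteq> (\<Union>n. ubps n)}"
  "mult ubp_hopf_algebra = ubp_mult" "one ubp_hopf_algebra = single {} 1"
  "zero ubp_hopf_algebra = 0" "add ubp_hopf_algebra = (+)" "smult ubp_hopf_algebra = scale"
  "grade ubp_hopf_algebra n = {p. keys p \<subseteq> ubps n}"
  "comult ubp_hopf_algebra = ubp_comult" "counit ubp_hopf_algebra = (\<lambda>p. lookup p {})"
  by (simp_all add: ubp_hopf_algebra_def ubp_module_def)

lemma free_algebra_simps [simp]:
  "carrier (free_algebra X) = {p. keys p \<subseteq> lists X}"
  "mult (free_algebra X) = bilin_ext (@)" "one (free_algebra X) = single [] 1"
  "zero (free_algebra X) = 0" "add (free_algebra X) = (+)" "smult (free_algebra X) = scale"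
  by (simp_all add: free_algebra_def)

lemma ubp_mult_eq_lin:
  "ubp_mult p q = lin (\<lambda>f. lin (\<lambda>g. monoid_algebra_mult (sh (ubp_deg f) (ubp_deg g))
     (single (ubp_concat f g) 1)) q) p"
  by (simp add: ubp_mult_def lin_def scale_sum)

lemma ubp_mult_lin: "ubp_mult (lin F p) (lin G q) = lin (\<lambda>x. lin (\<lambda>y. ubp_mult (F x) (G y)) q) p"
  by (simp add: ubp_mult_eq_lin lin_lin) (subst lin_swap, rule refl)

text \<open>
  The word \<open>u\<close> encodes the inverse of the basis element \<open>dual_basis u\<close>: taking inverses turns
  the product into the sum over all shuffles, which is dual to the coproduct.
\<close>

definition dual_basis :: "nat set list \<Rightarrow> ubp \<Rightarrow>\<^sub>0 'k::{comm_ring,comm_monoid_mult}" where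
  "dual_basis u = single ((ubp_of u)\<inverse>) 1"

text \<open>The shuffle permutations act on the converse of the concatenation by permuting the word;
  since \<open>a\<close> and the shifted \<open>b\<close> share no letter, distinct permutations
  give distinct shuffles and every coefficient is 1.\<close>

lemma ubp_mult_dual_basis:
  assumes a: "a \<in> codes" and b: "b \<in> codes"
  shows "ubp_mult (dual_basis a) (dual_basis b) = (\<Sum>u\<in>{u. splits u a b}. dual_basis u)"
proof -
  have deg: "ubp_deg ((ubp_of a)\<inverse>) = length a" "ubp_deg ((ubp_of b)\<inverse>) = length b"
    using ubp_deg_converse[OF ubp_of_ubps[OF a]] ubp_deg_converse[OF ubp_of_ubps[OF b]] by simp_all
  have concat: "ubp_concat ((ubp_of a)\<inverse>) ((ubp_of b)\<inverse>) = (ubp_of (conc a b))\<inverse>"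
    using ubp_concat_converse[OF ubp_of_ubps[OF a]] ubp_concat_ubp_of[OF a b] by simp
  have comp: "ubp_comp (perm_ubp (length a + length b) \<xi>) ((ubp_of (conc a b))\<inverse>) =
      (ubp_of (permute_word \<xi> (conc a b)))\<inverse>" if "\<xi> \<in> Sh (length a) (length b)" for \<xi>
    using that ubp_comp_perm_left[OF conc_codes[OF a b], of \<xi>] by (simp add: Sh_def)
  have "ubp_mult (dual_basis a) (dual_basis b) =
      (\<Sum>\<xi>\<in>Sh (length a) (length b).
        single (ubp_comp (perm_ubp (length a + length b) \<xi>) ((ubp_of (conc a b))\<inverse>)) 1)"
    by (simp add: ubp_mult_eq_lin dual_basis_def deg concat monoid_algebra_mult_def bilin_ext_eq_lin
        sh_def lin_sum)
  also have "\<dots> = (\<Sum>\<xi>\<in>Sh (length a) (length b). dual_basis (permute_word \<xi> (conc a b)))"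
    using comp by (intro sum.cong) (simp_all add: dual_basis_def)
  also have "\<dots> = (\<Sum>u\<in>shuffles a (shift (length a) b). dual_basis u)"
    using sum.reindex_bij_betw[OF bij_betw_permute_word[OF set_codes_disjoint[OF a b]], of dual_basis]
    by (simp add: conc_def)
  also have "shuffles a (shift (length a) b) = {u. splits u a b}"
    using a b by (auto simp: splits_def)
  finally show ?thesis .
qed

text \<open>For \<open>w\<close> in \<open>lists codes\<close> this is the product of the elements
  \<open>dual_basis a\<close> for the entries \<open>a\<close> of \<open>w\<close>, already expanded
  in the basis.\<close>

definition word_product :: "nat set list list \<Rightarrow> ubp \<Rightarrow>\<^sub>0 'k::{comm_ring,comm_monoid_mult}" where
  "word_product w = (\<Sum>u\<in>{u. msplits u w}. dual_basis u)"

text \<open>Multiplying out gives a sum over all splittings into some \<open>a\<close> from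
  \<open>v\<close> and some \<open>b\<close> from \<open>w\<close>. All such \<open>a\<close> have
  the same length, so \<open>u\<close> determines the pair and occurs only once.\<close>

lemma word_product_append:
  "ubp_mult (word_product v) (word_product w) = word_product (v @ w)"
proof -
  define A where "A = {a. msplits a v}"
  define B where "B = {b. msplits b w}"
  have fin: "finite A" "finite B"
    by (simp_all add: A_def B_def finite_msplits_left)
  have ind: "word_product w' = lin dual_basis (\<Sum>u\<in>{u. msplits u w'}. single u 1)" for w'
    by (simp add: word_product_def lin_sum)
  have "ubp_mult (word_product v) (word_product w) =
      lin (\<lambda>a. lin (\<lambda>b. ubp_mult (dual_basis a) (dual_basis b)) (\<Sum>b\<in>B. single b 1))
        (\<Sum>a\<in>A. single a 1)"
    unfolding ind ubp_mult_lin A_def B_def ..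
  also have "\<dots> = (\<Sum>a\<in>A. \<Sum>b\<in>B. ubp_mult (dual_basis a) (dual_basis b))"
    by (simp add: lin_sum)
  also have "\<dots> = (\<Sum>a\<in>A. \<Sum>b\<in>B. \<Sum>u\<in>{u. splits u a b}. dual_basis u)"
    by (intro sum.cong refl ubp_mult_dual_basis) (auto simp: A_def B_def dest: msplits_codes)
  also have "\<dots> = (\<Sum>(a, b)\<in>A \<times> B. \<Sum>u\<in>{u. splits u a b}. dual_basis u)"
    by (rule sum.cartesian_product)
  also have "\<dots> = (\<Sum>x\<in>A \<times> B. \<Sum>u\<in>{u. splits u (fst x) (snd x)}. dual_basis u)"
    by (simp add: case_prod_unfold)
  also have "\<dots> = (\<Sum>u\<in>(\<Union>x\<in>A \<times> B. {u. splits u (fst x) (snd x)}). dual_basis u)"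
  proof (rule sum.UNION_disjoint[symmetric])
    show "finite (A \<times> B)" using fin by simp
    show "\<forall>x\<in>A \<times> B. finite {u. splits u (fst x) (snd x)}"
      by (auto simp: splits_def)
    show "\<forall>x\<in>A \<times> B. \<forall>y\<in>A \<times> B. x \<noteq> y \<longrightarrow>
        {u. splits u (fst x) (snd x)} \<inter> {u. splits u (fst y) (snd y)} = {}"
    proof (intro ballI impI)
      fix x y
      assume xy: "x \<in> A \<times> B" "y \<in> A \<times> B" "x \<noteq> y"
      then have "length (fst x) = length (fst y)"
        using msplits_length by (auto simp: A_def)
      with xy(3) show "{u. splits u (fst x) (snd x)} \<inter> {u. splits u (fst y) (snd y)} = {}"
        using splits_unique[of _ "fst x" "snd x" "fst y" "snd y"] by (auto simp: prod_eq_iff)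
    qed
  qed
  also have "(\<Union>x\<in>A \<times> B. {u. splits u (fst x) (snd x)}) = {u. msplits u (v @ w)}"
    unfolding msplits_append A_def B_def by fastforce
  finally show ?thesis
    by (simp add: word_product_def)
qed

lemma free_as_algebra_ubp_hopf_algebra:
  "free_as_algebra (ubp_hopf_algebra :: ('k::{comm_ring,comm_monoid_mult}, ubp \<Rightarrow>\<^sub>0 'k) graded_coalgebra)"
proof (cases "(1::'k) = 0")
  \<comment> \<open>Over the zero ring all elements are 0, and the free algebra on the empty set is
    isomorphic by the zero map.\<close>
  case True
  have eq: "(x :: 'a \<Rightarrow>\<^sub>0 'k) = 0" for x
    using True by (rule poly_mapping_trivial)
  have eq': "(x :: (ubp \<Rightarrow>\<^sub>0 'k) list \<Rightarrow>\<^sub>0 'k) = 0" for x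
    using True by (rule poly_mapping_trivial)
  have eq'': "(x :: ubp \<Rightarrow>\<^sub>0 'k) = 0" for x
    using True by (rule poly_mapping_trivial)
  let ?F = "free_algebra {} :: ('k, (ubp \<Rightarrow>\<^sub>0 'k) list \<Rightarrow>\<^sub>0 'k) module"
  let ?A = "ubp_hopf_algebra :: ('k, ubp \<Rightarrow>\<^sub>0 'k) graded_coalgebra"
  have c: "carrier ?F = {0}" "carrier ?A = {0}"
    using eq' eq'' by auto
  have "(\<lambda>_. 0) \<in> ring_iso ?F ?A"
    unfolding ring_iso_def ring_hom_def c using eq'' by (auto simp: bij_betw_def)
  moreover have "linear_map ?F ?A (\<lambda>_. 0)"
    unfolding linear_map_def c using eq'' by auto
  ultimately show ?thesis
    unfolding free_as_algebra_def by blast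
next
  case False
  define dual :: "nat set list \<Rightarrow> ubp" where "dual u = (ubp_of u)\<inverse>" for u
  have inj_dual: "inj dual"
    using ubp_of_inj by (auto simp: inj_def dual_def dest: arg_cong[where f = converse])
  have dual_codes: "dual ` codes = (\<Union>n. ubps n)"
  proof
    show "dual ` codes \<subseteq> (\<Union>n. ubps n)"
      unfolding dual_def using ubp_of_ubps ubps_converse by blast
    show "(\<Union>n. ubps n) \<subseteq> dual ` codes"
    proof
      fix f
      assume "f \<in> (\<Union>n. ubps n)"
      then have "f\<inverse> \<in> ubp_of ` codes"
        by (simp add: ubp_of_codes)
      then show "f \<in> dual ` codes"
        unfolding dual_def by (metis converse_converse imageE image_eqI)
    qed
  qed
  have dual_basis_eq: "dual_basis u = single (dual u) (1::'k)" for u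
    by (simp add: dual_basis_def dual_def)
  \<comment> \<open>Generators have to be elements of the algebra. As 1 differs from 0,
    \<open>dual_basis\<close> is injective, and \<open>dec\<close> below reads the irreducible word
    off a generator.\<close>
  define X where "X = (dual_basis ` irreducibles :: (ubp \<Rightarrow>\<^sub>0 'k) set)"
  have "inj (dual_basis :: _ \<Rightarrow> ubp \<Rightarrow>\<^sub>0 'k)"
  proof (rule injI)
    fix u v
    assume "dual_basis u = (dual_basis v :: ubp \<Rightarrow>\<^sub>0 'k)"
    then have "lookup (single (dual u) (1::'k)) (dual u) =
        lookup (single (dual v) 1) (dual u)"
      by (simp add: dual_basis_eq)
    then have "dual u = dual v"
      using False by (simp add: lookup_single when_def split: if_splits)
    then show "u = v"
      using inj_dual by (simp add: inj_eq)
  qed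
  then have bij: "bij_betw dual_basis irreducibles X"
    by (simp add: X_def bij_betw_def inj_on_subset[OF _ subset_UNIV])
  define dec where "dec = inv_into irreducibles (dual_basis :: _ \<Rightarrow> ubp \<Rightarrow>\<^sub>0 'k)"
  have dec: "bij_betw (map dec) (lists X) (lists irreducibles)"
    unfolding dec_def by (rule bij_lists[OF bij_betw_inv_into[OF bij]])
  define c where "c w = dual (concs (map dec w))" for w
  define S where "S w = dual ` {u. msplits u (map dec w)}" for w
  \<comment> \<open>All words in one column have the same length, and the diagonal one has the
    fewest inversions. Subtracting from the squared length turns this minimum into the maximum that
    \<open>unitriangular\<close> expects.\<close>
  define r where "r f = (let u = inv_into UNIV dual f in length u * length u - inversions u)" for f
  define g where "g w = (\<Sum>f\<in>S w. single f (1::'k))" for w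
  have g_eq: "g w = word_product (map dec w)" for w
    unfolding g_def S_def word_product_def dual_basis_eq
    by (rule sum.reindex[THEN trans]) (simp_all add: inj_on_subset[OF inj_dual])
  have "bij_betw dual codes (\<Union>n. ubps n)"
    using inj_dual dual_codes by (simp add: bij_betw_def inj_on_subset[OF _ subset_UNIV])
  from bij_betw_trans[OF bij_betw_trans[OF dec bij_betw_concs] this]
  have c: "bij_betw c (lists X) (\<Union>n. ubps n)"
    by (simp add: c_def[abs_def] comp_def)
  have dec_codes: "map dec w \<in> lists codes" if "w \<in> lists X" for w
    using that dec lists_mono[OF irreducibles_codes] by (auto simp: bij_betw_def)
  have S_fin: "finite (S w)" for w
    by (simp add: S_def finite_msplits_left)
  have S_sub: "S w \<subseteq> (\<Union>n. ubps n)" for w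
    unfolding dual_codes[symmetric] S_def using msplits_codes by blast
  have S_c: "c w \<in> S w" if "w \<in> lists X" for w
    unfolding c_def S_def using msplits_concs[OF dec_codes[OF that]] by blast
  have r: "r f < r (c w)" if f: "f \<in> S w" "f \<noteq> c w" for w f
  proof -
    obtain u where u: "f = dual u" "msplits u (map dec w)"
      using f(1) by (auto simp: S_def)
    then have ne: "u \<noteq> concs (map dec w)"
      using f(2) by (auto simp: c_def)
    have len: "length u = length (concs (map dec w))"
      using msplits_length[OF u(2)] by (simp add: length_concs)
    show ?thesis
      using inversions_msplits[OF u(2) ne] inversions_le[of u] len inj_dual
      by (simp add: r_def u(1) c_def Let_def)
  qed
  have bij_g: "bij_betw (lin g) {p. keys p \<subseteq> lists X} {p. keys p \<subseteq> (\<Union>n. ubps n)}"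
  proof (rule bij_betw_lin)
    show "p = 0" if "keys p \<subseteq> lists X" "lin g p = 0" for p
      by (rule unitriangular(1)[OF c, of S r]) (use S_fin S_sub S_c r that in \<open>simp_all add: g_def[abs_def]\<close>)
    show "\<exists>p. keys p \<subseteq> lists X \<and> lin g p = single z 1" if "z \<in> (\<Union>n. ubps n)" for z
      unfolding g_def[abs_def]
      by (rule unitriangular(2)[OF c, of S r]) (use S_fin S_sub S_c r that in simp_all)
    show "keys (g w) \<subseteq> (\<Union>n. ubps n)" for w
      unfolding g_def using S_sub[of w] by (intro keys_sum_subset keys_single_subset) blast
  qed
  have "lin g \<in> ring_iso (free_algebra X) ubp_hopf_algebra"
  proof -
    have "lin g (bilin_ext (@) p q) = ubp_mult (lin g p) (lin g q)" for p q
      by (simp add: bilin_ext_eq_lin lin_lin ubp_mult_lin g_eq word_product_append)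
    moreover have "lin g (single [] 1) = single {} 1"
      by (simp add: g_eq word_product_def dual_basis_def)
    ultimately show ?thesis
      using bij_g by (auto simp: ring_iso_def ring_hom_def lin_add bij_betw_def)
  qed
  moreover have "linear_map (free_algebra X) ubp_hopf_algebra (lin g)"
    using bij_g by (auto simp: linear_map_def lin_add lin_scale bij_betw_def)
  ultimately show ?thesis
    unfolding free_as_algebra_def by blast
qed

section \<open>Tensor products of modules\<close>

context free_submodule
begin

lemma lin_ext_Q_cong:
  assumes "\<And>x. x \<in> keys p \<Longrightarrow> b x = coset (g x)"
    and "\<And>x. x \<in> keys p \<Longrightarrow> keys (g x) \<subseteq> X"
  shows "lin_ext Q b p = coset (lin g p)"
proof -
  interpret module scalars Q
    by (rule module_Q)
  have "lin_ext Q b p = lin_ext Q (\<lambda>x. coset (g x)) p"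
    unfolding lin_ext_def
    by (rule M.finsum_cong') (use assms coset_in_carrier in auto)
  then show ?thesis
    using lin_ext_Q[of p g] assms(2) by simp
qed

lemma image_coset:
  assumes "\<And>q. q \<in> coset p \<Longrightarrow> f q = c"
  shows "f ` coset p = {c}"
proof -
  have "p \<in> coset p"
    by (simp add: in_coset)
  then show ?thesis
    using assms by (auto intro: image_eqI[of _ _ p])
qed

text \<open>Here \<Phi> is linear only modulo \<open>K\<close>, as is the map from \<open>y\<close>
  to \<open>single (x, y) 1\<close> modulo the tensor relations; it still commutes with linear
  combinations modulo \<open>K\<close>.\<close>

lemma K_linear:
  assumes add: "\<And>u v. keys u \<subseteq> U \<Longrightarrow> keys v \<subseteq> U \<Longrightarrow> \<Phi> (u + v) - \<Phi> u - \<Phi> v \<in> K"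
    and scale: "\<And>c v. keys v \<subseteq> U \<Longrightarrow> \<Phi> (scale c v) - scale c (\<Phi> v) \<in> K"
    and g: "\<And>a. a \<in> keys p \<Longrightarrow> keys (g a) \<subseteq> U"
  shows "\<Phi> (lin g p) - lin (\<lambda>a. \<Phi> (g a)) p \<in> K"
proof -
  \<comment> \<open>Covers the empty sum; it is the scaling rule for the scalar 0 and the vector
    0.\<close>
  have \<Phi>0: "\<Phi> 0 \<in> K"
    using scale[of 0 0] by simp
  have sum: "\<Phi> (sum f I) - (\<Sum>i\<in>I. \<Phi> (f i)) \<in> K"
    if "finite I" "\<And>i. i \<in> I \<Longrightarrow> keys (f i) \<subseteq> U" for f :: "'b \<Rightarrow> _" and I
    using that
  proof (induct I)
    case (insert i I)
    have "\<Phi> (f i + sum f I) - \<Phi> (f i) - \<Phi> (sum f I) \<in> K"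
      using insert by (intro add keys_sum_subset) auto
    then have "\<Phi> (f i + sum f I) - \<Phi> (f i) - \<Phi> (sum f I) + (\<Phi> (sum f I) - (\<Sum>i\<in>I. \<Phi> (f i))) \<in> K"
      using insert by (intro K_add) auto
    with insert(1,2) show ?case
      by (simp add: algebra_simps)
  qed (simp add: \<Phi>0)
  have "\<Phi> (lin g p) - (\<Sum>a\<in>keys p. \<Phi> (scale (lookup p a) (g a))) \<in> K"
    unfolding lin_def by (rule sum) (use g in \<open>auto intro!: order_trans[OF keys_scale]\<close>)
  moreover have "(\<Sum>a\<in>keys p. \<Phi> (scale (lookup p a) (g a))) - lin (\<lambda>a. \<Phi> (g a)) p \<in> K"
    unfolding lin_def sum_subtractf[symmetric] by (intro K_sum scale g)
  ultimately show ?thesis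
    by (rule K_trans)
qed

end

lemma tensor_rels_keys:
  assumes "module scalars M" "module scalars N" "p \<in> tensor_rels M N"
  shows "keys p \<subseteq> carrier M \<times> carrier N"
proof -
  interpret M: module scalars M by fact
  interpret N: module scalars N by fact
  show ?thesis
    using assms(3) unfolding tensor_rels_def
    by (elim UnE CollectE exE conjE; simp only:; intro keys_diff_subset keys_single_subset; simp)
qed

lemma free_submodule_tensor:
  assumes "module scalars M" "module scalars N"
  shows "free_submodule (tensor_kernel M N) (carrier M \<times> carrier N)"
  unfolding tensor_kernel_def using tensor_rels_keys[OF assms] by (rule free_submodule_span)

lemma tensor_rels_kernel: "p \<in> tensor_rels M N \<Longrightarrow> p \<in> tensor_kernel M N"
  unfolding tensor_kernel_def by (rule subsetD[OF span_of_superset])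

lemma tensor_kernel_relI:
  shows "x \<in> carrier M \<Longrightarrow> x' \<in> carrier M \<Longrightarrow> y \<in> carrier N \<Longrightarrow>
      single (x \<oplus>\<^bsub>M\<^esub> x', y) 1 - single (x, y) 1 - single (x', y) 1
      \<in> tensor_kernel M N"
    and "x \<in> carrier M \<Longrightarrow> y \<in> carrier N \<Longrightarrow> y' \<in> carrier N \<Longrightarrow>
      single (x, y \<oplus>\<^bsub>N\<^esub> y') 1 - single (x, y) 1 - single (x, y') 1
      \<in> tensor_kernel M N"
    and "x \<in> carrier M \<Longrightarrow> y \<in> carrier N \<Longrightarrow>
      single (c \<odot>\<^bsub>M\<^esub> x, y) 1 - single (x, y) c \<in> tensor_kernel M N"
    and "x \<in> carrier M \<Longrightarrow> y \<in> carrier N \<Longrightarrow>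
      single (x, c \<odot>\<^bsub>N\<^esub> y) 1 - single (x, y) c \<in> tensor_kernel M N"
  by (rule tensor_rels_kernel, unfold tensor_rels_def, blast)+

text \<open>Bilinearity of the tensor product on representatives, obtained by expanding the left
  factor and then the right one.\<close>

lemma tensor_free_lin:
  fixes f :: "'a \<Rightarrow> 'u \<Rightarrow>\<^sub>0 'k::{comm_ring,comm_monoid_mult}" and g :: "'b \<Rightarrow> 'u \<Rightarrow>\<^sub>0 'k"
  assumes f: "\<And>a. a \<in> keys p \<Longrightarrow> keys (f a) \<subseteq> U"
    and g: "\<And>b. b \<in> keys q \<Longrightarrow> keys (g b) \<subseteq> U"
  shows "single (lin f p, lin g q) 1 -
      lin (\<lambda>a. lin (\<lambda>b. single (f a, g b) 1) q) p
    \<in> tensor_kernel (free_module U) (free_module U)"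
proof -
  interpret free_submodule "tensor_kernel (free_module U) (free_module U) :: (_ \<Rightarrow>\<^sub>0 'k) set"
    "carrier (free_module U) \<times> carrier (free_module U)"
    by (intro free_submodule_tensor module_free_module)
  note rel = tensor_kernel_relI[where M = "free_module U" and N = "free_module U", simplified]
  have "single (lin f p, lin g q) 1 - lin (\<lambda>a. single (f a, lin g q) 1) p
      \<in> tensor_kernel (free_module U) (free_module U)"
    using rel(1,3) keys_lin[of q g U] g f
    by (intro K_linear[where \<Phi> = "\<lambda>x. single (x, lin g q) 1" and U = U]) auto
  moreover have "lin (\<lambda>a. single (f a, lin g q) 1) p -
      lin (\<lambda>a. lin (\<lambda>b. single (f a, g b) 1) q) p \<in> tensor_kernel (free_module U) (free_module U)"
  proof (rule K_lin_cong)
    fix a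
    assume "a \<in> keys p"
    note fa = f[OF this]
    show "single (f a, lin g q) 1 - lin (\<lambda>b. single (f a, g b) 1) q
        \<in> tensor_kernel (free_module U) (free_module U)"
      using rel(2)[OF fa] rel(4)[OF fa] g
      by (intro K_linear[where \<Phi> = "\<lambda>y. single (f a, y) 1" and U = U]) auto
  qed
  ultimately show ?thesis
    by (rule K_trans)
qed

text \<open>A linear \<open>h\<close> sends each tensor relation of \<open>M\<close> to one of
  \<open>N\<close>, so the map on representatives preserves the kernels and is constant on
  cosets.\<close>

lemma tensor_map_coset:
  fixes M :: "('k::{comm_ring,comm_monoid_mult}, 'm, 'y) module_scheme"
    and N :: "('k, 'n, 'z) module_scheme"
  assumes M: "module scalars M" and N: "module scalars N" and h: "linear_map M N h"
    and q: "keys q \<subseteq> carrier M \<times> carrier M"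
  shows "tensor_map M N h (tensor_kernel M M +>\<^bsub>free_module (carrier M \<times> carrier M)\<^esub> q) =
    tensor_kernel N N +>\<^bsub>free_module (carrier N \<times> carrier N)\<^esub>
      lin (\<lambda>(x, y). single (h x, h y) 1) q"
proof -
  interpret M: free_submodule "tensor_kernel M M" "carrier M \<times> carrier M"
    by (intro free_submodule_tensor M)
  interpret N: free_submodule "tensor_kernel N N" "carrier N \<times> carrier N"
    by (intro free_submodule_tensor N)
  let ?g = "\<lambda>(x, y). single (h x, h y) (1::'k)"
  have hc: "h x \<in> carrier N" if "x \<in> carrier M" for x
    using h that by (auto simp: linear_map_def)
  have keys: "keys (?g z) \<subseteq> carrier N \<times> carrier N" if "z \<in> carrier M \<times> carrier M" for z
    using that hc by (auto intro!: keys_single_subset)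
  have K: "lin ?g k \<in> tensor_kernel N N" if "k \<in> tensor_kernel M M" for k
  proof (rule lin_span_subset[OF N.free_submodule_axioms])
    show "k \<in> span_of (free_module (carrier M \<times> carrier M)) (tensor_rels M M)"
      using that by (simp add: tensor_kernel_def)
    show "keys r \<subseteq> carrier M \<times> carrier M" if "r \<in> tensor_rels M M" for r
      using tensor_rels_keys[OF M M that] .
    show "lin ?g r \<in> tensor_kernel N N" if "r \<in> tensor_rels M M" for r
      using that h unfolding tensor_rels_def linear_map_def
      by (elim UnE CollectE exE conjE) (auto simp: lin_diff hc intro!: tensor_kernel_relI)
  qed
  have ext: "lin_ext (tensor N N) (\<lambda>(x, y). pure_tensor N N (h x) (h y)) q' = N.coset (lin ?g q')"
    if "keys q' \<subseteq> carrier M \<times> carrier M" for q'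
    unfolding tensor_def
    by (rule N.lin_ext_Q_cong) (use that keys in \<open>auto simp: pure_tensor_def\<close>)
  have "lin_ext (tensor N N) (\<lambda>(x, y). pure_tensor N N (h x) (h y)) ` M.coset q = {N.coset (lin ?g q)}"
  proof (rule M.image_coset)
    fix q'
    assume q': "q' \<in> M.coset q"
    then have "N.coset (lin ?g q') = N.coset (lin ?g q)"
      using K[of "q' - q"] by (simp only: M.in_coset N.coset_eq_iff lin_diff)
    then show "lin_ext (tensor N N) (\<lambda>(x, y). pure_tensor N N (h x) (h y)) q' = N.coset (lin ?g q)"
      using ext[OF M.coset_keys[OF q' q]] by (rule trans[rotated])
  qed
  then show ?thesis
    by (simp add: tensor_map_def)
qed

section \<open>Tensor powers of a free module\<close>

text \<open>The multilinear expansion of a pure tensor in words over the basis: the coefficient of a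
  word of the same length is the product of the coefficients of its letters. It respects
  \<open>word_rels\<close>, hence lives on the tensor powers.\<close>

fun expand :: "('y \<Rightarrow>\<^sub>0 'k::{comm_ring,comm_monoid_mult}) list \<Rightarrow> ('y list \<Rightarrow>\<^sub>0 'k)" where
  "expand [] = single [] 1"
| "expand (v # vs) = lin (\<lambda>y. lin (\<lambda>w. single (y # w) 1) (expand vs)) v"

lemma expand_append:
  "expand (us @ vs) = lin (\<lambda>w. lin (\<lambda>w'. single (w @ w') 1) (expand vs)) (expand us)"
  by (induct us) (simp_all add: lin_lin lin_id)

lemma expand_add:
  "expand (xs @ [u + v] @ ys) = expand (xs @ [u] @ ys) + expand (xs @ [v] @ ys)"
  by (induct xs) (simp_all add: lin_add lin_add_fun)

lemma expand_scale: "expand (xs @ [scale c v] @ ys) = scale c (expand (xs @ [v] @ ys))"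
  by (induct xs) (simp_all add: lin_scale lin_scale_fun)

lemma expand_basis: "expand (map (\<lambda>y. single y 1) w) = single w 1"
  by (induct w) simp_all

lemma keys_expand:
  "w \<in> keys (expand vs) \<Longrightarrow> list_all2 (\<lambda>v y. y \<in> keys v) vs w"
proof (induct vs arbitrary: w)
  case Nil
  then show ?case
    by (auto simp: keys_single split: if_splits)
next
  case (Cons v vs)
  have "keys (expand (v # vs)) \<subseteq>
      {y # w | y w. y \<in> keys v \<and> w \<in> keys (expand vs)}"
    unfolding expand.simps by (intro keys_lin keys_single_subset) blast
  with Cons.prems obtain y w' where "w = y # w'" "y \<in> keys v" "w' \<in> keys (expand vs)"
    by blast
  then show ?case
    using Cons.hyps by simp
qed

locale cotensor =
  fixes Y :: "'y set" and G :: "nat \<Rightarrow> ('y \<Rightarrow>\<^sub>0 'k::{comm_ring,comm_monoid_mult}) set"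
begin

abbreviation V :: "('k, 'y \<Rightarrow>\<^sub>0 'k) module" where
  "V \<equiv> free_module Y"

abbreviation vwords :: "('y \<Rightarrow>\<^sub>0 'k) list set" where
  "vwords \<equiv> lists {v. keys v \<subseteq> Y}"

abbreviation basis_word :: "'y list \<Rightarrow> ('y \<Rightarrow>\<^sub>0 'k) list" where
  "basis_word \<equiv> map (\<lambda>y. single y 1)"

lemma word_rels_keys:
  assumes "r \<in> word_rels V"
  shows "keys r \<subseteq> vwords"
  using assms unfolding word_rels_def
  by (elim UnE CollectE exE conjE; simp only:; intro keys_diff_subset keys_single_subset;
      simp add: keys_add_subset order_trans[OF keys_scale])

sublocale W: free_submodule "word_kernel V" "vwords"
  using free_submodule_span[of "word_rels V" vwords] word_rels_keys by (simp add: word_kernel_def)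

lemma tensor_powers_eq: "tensor_powers V = W.Q"
  by (simp add: tensor_powers_def)

lemma module_tensor_powers: "module scalars (tensor_powers V)"
  unfolding tensor_powers_eq by (rule W.module_Q)

lemma pure_word_eq: "pure_word V vs = W.coset (single vs 1)"
  by (simp add: pure_word_def)

lemma pure_word_carrier: "vs \<in> vwords \<Longrightarrow> pure_word V vs \<in> carrier (tensor_powers V)"
  unfolding pure_word_eq tensor_powers_eq by (intro W.coset_in_carrier keys_single_subset)

lemma word_rel_add:
  assumes "xs \<in> vwords" "ys \<in> vwords" "keys u \<subseteq> Y" "keys v \<subseteq> Y"
  shows "single (xs @ [u + v] @ ys) 1 - single (xs @ [u] @ ys) 1
      - single (xs @ [v] @ ys) 1 \<in> word_kernel V"
proof -
  have "single (xs @ [u + v] @ ys) 1 - single (xs @ [u] @ ys) 1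
      - single (xs @ [v] @ ys) 1 \<in> word_rels V"
    unfolding word_rels_def
    by (rule UnI1, rule CollectI, rule exI[of _ xs], rule exI[of _ u], rule exI[of _ v], rule exI[of _ ys])
       (use assms in simp)
  then show ?thesis
    unfolding word_kernel_def by (rule subsetD[OF span_of_superset])
qed

lemma word_rel_scale:
  assumes "xs \<in> vwords" "ys \<in> vwords" "keys v \<subseteq> Y"
  shows "single (xs @ [scale c v] @ ys) 1 - single (xs @ [v] @ ys) c \<in> word_kernel V"
proof -
  have "single (xs @ [scale c v] @ ys) 1 - single (xs @ [v] @ ys) c \<in> word_rels V"
    unfolding word_rels_def
    by (rule UnI2, rule CollectI, rule exI[of _ xs], rule exI[of _ c], rule exI[of _ v], rule exI[of _ ys])
       (use assms in simp)
  then show ?thesis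
    unfolding word_kernel_def by (rule subsetD[OF span_of_superset])
qed

lemma lin_word_kernel:
  assumes K: "free_submodule K Z" and k: "k \<in> word_kernel V"
    and add: "\<And>xs ys u v. xs \<in> vwords \<Longrightarrow> ys \<in> vwords \<Longrightarrow> keys u \<subseteq> Y \<Longrightarrow> keys v \<subseteq> Y \<Longrightarrow>
      g (xs @ [u + v] @ ys) - g (xs @ [u] @ ys) - g (xs @ [v] @ ys) \<in> K"
    and scale: "\<And>xs ys c v. xs \<in> vwords \<Longrightarrow> ys \<in> vwords \<Longrightarrow> keys v \<subseteq> Y \<Longrightarrow>
      g (xs @ [scale c v] @ ys) - scale c (g (xs @ [v] @ ys)) \<in> K"
  shows "lin g k \<in> K"
proof (rule lin_span_subset[OF K])
  show "k \<in> span_of (free_module vwords) (word_rels V)"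
    using k by (simp add: word_kernel_def)
  show "lin g r \<in> K" if "r \<in> word_rels V" for r
    using that unfolding word_rels_def
  proof (elim UnE CollectE exE conjE)
    fix xs u v ys
    assume "r = single (xs @ [u \<oplus>\<^bsub>V\<^esub> v] @ ys) 1 - single (xs @ [u] @ ys) 1 -
        single (xs @ [v] @ ys) 1"
      "xs \<in> lists (carrier V)" "u \<in> carrier V" "v \<in> carrier V" "ys \<in> lists (carrier V)"
    then show ?thesis
      using add[of xs ys u v] by (simp add: lin_diff)
  next
    fix xs c v ys
    assume "r = single (xs @ [c \<odot>\<^bsub>V\<^esub> v] @ ys) 1 - single (xs @ [v] @ ys) c"
      "xs \<in> lists (carrier V)" "v \<in> carrier V" "ys \<in> lists (carrier V)"
    then show ?thesis
      using scale[of xs ys v c] by (simp add: lin_diff)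
  qed
qed (rule word_rels_keys)

text \<open>Entries are replaced by basis elements from left to right, by multilinearity modulo the
  relations; \<open>us\<close> is the prefix already treated, which grows along the
  induction.\<close>

lemma word_expand:
  assumes "us \<in> vwords" "vs \<in> vwords"
  shows "single (us @ vs) 1 -
    lin (\<lambda>w. single (us @ basis_word w) 1) (expand vs) \<in> word_kernel V"
  using assms
proof (induct vs arbitrary: us)
  case (Cons v vs)
  have v: "keys v \<subseteq> Y" and vs: "vs \<in> vwords"
    using Cons.prems(2) by auto
  have y: "keys (single y (1::'k)) \<subseteq> Y" if "y \<in> keys v" for y
    using that v by (intro keys_single_subset) blast
  have "single (us @ [lin (\<lambda>y. single y 1) v] @ vs) 1 -
      lin (\<lambda>y. single (us @ [single y 1] @ vs) 1) v \<in> word_kernel V"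
  proof (rule W.K_linear[where \<Phi> = "\<lambda>x. single (us @ [x] @ vs) 1" and U = Y])
    show "single (us @ [scale c x] @ vs) 1 - scale c (single (us @ [x] @ vs) 1) \<in> word_kernel V"
      if "keys x \<subseteq> Y" for c x
      using word_rel_scale[OF Cons.prems(1) vs that, of c] by simp
  qed (use word_rel_add[OF Cons.prems(1) vs] y in blast)+
  moreover have "lin (\<lambda>y. single (us @ [single y 1] @ vs) 1) v -
      lin (\<lambda>y. lin (\<lambda>w. single ((us @ [single y 1]) @ basis_word w) 1) (expand vs)) v
      \<in> word_kernel V"
  proof (rule W.K_lin_cong)
    fix y
    assume "y \<in> keys v"
    then have "us @ [single y 1] \<in> vwords"
      using Cons.prems(1) y by simp
    from Cons.hyps[OF this vs]
    show "single (us @ [single y 1] @ vs) 1 -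
        lin (\<lambda>w. single ((us @ [single y 1]) @ basis_word w) 1) (expand vs) \<in> word_kernel V"
      by simp
  qed
  ultimately have "single (us @ [lin (\<lambda>y. single y 1) v] @ vs) 1 -
      lin (\<lambda>y. lin (\<lambda>w. single ((us @ [single y 1]) @ basis_word w) 1) (expand vs)) v
      \<in> word_kernel V"
    by (rule W.K_trans)
  then show ?case
    by (simp add: lin_id lin_lin)
qed simp

lemma lin_expand_word_kernel:
  fixes \<phi> :: "'y list \<Rightarrow> 'z \<Rightarrow>\<^sub>0 'k"
  assumes "k \<in> word_kernel V"
  shows "lin (\<lambda>vs. lin \<phi> (expand vs)) k = 0"
proof -
  \<comment> \<open>Membership in the zero submodule is the desired equation, so the general rule
    for the word relations applies.\<close>
  have "free_submodule {0 :: 'z \<Rightarrow>\<^sub>0 'k} UNIV"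
    by (rule free_submodule.intro) (simp add: free_submodule_iff)
  then have "lin (\<lambda>vs. lin \<phi> (expand vs)) k \<in> {0 :: 'z \<Rightarrow>\<^sub>0 'k}"
    using assms by (rule lin_word_kernel) (simp_all only: expand_add expand_scale lin_add lin_scale, simp_all)
  then show ?thesis by simp
qed

lemma the_elem_lin_expand:
  "the_elem (lin (\<lambda>vs. lin \<phi> (expand vs)) ` W.coset p) = lin (\<lambda>vs. lin \<phi> (expand vs)) p"
  by (rule W.the_elem_coset) (simp_all add: lin_add lin_expand_word_kernel)

abbreviation TK :: "((('y \<Rightarrow>\<^sub>0 'k) list \<Rightarrow>\<^sub>0 'k) set \<times> (('y \<Rightarrow>\<^sub>0 'k) list \<Rightarrow>\<^sub>0 'k) set \<Rightarrow>\<^sub>0 'k) set" where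
  "TK \<equiv> tensor_kernel (tensor_powers V) (tensor_powers V)"

sublocale T: free_submodule "TK"
    "carrier (tensor_powers V) \<times> carrier (tensor_powers V)"
  by (intro free_submodule_tensor module_tensor_powers)

text \<open>A representative of the deconcatenation coproduct, before passing to the quotient by
  \<open>TK\<close>.\<close>

definition deconc :: "('y \<Rightarrow>\<^sub>0 'k) list \<Rightarrow>
    (('y \<Rightarrow>\<^sub>0 'k) list \<Rightarrow>\<^sub>0 'k) set \<times> (('y \<Rightarrow>\<^sub>0 'k) list \<Rightarrow>\<^sub>0 'k) set \<Rightarrow>\<^sub>0 'k" where
  "deconc vs = (\<Sum>i\<in>{0..length vs}. single (pure_word V (take i vs), pure_word V (drop i vs)) 1)"

lemma vwords_middle: "xs \<in> vwords \<Longrightarrow> keys v \<subseteq> Y \<Longrightarrow> ys \<in> vwords \<Longrightarrow> xs @ [v] @ ys \<in> vwords"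
  by simp

lemma take_drop_vwords: "vs \<in> vwords \<Longrightarrow> take i vs \<in> vwords" "vs \<in> vwords \<Longrightarrow> drop i vs \<in> vwords"
  by (auto dest: in_set_takeD in_set_dropD)

lemma keys_deconc:
  "vs \<in> vwords \<Longrightarrow> keys (deconc vs) \<subseteq> carrier (tensor_powers V) \<times> carrier (tensor_powers V)"
  unfolding deconc_def
  by (intro keys_sum_subset keys_single_subset SigmaI pure_word_carrier take_drop_vwords)

lemma pure_word_add:
  assumes "xs \<in> vwords" "ys \<in> vwords" "keys u \<subseteq> Y" "keys v \<subseteq> Y"
  shows "pure_word V (xs @ [u + v] @ ys) =
    pure_word V (xs @ [u] @ ys) \<oplus>\<^bsub>tensor_powers V\<^esub> pure_word V (xs @ [v] @ ys)"
  using word_rel_add[OF assms]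
  unfolding pure_word_eq tensor_powers_eq W.quotient_simps W.coset_eq_iff by (simp add: diff_diff_add)

lemma pure_word_scale:
  assumes "xs \<in> vwords" "ys \<in> vwords" "keys v \<subseteq> Y"
  shows "pure_word V (xs @ [scale c v] @ ys) = c \<odot>\<^bsub>tensor_powers V\<^esub> pure_word V (xs @ [v] @ ys)"
  using word_rel_scale[OF assms, of c]
  unfolding pure_word_eq tensor_powers_eq W.quotient_simps W.coset_eq_iff by simp

lemma take_drop_middle:
  "i \<le> length xs \<Longrightarrow> take i (xs @ [v] @ ys) = take i xs"
  "i \<le> length xs \<Longrightarrow> drop i (xs @ [v] @ ys) = drop i xs @ [v] @ ys"
  "\<not> i \<le> length xs \<Longrightarrow> take i (xs @ [v] @ ys) = xs @ [v] @ take (i - length xs - 1) ys"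
  "\<not> i \<le> length xs \<Longrightarrow> drop i (xs @ [v] @ ys) = drop (i - length xs - 1) ys"
  by (auto simp: take_Cons' drop_Cons')

text \<open>A word relation changes a single entry. At each cut this entry lies in the left or in
  the right part, and the summand becomes a tensor relation in that factor.\<close>

lemma lin_deconc_word_kernel:
  assumes "k \<in> word_kernel V"
  shows "lin deconc k \<in> TK"
proof (rule lin_word_kernel[OF T.free_submodule_axioms assms])
  fix xs ys and u v :: "'y \<Rightarrow>\<^sub>0 'k"
  assume w: "xs \<in> vwords" "ys \<in> vwords" "keys u \<subseteq> Y" "keys v \<subseteq> Y"
  have uv: "keys (u + v) \<subseteq> Y"
    using w by (intro keys_add_subset)
  let ?s = "\<lambda>z i. single (pure_word V (take i (xs @ [z] @ ys)), pure_word V (drop i (xs @ [z] @ ys))) (1::'k)"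
  have "?s (u + v) i - ?s u i - ?s v i \<in> TK" for i
  proof (cases "i \<le> length xs")
    case True
    show ?thesis
      unfolding take_drop_middle(1,2)[OF True]
        pure_word_add[OF take_drop_vwords(2)[OF w(1)] w(2-4)]
      by (rule tensor_kernel_relI(2)) (intro pure_word_carrier vwords_middle take_drop_vwords w)+
  next
    case False
    show ?thesis
      unfolding take_drop_middle(3,4)[OF False]
        pure_word_add[OF w(1) take_drop_vwords(1)[OF w(2)] w(3,4)]
      by (rule tensor_kernel_relI(1)) (intro pure_word_carrier vwords_middle take_drop_vwords w)+
  qed
  then have "(\<Sum>i\<in>{0..length (xs @ [u] @ ys)}. ?s (u + v) i - ?s u i - ?s v i)
      \<in> TK"
    by (rule T.K_sum)
  then show "deconc (xs @ [u + v] @ ys) - deconc (xs @ [u] @ ys) - deconc (xs @ [v] @ ys)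
      \<in> TK"
    by (simp add: deconc_def sum_subtractf)
next
  fix xs ys and c :: 'k and v :: "'y \<Rightarrow>\<^sub>0 'k"
  assume w: "xs \<in> vwords" "ys \<in> vwords" "keys v \<subseteq> Y"
  let ?s = "\<lambda>z i. single (pure_word V (take i (xs @ [z] @ ys)), pure_word V (drop i (xs @ [z] @ ys)))"
  have "?s (scale c v) i 1 - ?s v i c \<in> TK" for i
  proof (cases "i \<le> length xs")
    case True
    show ?thesis
      unfolding take_drop_middle(1,2)[OF True]
        pure_word_scale[OF take_drop_vwords(2)[OF w(1)] w(2-3)]
      by (rule tensor_kernel_relI(4)) (intro pure_word_carrier vwords_middle take_drop_vwords w)+
  next
    case False
    show ?thesis
      unfolding take_drop_middle(3,4)[OF False]
        pure_word_scale[OF w(1) take_drop_vwords(1)[OF w(2)] w(3)]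
      by (rule tensor_kernel_relI(3)) (intro pure_word_carrier vwords_middle take_drop_vwords w)+
  qed
  then have "(\<Sum>i\<in>{0..length (xs @ [v] @ ys)}. ?s (scale c v) i 1 - ?s v i c)
      \<in> TK"
    by (rule T.K_sum)
  then show "deconc (xs @ [scale c v] @ ys) - scale c (deconc (xs @ [v] @ ys))
      \<in> TK"
    by (simp only: deconc_def scale_sum scale_single mult_1_right sum_subtractf length_append list.size)
qed

abbreviation C :: "('k, (('y \<Rightarrow>\<^sub>0 'k) list \<Rightarrow>\<^sub>0 'k) set) graded_coalgebra" where
  "C \<equiv> cotensor_coalgebra V G"

lemma comult_coset:
  assumes p: "keys p \<subseteq> vwords"
  shows "comult C (W.coset p) = T.coset (lin deconc p)"
proof -
  have deconc: "(\<Oplus>\<^bsub>T.Q\<^esub>i\<in>{0..length vs}.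
      pure_tensor (tensor_powers V) (tensor_powers V) (pure_word V (take i vs)) (pure_word V (drop i vs))) =
      T.coset (deconc vs)" if "vs \<in> vwords" for vs
    unfolding pure_tensor_def deconc_def
    by (intro T.finsum_Q keys_single_subset SigmaI pure_word_carrier take_drop_vwords that)
  have ext: "lin_ext T.Q (\<lambda>vs. \<Oplus>\<^bsub>T.Q\<^esub>i\<in>{0..length vs}.
      pure_tensor (tensor_powers V) (tensor_powers V) (pure_word V (take i vs)) (pure_word V (drop i vs))) q =
      T.coset (lin deconc q)" if "keys q \<subseteq> vwords" for q
    using that by (intro T.lin_ext_Q_cong deconc keys_deconc) auto
  have "lin_ext T.Q (\<lambda>vs. \<Oplus>\<^bsub>T.Q\<^esub>i\<in>{0..length vs}.
      pure_tensor (tensor_powers V) (tensor_powers V) (pure_word V (take i vs)) (pure_word V (drop i vs))) `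
      W.coset p = {T.coset (lin deconc p)}"
  proof (rule W.image_coset)
    fix q
    assume q: "q \<in> W.coset p"
    then have "T.coset (lin deconc q) = T.coset (lin deconc p)"
      using lin_deconc_word_kernel[of "q - p"] by (simp only: W.in_coset T.coset_eq_iff lin_diff)
    then show "lin_ext T.Q (\<lambda>vs. \<Oplus>\<^bsub>T.Q\<^esub>i\<in>{0..length vs}.
      pure_tensor (tensor_powers V) (tensor_powers V) (pure_word V (take i vs)) (pure_word V (drop i vs))) q =
      T.coset (lin deconc p)"
      using ext[OF W.coset_keys[OF q p]] by (rule trans[rotated])
  qed
  then show ?thesis
    by (simp add: cotensor_coalgebra_def tensor_def)
qed

lemma counit_coset: "counit C (W.coset p) = lookup p []"
proof -
  \<comment> \<open>The coefficient at the empty word is written as a linear map to the free module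
    on one point, so that \<open>lin_word_kernel\<close> can show that it vanishes on the
    relations.\<close>
  have lin: "lin (\<lambda>vs. single () (if vs = [] then 1 else 0)) q = single () (lookup q [])"
    for q :: "('y \<Rightarrow>\<^sub>0 'k) list \<Rightarrow>\<^sub>0 'k"
  proof (rule poly_mapping_eqI)
    show "lookup (lin (\<lambda>vs. single () (if vs = [] then 1 else 0)) q) x =
        lookup (single () (lookup q [])) x" for x
      by (simp add: lookup_lin if_distrib[of "\<lambda>c. _ * c"] sum.delta in_keys_iff cong: if_cong)
  qed
  have "lookup k [] = 0" if "k \<in> word_kernel V" for k
  proof -
    have "free_submodule {0 :: unit \<Rightarrow>\<^sub>0 'k} UNIV"
      by (rule free_submodule.intro) (simp add: free_submodule_iff)
    then have "lin (\<lambda>vs. single () (if vs = [] then 1 else 0)) k \<in> {0 :: unit \<Rightarrow>\<^sub>0 'k}"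
      using that by (rule lin_word_kernel) simp_all
    then have "lookup (single () (lookup k [])) () = 0"
      unfolding lin by simp
    then show ?thesis by simp
  qed
  then have "the_elem ((\<lambda>q. lookup q []) ` W.coset p) = lookup p []"
    by (intro W.the_elem_coset) (simp_all add: lookup_add)
  then show ?thesis
    by (simp add: cotensor_coalgebra_def)
qed

lemma cotensor_simps:
  "carrier C = W.coset ` {p. keys p \<subseteq> vwords}" "add C = add W.Q" "smult C = smult W.Q"
  by (simp_all add: cotensor_coalgebra_def tensor_powers_eq W.quotient_simps(1))

end

section \<open>Cofreeness\<close>

text \<open>A basis element \<open>y\<close> can occur only in the component of degree
  \<open>\<delta> y\<close>, so the components of \<open>p\<close> are forced: each collects the
  terms of \<open>p\<close> of its degree.\<close>

lemma graded_free_module: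
  fixes \<delta> :: "'y \<Rightarrow> nat"
  shows "graded_module (free_module Y :: ('k::{comm_ring,comm_monoid_mult}, 'y \<Rightarrow>\<^sub>0 'k) module)
    (\<lambda>d. {p. keys p \<subseteq> {y\<in>Y. \<delta> y = d}})"
  unfolding graded_module_def
proof (intro conjI allI ballI)
  show "submodule {p. keys p \<subseteq> {y\<in>Y. \<delta> y = d}} scalars (free_module Y :: ('k, _) module)" for d
    unfolding free_submodule_iff by (auto dest!: keys_add[THEN subsetD] keys_scale[THEN subsetD])
  fix p :: "'y \<Rightarrow>\<^sub>0 'k"
  assume "p \<in> carrier (free_module Y)"
  then have p: "keys p \<subseteq> Y" by simp
  define c where "c d = lin (\<lambda>y. if \<delta> y = d then single y 1 else 0) p" for d
  have lookup_c: "lookup (c d) y = (if \<delta> y = d then lookup p y else 0)" for d y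
  proof -
    have "lookup (c d) y =
        (\<Sum>x\<in>keys p. if x = y then (if \<delta> y = d then lookup p y else 0) else 0)"
      unfolding c_def lookup_lin by (rule sum.cong) (auto simp: lookup_single when_def)
    then show ?thesis
      by (auto simp: sum.delta in_keys_iff)
  qed
  have keys_c: "keys (c d) \<subseteq> {y\<in>Y. \<delta> y = d}" for d
    using p by (auto simp: in_keys_iff lookup_c split: if_splits)
  have lookup_finsum: "lookup (\<Oplus>\<^bsub>free_module Y\<^esub>d\<in>{d. c' d \<noteq> \<zero>\<^bsub>free_module Y\<^esub>}. c' d) y =
      lookup (c' (\<delta> y)) y"
    if c': "\<And>d. keys (c' d) \<subseteq> {y\<in>Y. \<delta> y = d}" and fin: "finite {d. c' d \<noteq> 0}"
    for c' :: "nat \<Rightarrow> 'y \<Rightarrow>\<^sub>0 'k" and y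
  proof -
    have 1: "(\<Oplus>\<^bsub>free_module Y\<^esub>d\<in>{d. c' d \<noteq> \<zero>\<^bsub>free_module Y\<^esub>}. c' d) = (\<Sum>d\<in>{d. c' d \<noteq> 0}. c' d)"
      using c' by (simp, intro finsum_free_module) blast
    have 2: "lookup (c' d) y = (if d = \<delta> y then lookup (c' (\<delta> y)) y else 0)" for d
      using c'[of d] by (auto simp: in_keys_iff)
    have "lookup (\<Oplus>\<^bsub>free_module Y\<^esub>d\<in>{d. c' d \<noteq> \<zero>\<^bsub>free_module Y\<^esub>}. c' d) y =
        (\<Sum>d\<in>{d. c' d \<noteq> 0}. lookup (c' d) y)"
      by (simp only: 1 lookup_sum)
    also have "\<dots> = (\<Sum>d\<in>{d. c' d \<noteq> 0}. if d = \<delta> y then lookup (c' (\<delta> y)) y else 0)"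
      by (rule sum.cong[OF refl 2])
    also have "\<dots> = lookup (c' (\<delta> y)) y"
      using fin by (simp add: sum.delta)
    finally show ?thesis .
  qed
  have fin: "finite {d. c d \<noteq> 0}"
  proof (rule finite_subset)
    show "{d. c d \<noteq> 0} \<subseteq> \<delta> ` keys p"
    proof
      fix d
      assume "d \<in> {d. c d \<noteq> 0}"
      then obtain y where "lookup (c d) y \<noteq> 0"
        by (auto simp: poly_mapping_eq_iff fun_eq_iff)
      then show "d \<in> \<delta> ` keys p"
        by (auto simp: lookup_c in_keys_iff split: if_splits)
    qed
  qed simp
  show "\<exists>!c. (\<forall>d. c d \<in> {p. keys p \<subseteq> {y\<in>Y. \<delta> y = d}}) \<and> finite {d. c d \<noteq> \<zero>\<^bsub>free_module Y\<^esub>} \<and>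
      p = (\<Oplus>\<^bsub>free_module Y\<^esub>d\<in>{d. c d \<noteq> \<zero>\<^bsub>free_module Y\<^esub>}. c d)" (is "\<exists>!c. ?P c")
  proof (rule ex1I)
    have "p = (\<Oplus>\<^bsub>free_module Y\<^esub>d\<in>{d. c d \<noteq> \<zero>\<^bsub>free_module Y\<^esub>}. c d)"
      by (rule poly_mapping_eqI) (simp only: lookup_finsum[OF keys_c fin] lookup_c refl if_True)
    then show "?P c"
      using keys_c fin by simp
  next
    fix c'
    assume c': "?P c'"
    then have k: "keys (c' d) \<subseteq> {y\<in>Y. \<delta> y = d}" and f: "finite {d. c' d \<noteq> 0}" for d
      by auto
    have p': "lookup p y = lookup (c' (\<delta> y)) y" for y
      using c' lookup_finsum[OF k f, of y] by metis
    show "c' = c"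
    proof (rule ext, rule poly_mapping_eqI)
      fix d y
      show "lookup (c' d) y = lookup (c d) y"
        using k[of d] by (auto simp: lookup_c p' in_keys_iff)
    qed
  qed
qed (rule module_free_module)

context free_submodule
begin

lemma submodule_Q:
  assumes "free_submodule D X"
  shows "submodule (coset ` D) scalars Q"
proof -
  interpret D: free_submodule D X by fact
  interpret module scalars Q by (rule module_Q)
  show ?thesis
  proof (rule submoduleI)
    show "coset ` D \<subseteq> carrier Q"
      using D.K_keys coset_in_carrier by blast
    show "\<ominus>\<^bsub>Q\<^esub> T \<in> coset ` D" if T: "T \<in> coset ` D" for T
    proof -
      obtain p where p: "p \<in> D" "T = coset p" using T by blast
      have "\<ominus>\<^bsub>Q\<^esub> T = coset (- p)"
        using D.K_keys[OF p(1)] coset_in_carrier[of p] coset_in_carrier[of "- p"]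
        by (intro M.minus_equality) (simp_all add: p(2) quotient_simps(2,3))
      then show ?thesis
        using D.K_uminus[OF p(1)] by blast
    qed
  qed (use D.K_add D.K_scale in \<open>auto simp: quotient_simps(2-4)\<close>)
qed

lemma coset_lin_span:
  fixes p :: "'a \<Rightarrow>\<^sub>0 'k"
  assumes "\<And>a. a \<in> keys p \<Longrightarrow> coset (g a) \<in> span_of Q S"
  shows "coset (lin g p) \<in> span_of Q S"
proof -
  have sum: "coset (sum f I) \<in> span_of Q S" if "finite I" "\<And>i. i \<in> I \<Longrightarrow> coset (f i) \<in> span_of Q S" for f :: "'a \<Rightarrow> _" and I
    using that
  proof (induct I)
    case empty
    then show ?case
      using span_of_closed(1)[of Q S] by (simp add: quotient_simps(2))
  next
    case (insert i I)
    then have "coset (f i) \<oplus>\<^bsub>Q\<^esub> coset (sum f I) \<in> span_of Q S"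
      by (intro span_of_closed(2)) auto
    with insert(1,2) show ?case
      by (simp add: quotient_simps(3))
  qed
  have "coset (scale c (g a)) \<in> span_of Q S" if "a \<in> keys p" for a c
    using span_of_closed(3)[OF assms[OF that], of c] by (simp add: quotient_simps(4))
  then show ?thesis
    unfolding lin_def by (intro sum finite_keys)
qed

end

section \<open>The iterated coproduct and its inverse\<close>

definition word_of :: "ubp \<Rightarrow> nat set list" where
  "word_of = inv_into UNIV ubp_of"

lemma word_of_ubp_of [simp]: "word_of (ubp_of u) = u"
  unfolding word_of_def by (rule inv_into_f_f) (auto simp: inj_def dest: ubp_of_inj)

lemma word_of_comp_ubp_of [simp]: "word_of \<circ> ubp_of = id"
  by (rule ext) simp

definition word_deg :: "ubp list \<Rightarrow> nat" where
  "word_deg w = (\<Sum>f\<leftarrow>w. ubp_deg f)"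

lemma word_deg_map: "word_deg (map ubp_of w) = (\<Sum>u\<leftarrow>w. length u)"
  by (simp add: word_deg_def comp_def)

definition irreducible_ubps :: "ubp set" where
  "irreducible_ubps = ubp_of ` irreducibles"

definition splittings :: "nat set list \<Rightarrow> nat set list list set" where
  "splittings u = {w\<in>lists irreducibles. msplits u w}"

text \<open>
  The coefficient of \<open>f\<^sub>1 \<otimes> \<dots> \<otimes> f\<^sub>k\<close> is the one in the iterated coproduct of \<open>f\<close>, but only irreducible
  \<open>f\<^sub>i\<close> are kept.
\<close>

definition iterated_comult :: "ubp \<Rightarrow> ubp list \<Rightarrow>\<^sub>0 'k::{comm_ring,comm_monoid_mult}" where
  "iterated_comult f = (\<Sum>w\<in>map ubp_of ` splittings (word_of f). single w 1)"

lemma finite_splittings [simp]: "finite (splittings u)"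
  by (simp add: splittings_def finite_msplits_right)

lemma inj_map_ubp_of: "inj_on (map ubp_of) A"
  by (rule inj_on_subset[OF _ subset_UNIV]) (auto simp: inj_map_eq_map inj_def dest!: ubp_of_inj map_injective)

lemma iterated_comult_ubp_of:
  "iterated_comult (ubp_of u) = (\<Sum>w\<in>splittings u. single (map ubp_of w) 1)"
  unfolding iterated_comult_def word_of_ubp_of by (simp add: sum.reindex[OF inj_map_ubp_of])

lemma irreducible_words: "lists irreducible_ubps = map ubp_of ` lists irreducibles"
  by (simp add: irreducible_ubps_def lists_image)

text \<open>Stated for each degree \<open>n\<close> separately, so that the preimages of basis words
  are homogeneous; this is what makes the final isomorphism graded.\<close>

lemma iterated_comult_unitriangular:
  fixes n :: nat
  defines "Z \<equiv> {w\<in>lists irreducible_ubps. word_deg w = n}"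
  shows "keys p \<subseteq> ubps n \<Longrightarrow> lin iterated_comult p = (0 :: _ \<Rightarrow>\<^sub>0 'k::{comm_ring,comm_monoid_mult}) \<Longrightarrow> p = 0"
    and "z \<in> Z \<Longrightarrow> \<exists>p. keys p \<subseteq> ubps n \<and> lin iterated_comult p = single z (1::'k)"
    and "f \<in> ubps n \<Longrightarrow> keys (iterated_comult f :: _ \<Rightarrow>\<^sub>0 'k) \<subseteq> Z"
proof -
  define fact where "fact = inv_into (lists irreducibles) concs"
  have fact: "fact u \<in> lists irreducibles" "concs (fact u) = u" if "u \<in> codes" for u
    using bij_betwE[OF bij_betw_inv_into[OF bij_betw_concs]] that
      bij_betw_inv_into_right[OF bij_betw_concs that] by (auto simp: fact_def)
  have fact_concs: "fact (concs w) = w" if "w \<in> lists irreducibles" for w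
    using bij_betw_inv_into_left[OF bij_betw_concs that] by (simp add: fact_def)
  \<comment> \<open>The diagonal entry is the factorisation of the word of \<open>f\<close> into
    irreducible words.\<close>
  define c where "c f = map ubp_of (fact (word_of f))" for f
  \<comment> \<open>The concatenation of the factorisation is the word of \<open>f\<close> itself,
    and by \<open>inversions_msplits\<close> every other splitting has a concatenation with fewer
    inversions; so the diagonal entry has the largest rank.\<close>
  define r where "r w = inversions (concs (map word_of w))" for w
  have word_map: "map word_of (map ubp_of w) = w" for w
    by simp
  have Z_eq: "Z = map ubp_of ` {w\<in>lists irreducibles. length (concs w) = n}"
    unfolding Z_def irreducible_words by (auto simp: word_deg_map length_concs)
  have code: "word_of f \<in> codes \<and> length (word_of f) = n \<and> ubp_of (word_of f) = f" if "f \<in> ubps n" for f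
    using that by (rule ubps_codeE) simp
  have c: "bij_betw c (ubps n) Z"
  proof (rule bij_betw_byWitness[where f' = "\<lambda>w. ubp_of (concs (map word_of w))"])
    show "\<forall>f\<in>ubps n. ubp_of (concs (map word_of (c f))) = f"
      using code fact by (simp add: c_def word_map)
    show "\<forall>w\<in>Z. c (ubp_of (concs (map word_of w))) = w"
    proof
      fix z
      assume "z \<in> Z"
      then obtain w where w: "w \<in> lists irreducibles" "z = map ubp_of w"
        unfolding Z_eq by blast
      then show "c (ubp_of (concs (map word_of z))) = z"
        by (simp only: c_def word_of_ubp_of word_map fact_concs)
    qed
    show "c ` ubps n \<subseteq> Z"
    proof
      fix z
      assume "z \<in> c ` ubps n"
      then obtain f where f: "f \<in> ubps n" "z = map ubp_of (fact (word_of f))"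
        by (auto simp: c_def)
      then have "fact (word_of f) \<in> {w\<in>lists irreducibles. length (concs w) = n}"
        using code[OF f(1)] fact[of "word_of f"] by simp
      then show "z \<in> Z"
        unfolding Z_eq f(2) by (rule imageI)
    qed
    show "(\<lambda>w. ubp_of (concs (map word_of w))) ` Z \<subseteq> ubps n"
    proof
      fix f
      assume "f \<in> (\<lambda>w. ubp_of (concs (map word_of w))) ` Z"
      then obtain z where z: "z \<in> Z" "f = ubp_of (concs (map word_of z))" by blast
      from z(1) obtain w where w': "w \<in> lists irreducibles" "length (concs w) = n" "z = map ubp_of w"
        unfolding Z_eq by blast
      then have w: "w \<in> lists irreducibles" "length (concs w) = n" "f = ubp_of (concs w)"
        using z(2) by (simp_all only: word_map)
      then have "concs w \<in> codes"
        using concs_codes lists_mono[OF irreducibles_codes] by blast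
      then show "f \<in> ubps n"
        using ubp_of_ubps[of "concs w"] w by simp
    qed
  qed
  have S: "map ubp_of ` splittings (word_of f) \<subseteq> Z" if "f \<in> ubps n" for f
  proof
    fix z
    assume "z \<in> map ubp_of ` splittings (word_of f)"
    then obtain w where w: "w \<in> splittings (word_of f)" "z = map ubp_of w" by blast
    then have "w \<in> lists irreducibles" "length (concs w) = n"
      using msplits_length[of "word_of f" w] code[OF that] by (auto simp: splittings_def length_concs)
    then show "z \<in> Z"
      unfolding Z_eq w(2) by blast
  qed
  have c_S: "c f \<in> map ubp_of ` splittings (word_of f)" if "f \<in> ubps n" for f
  proof -
    have u: "word_of f \<in> codes" using code[OF that] by simp
    then have "fact (word_of f) \<in> lists codes"
      using fact(1) lists_mono[OF irreducibles_codes] by blast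
    then have "fact (word_of f) \<in> splittings (word_of f)"
      using msplits_concs fact[OF u] by (fastforce simp: splittings_def)
    then show ?thesis by (simp add: c_def)
  qed
  have r: "r z < r (c f)" if f: "f \<in> ubps n" and z: "z \<in> map ubp_of ` splittings (word_of f)" "z \<noteq> c f" for f z
  proof -
    obtain w where w: "w \<in> splittings (word_of f)" "z = map ubp_of w"
      using z(1) by blast
    have "word_of f \<noteq> concs w"
      using w z(2) fact_concs[of w] by (auto simp: c_def splittings_def)
    then have "inversions (concs w) < inversions (word_of f)"
      using inversions_msplits w(1) by (simp add: splittings_def)
    then show ?thesis
      using code[OF f] fact(2) by (simp add: r_def w(2) c_def)
  qed
  have it: "iterated_comult = (\<lambda>f. \<Sum>z\<in>map ubp_of ` splittings (word_of f). single z (1::'k))"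
    by (rule ext) (simp add: iterated_comult_def)
  show "p = 0" if "keys p \<subseteq> ubps n" "lin iterated_comult p = (0 :: _ \<Rightarrow>\<^sub>0 'k)"
    by (rule unitriangular(1)[OF c, of "\<lambda>f. map ubp_of ` splittings (word_of f)" r])
       (use S c_S r that it in auto)
  show "\<exists>p. keys p \<subseteq> ubps n \<and> lin iterated_comult p = single z (1::'k)" if "z \<in> Z"
    unfolding it
    by (rule unitriangular(2)[OF c, of "\<lambda>f. map ubp_of ` splittings (word_of f)" r])
       (use S c_S r that in auto)
  show "keys (iterated_comult f :: _ \<Rightarrow>\<^sub>0 'k) \<subseteq> Z" if "f \<in> ubps n"
    unfolding iterated_comult_def using S[OF that] by (intro keys_sum_subset keys_single_subset) blast
qed

lemma ubps_degree_unique: "f \<in> ubps m \<Longrightarrow> f \<in> ubps n \<Longrightarrow> m = n"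
  using ubp_deg_ubps by blast

definition ubp_irreducible_grade :: "nat \<Rightarrow> (ubp \<Rightarrow>\<^sub>0 'k::{comm_ring,comm_monoid_mult}) set" where
  "ubp_irreducible_grade d = {p. keys p \<subseteq> {f\<in>irreducible_ubps. ubp_deg f = d}}"

lemma ubp_deg_irreducible: "f \<in> irreducible_ubps \<Longrightarrow> ubp_deg f > 0"
  by (auto simp: irreducible_ubps_def irreducibles_def)

text \<open>A homogeneous preimage of a basis word under the extension of \<open>iterated_comult\<close>.\<close>

definition concat_split :: "ubp list \<Rightarrow> ubp \<Rightarrow>\<^sub>0 'k::{comm_ring,comm_monoid_mult}" where
  "concat_split w = (SOME p. keys p \<subseteq> ubps (word_deg w) \<and>
     lin iterated_comult p = single w 1)"

lemma concat_split:
  assumes "w \<in> lists irreducible_ubps"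
  shows "keys (concat_split w :: ubp \<Rightarrow>\<^sub>0 'k::{comm_ring,comm_monoid_mult}) \<subseteq> ubps (word_deg w)"
    and "lin iterated_comult (concat_split w) = single w (1::'k)"
proof -
  have "\<exists>p :: ubp \<Rightarrow>\<^sub>0 'k. keys p \<subseteq> ubps (word_deg w) \<and> lin iterated_comult p = single w 1"
    by (rule iterated_comult_unitriangular(2)) (use assms in simp)
  from someI_ex[OF this]
  show "keys (concat_split w :: ubp \<Rightarrow>\<^sub>0 'k) \<subseteq> ubps (word_deg w)"
    and "lin iterated_comult (concat_split w) = single w (1::'k)"
    unfolding concat_split_def by blast+
qed

text \<open>By its choice \<open>concat_split\<close> is a right inverse of the iterated coproduct;
  injectivity in degree \<open>n\<close> makes it a left inverse as well.\<close>

lemma lin_concat_split_iterated_comult: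
  fixes n :: nat
  assumes f: "f \<in> ubps n"
  shows "lin concat_split (iterated_comult f) = single f (1::'k::{comm_ring,comm_monoid_mult})"
proof -
  let ?i = "iterated_comult f :: _ \<Rightarrow>\<^sub>0 'k"
  have keys: "keys ?i \<subseteq> {w\<in>lists irreducible_ubps. word_deg w = n}"
    by (rule iterated_comult_unitriangular(3)[OF f])
  have "lin iterated_comult (lin concat_split ?i) = lin (\<lambda>w. single w 1) ?i"
    unfolding lin_lin using keys by (intro lin_cong concat_split(2)) blast
  then have "lin iterated_comult (lin concat_split ?i - single f 1) = 0"
    by (simp add: lin_id lin_diff)
  moreover have "keys (lin concat_split ?i) \<subseteq> ubps n"
  proof (rule keys_lin)
    fix w
    assume "w \<in> keys ?i"
    then have "w \<in> lists irreducible_ubps" "word_deg w = n"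
      using keys by blast+
    with concat_split(1)[of w, where 'k = 'k]
    show "keys (concat_split w :: _ \<Rightarrow>\<^sub>0 'k) \<subseteq> ubps n" by simp
  qed
  then have "keys (lin concat_split ?i - single f 1) \<subseteq> ubps n"
    using f by (intro keys_diff_subset keys_single_subset)
  ultimately have "lin concat_split ?i - single f 1 = 0"
    by (intro iterated_comult_unitriangular(1))
  then show ?thesis by simp
qed

lemma lin_concat_split:
  assumes "keys p \<subseteq> (\<Union>n. ubps n)"
  shows "lin concat_split (lin iterated_comult p) = (p :: _ \<Rightarrow>\<^sub>0 'k::{comm_ring,comm_monoid_mult})"
proof -
  have "lin concat_split (lin iterated_comult p) = lin (\<lambda>f. single f 1) p"
    unfolding lin_lin
  proof (rule lin_cong)
    fix f
    assume "f \<in> keys p"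
    then obtain n where "f \<in> ubps n"
      using assms by blast
    then show "lin concat_split (iterated_comult f) = single f (1::'k)"
      by (rule lin_concat_split_iterated_comult)
  qed
  then show ?thesis by (simp add: lin_id)
qed

lemma lin_iterated_comult:
  assumes "keys q \<subseteq> lists irreducible_ubps"
  shows "lin iterated_comult (lin concat_split q) = (q :: _ \<Rightarrow>\<^sub>0 'k::{comm_ring,comm_monoid_mult})"
proof -
  have "lin iterated_comult (lin concat_split q) = lin (\<lambda>w. single w 1) q"
    unfolding lin_lin using assms by (intro lin_cong concat_split(2)) blast
  then show ?thesis by (simp add: lin_id)
qed

lemma splittings_Nil: "splittings [] = {[]}"
proof -
  have "w = []" if "w \<in> splittings []" for w
  proof (rule ccontr)
    assume "w \<noteq> []"
    then obtain a v where w: "w = a # v" by (auto simp: neq_Nil_conv)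
    then have "a = []"
      using that msplits_length[of "[]" w] by (simp add: splittings_def)
    then show False
      using that w by (simp add: splittings_def irreducibles_def)
  qed
  then show ?thesis
    by (auto simp: splittings_def)
qed

lemma concat_split_Nil: "concat_split [] = single {} (1::'k::{comm_ring,comm_monoid_mult})"
proof -
  have "iterated_comult {} = single [] (1::'k)"
    using iterated_comult_ubp_of[of "[]", where 'a = 'k] by (simp add: splittings_Nil)
  moreover have "{} \<in> ubps 0"
    using ubp_of_ubps[of "[]"] by simp
  ultimately show ?thesis
    using lin_concat_split_iterated_comult[of "{}" 0, where 'k = 'k] by simp
qed

lemma splittings_append:
  assumes "u \<in> codes"
  shows "{(v, w). v @ w \<in> splittings u} = (\<Union>(a, b)\<in>{(a, b). splits u a b}. splittings a \<times> splittings b)"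
  by (auto simp: splittings_def msplits_append)

text \<open>Breaking points correspond to splittings through the length of the left factor, which is
  injective by \<open>splits_unique\<close>.\<close>

lemma ubp_comult_ubp_of_sum:
  assumes u: "u \<in> codes"
  shows "(\<Sum>i\<in>ubp_breaks (ubp_of u). single
      (single (fst (ubp_split (ubp_of u) i)) 1,
       single (snd (ubp_split (ubp_of u) i)) (1::'k::{comm_ring,comm_monoid_mult})) (1::'k)) =
    (\<Sum>(a, b)\<in>{(a, b). splits u a b}. single
      (single (ubp_of a) 1, single (ubp_of b) 1) 1)"
proof -
  have inj: "inj_on (\<lambda>(a, b). length a) {(a, b). splits u a b}"
    using splits_unique[of u] by (auto simp: inj_on_def)
  have "ubp_breaks (ubp_of u) = (\<lambda>(a, b). length a) ` {(a, b). splits u a b}"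
    unfolding ubp_breaks_ubp_of[OF u] by force
  then show ?thesis
    by (simp add: sum.reindex[OF inj] comp_def) (rule sum.cong, auto simp: ubp_split_ubp_of)
qed

lemma finite_splits: "finite {(a, b). splits u a b}"
proof (rule finite_subset)
  show "{(a, b). splits u a b} \<subseteq> {a\<in>codes. length a \<le> length u} \<times> {b\<in>codes. length b \<le> length u}"
    using splits_codes splits_length by fastforce
qed (intro finite_cartesian_product finite_codes_length)

text \<open>Coassociativity: \<open>iterated_comult\<close> turns the coproduct into deconcatenation.\<close>

lemma sum_splittings_deconc:
  assumes u: "u \<in> codes"
  shows "(\<Sum>w\<in>splittings u. \<Sum>i\<in>{0..length w}. F (take i w) (drop i w)) =
    (\<Sum>(a, b)\<in>{(a, b). splits u a b}. \<Sum>v\<in>splittings a. \<Sum>w\<in>splittings b. F v w :: 'm::comm_monoid_add)"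
proof -
  have "(\<Sum>w\<in>splittings u. \<Sum>i\<in>{0..length w}. F (take i w) (drop i w)) =
      (\<Sum>(w, i)\<in>(SIGMA w:splittings u. {0..length w}). F (take i w) (drop i w))"
    by (rule sum.Sigma) simp_all
  also have "\<dots> = (\<Sum>(v, w)\<in>{(v, w). v @ w \<in> splittings u}. F v w)"
    by (rule sum.reindex_bij_witness[where i = "\<lambda>(v, w). (v @ w, length v)" and j = "\<lambda>(w, i). (take i w, drop i w)"])
       auto
  also have "\<dots> = (\<Sum>x\<in>(\<Union>y\<in>{(a, b). splits u a b}. splittings (fst y) \<times> splittings (snd y)). F (fst x) (snd x))"
    unfolding splittings_append[OF u] by (simp add: case_prod_unfold)
  also have "\<dots> = (\<Sum>y\<in>{(a, b). splits u a b}. \<Sum>x\<in>splittings (fst y) \<times> splittings (snd y). F (fst x) (snd x))"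
  proof (rule sum.UNION_disjoint)
    show "\<forall>x\<in>{(a, b). splits u a b}. \<forall>y\<in>{(a, b). splits u a b}. x \<noteq> y \<longrightarrow>
      (splittings (fst x) \<times> splittings (snd x)) \<inter> (splittings (fst y) \<times> splittings (snd y)) = {}"
    \<comment> \<open>A sequence fixes the length of the word that it splits, and the length of the
      left factor fixes the splitting of \<open>u\<close>.\<close>
    proof (intro ballI impI)
      fix x y
      assume xy: "x \<in> {(a, b). splits u a b}" "y \<in> {(a, b). splits u a b}" "x \<noteq> y"
      then have "length (fst x) \<noteq> length (fst y)"
        using splits_unique[of u "fst x" "snd x" "fst y" "snd y"] by (auto simp: prod_eq_iff)
      then have "splittings (fst x) \<inter> splittings (fst y) = {}"
        using msplits_length by (fastforce simp: splittings_def)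
      then show "(splittings (fst x) \<times> splittings (snd x)) \<inter> (splittings (fst y) \<times> splittings (snd y)) = {}"
        by blast
    qed
  qed (use finite_splits in auto)
  finally show ?thesis
    by (simp add: sum.cartesian_product case_prod_unfold)
qed

text \<open>A representative of the coproduct in the free module on pairs;
  \<open>ubp_comult_eq\<close> passes to the quotient.\<close>

definition split_sum ::
    "ubp \<Rightarrow> (ubp \<Rightarrow>\<^sub>0 'k::{comm_ring,comm_monoid_mult}) \<times> (ubp \<Rightarrow>\<^sub>0 'k) \<Rightarrow>\<^sub>0 'k" where
  "split_sum f = (\<Sum>i\<in>ubp_breaks f. single
     (single (fst (ubp_split f i)) 1, single (snd (ubp_split f i)) 1) 1)"

text \<open>A representative of the deconcatenation of \<open>w\<close> after applying
  \<open>concat_split\<close> to both tensor factors.\<close>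

definition word_split_sum ::
    "ubp list \<Rightarrow> (ubp \<Rightarrow>\<^sub>0 'k::{comm_ring,comm_monoid_mult}) \<times> (ubp \<Rightarrow>\<^sub>0 'k) \<Rightarrow>\<^sub>0 'k" where
  "word_split_sum w = (\<Sum>i\<in>{0..length w}. single
     (concat_split (take i w), concat_split (drop i w)) 1)"

abbreviation ubp_tensor_kernel ::
    "((ubp \<Rightarrow>\<^sub>0 'k::{comm_ring,comm_monoid_mult}) \<times> (ubp \<Rightarrow>\<^sub>0 'k) \<Rightarrow>\<^sub>0 'k) set" where
  "ubp_tensor_kernel \<equiv> tensor_kernel ubp_module ubp_module"

interpretation P: free_submodule "ubp_tensor_kernel :: (_ \<Rightarrow>\<^sub>0 'k::{comm_ring,comm_monoid_mult}) set"
    "carrier (ubp_module :: ('k, _) module) \<times> carrier (ubp_module :: ('k, _) module)"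
  unfolding ubp_module_def by (intro free_submodule_tensor module_free_module)

lemma keys_concat_split:
  assumes "w \<in> lists irreducible_ubps"
  shows "keys (concat_split w :: _ \<Rightarrow>\<^sub>0 'k::{comm_ring,comm_monoid_mult}) \<subseteq> (\<Union>n. ubps n)"
  using concat_split(1)[OF assms] by blast

lemma concat_split_tensor:
  fixes p q :: "ubp list \<Rightarrow>\<^sub>0 'k::{comm_ring,comm_monoid_mult}"
  assumes "keys p \<subseteq> lists irreducible_ubps" "keys q \<subseteq> lists irreducible_ubps"
  shows "single (lin concat_split p, lin concat_split q) 1 -
    lin (\<lambda>v. lin (\<lambda>w. single (concat_split v, concat_split w) 1) q) p \<in> ubp_tensor_kernel"
  unfolding ubp_module_def
  by (rule tensor_free_lin) (use assms in \<open>auto intro!: keys_concat_split[THEN subsetD]\<close>)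

text \<open>Each factor \<open>ubp_of a\<close> equals \<open>concat_split\<close> applied to its
  iterated coproduct. Bilinear expansion then turns the coproduct into a sum over pairs of
  splittings, which \<open>sum_splittings_deconc\<close> regroups by cuts.\<close>

lemma split_sum_iterated_comult:
  assumes f: "f \<in> ubps n"
  shows "split_sum f - lin word_split_sum (iterated_comult f) \<in>
    (ubp_tensor_kernel :: (_ \<Rightarrow>\<^sub>0 'k::{comm_ring,comm_monoid_mult}) set)"
proof -
  obtain u where u: "u \<in> codes" "f = ubp_of u"
    using f by (rule ubps_codeE)
  define \<phi> where "\<phi> w = (concat_split (map ubp_of w) :: _ \<Rightarrow>\<^sub>0 'k)" for w
  have "lin word_split_sum (iterated_comult f) =
      (\<Sum>w\<in>splittings u. \<Sum>i\<in>{0..length w}. single (\<phi> (take i w), \<phi> (drop i w)) (1::'k))"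
    by (simp add: u(2) iterated_comult_ubp_of lin_sum word_split_sum_def \<phi>_def take_map drop_map)
  also have "\<dots> = (\<Sum>(a, b)\<in>{(a, b). splits u a b}. \<Sum>v\<in>splittings a. \<Sum>w\<in>splittings b. single (\<phi> v, \<phi> w) 1)"
    by (rule sum_splittings_deconc[OF u(1)])
  finally have 1: "lin word_split_sum (iterated_comult f) =
      (\<Sum>(a, b)\<in>{(a, b). splits u a b}. \<Sum>v\<in>splittings a. \<Sum>w\<in>splittings b. single (\<phi> v, \<phi> w) (1::'k))" .
  have 2: "split_sum f = (\<Sum>(a, b)\<in>{(a, b). splits u a b}. single
      (single (ubp_of a) 1, single (ubp_of b) 1) (1::'k))"
    unfolding split_sum_def u(2) by (rule ubp_comult_ubp_of_sum[OF u(1)])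
  have "single (single (ubp_of a) 1, single (ubp_of b) 1) 1 -
      (\<Sum>v\<in>splittings a. \<Sum>w\<in>splittings b. single (\<phi> v, \<phi> w) (1::'k)) \<in> ubp_tensor_kernel"
    if ab: "splits u a b" for a b
  proof -
    have "ubp_of a \<in> ubps (length a)" "ubp_of b \<in> ubps (length b)"
      using splits_codes[OF ab] ubp_of_ubps by blast+
    then have "single (lin concat_split (iterated_comult (ubp_of a)),
          lin concat_split (iterated_comult (ubp_of b))) 1 -
        lin (\<lambda>v. lin (\<lambda>w. single (concat_split v, concat_split w) 1) (iterated_comult (ubp_of b)))
          (iterated_comult (ubp_of a)) \<in> (ubp_tensor_kernel :: (_ \<Rightarrow>\<^sub>0 'k) set)"
      using iterated_comult_unitriangular(3) by (intro concat_split_tensor) blast+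
    then show ?thesis
      using \<open>ubp_of a \<in> ubps (length a)\<close> \<open>ubp_of b \<in> ubps (length b)\<close>
      by (simp add: lin_concat_split_iterated_comult)
         (simp add: iterated_comult_ubp_of lin_sum \<phi>_def)
  qed
  then show ?thesis
    unfolding 1 2 sum_subtractf[symmetric] by (intro P.K_sum) auto
qed

text \<open>The preceding relation, extended linearly to \<open>concat_split w\<close>, whose
  iterated coproduct is the single word \<open>w\<close>.\<close>

lemma split_sum_concat_split:
  assumes w: "w \<in> lists irreducible_ubps"
  shows "lin split_sum (concat_split w) - word_split_sum w \<in>
    (ubp_tensor_kernel :: (_ \<Rightarrow>\<^sub>0 'k::{comm_ring,comm_monoid_mult}) set)"
proof -
  have "lin split_sum (concat_split w) - lin (\<lambda>f. lin word_split_sum (iterated_comult f)) (concat_split w) \<in>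
    (ubp_tensor_kernel :: (_ \<Rightarrow>\<^sub>0 'k) set)"
    by (rule P.K_lin_cong, rule split_sum_iterated_comult) (use concat_split(1)[OF w] in blast)
  moreover have "lin (\<lambda>f. lin word_split_sum (iterated_comult f)) (concat_split w) = (word_split_sum w :: _ \<Rightarrow>\<^sub>0 'k)"
    unfolding lin_lin[symmetric] concat_split(2)[OF w] by simp
  ultimately show ?thesis by simp
qed

section \<open>The isomorphism from the cotensor coalgebra\<close>

interpretation C: cotensor irreducible_ubps
  "ubp_irreducible_grade :: nat \<Rightarrow> (ubp \<Rightarrow>\<^sub>0 'k::{comm_ring,comm_monoid_mult}) set" .

definition concat_word :: "(ubp \<Rightarrow>\<^sub>0 'k::{comm_ring,comm_monoid_mult}) list \<Rightarrow> ubp \<Rightarrow>\<^sub>0 'k" where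
  "concat_word vs = lin concat_split (expand vs)"

text \<open>Well defined on cosets because \<open>expand\<close> sends the word relations to
  0.\<close>

definition coalgebra_iso ::
    "((ubp \<Rightarrow>\<^sub>0 'k::{comm_ring,comm_monoid_mult}) list \<Rightarrow>\<^sub>0 'k) set \<Rightarrow> ubp \<Rightarrow>\<^sub>0 'k" where
  "coalgebra_iso T = the_elem (lin concat_word ` T)"

lemma coalgebra_iso_coset: "coalgebra_iso (C.W.coset p) = lin concat_word p"
  unfolding coalgebra_iso_def concat_word_def[abs_def] by (rule C.the_elem_lin_expand)

lemma coalgebra_iso_pure_word: "coalgebra_iso (pure_word C.V vs) = concat_word vs"
  by (simp add: C.pure_word_eq coalgebra_iso_coset)

lemma keys_expand_irreducible:
  assumes "vs \<in> C.vwords"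
  shows "keys (expand vs) \<subseteq> {w\<in>lists irreducible_ubps. length w = length vs}"
proof
  fix w
  assume "w \<in> keys (expand vs)"
  then have "list_all2 (\<lambda>v y. y \<in> keys v) vs w"
    by (rule keys_expand)
  then show "w \<in> {w\<in>lists irreducible_ubps. length w = length vs}"
    using assms
    by (auto simp: list_all2_conv_all_nth in_set_conv_nth) (metis nth_mem subsetD)
qed

lemma keys_concat_word:
  assumes "vs \<in> C.vwords"
  shows "keys (concat_word vs) \<subseteq> (\<Union>n. ubps n)"
  unfolding concat_word_def using keys_expand_irreducible[OF assms] by (intro keys_lin keys_concat_split) blast

lemma keys_lin_concat_word:
  "keys p \<subseteq> C.vwords \<Longrightarrow> keys (lin concat_word p) \<subseteq> (\<Union>n. ubps n)"
  by (intro keys_lin keys_concat_word) blast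

lemma linear_map_coalgebra_iso:
  "linear_map (tensor_powers C.V) (ubp_module :: ('k::{comm_ring,comm_monoid_mult}, _) module) coalgebra_iso"
  unfolding linear_map_def C.tensor_powers_eq C.W.quotient_simps(1) ubp_module_def
proof (intro conjI ballI allI Pi_I)
  fix T :: "((ubp \<Rightarrow>\<^sub>0 'k) list \<Rightarrow>\<^sub>0 'k) set"
  assume "T \<in> C.W.coset ` {p. keys p \<subseteq> C.vwords}"
  then obtain p where p: "keys p \<subseteq> C.vwords" "T = C.W.coset p" by blast
  show "coalgebra_iso T \<in> carrier (free_module (\<Union>n. ubps n))"
    using keys_lin_concat_word[OF p(1)] by (simp add: p(2) coalgebra_iso_coset)
  show "coalgebra_iso (c \<odot>\<^bsub>C.W.Q\<^esub> T) = c \<odot>\<^bsub>free_module (\<Union>n. ubps n)\<^esub> coalgebra_iso T" for c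
    by (simp add: p(2) coalgebra_iso_coset C.W.quotient_simps(4) lin_scale)
  fix T' :: "((ubp \<Rightarrow>\<^sub>0 'k) list \<Rightarrow>\<^sub>0 'k) set"
  assume "T' \<in> C.W.coset ` {p. keys p \<subseteq> C.vwords}"
  then obtain p' where p': "T' = C.W.coset p'" by blast
  show "coalgebra_iso (T \<oplus>\<^bsub>C.W.Q\<^esub> T') = coalgebra_iso T \<oplus>\<^bsub>free_module (\<Union>n. ubps n)\<^esub> coalgebra_iso T'"
    by (simp add: p(2) p' coalgebra_iso_coset C.W.quotient_simps(3) lin_add)
qed

lemma lin_concat_word_basis:
  "lin concat_word (lin (\<lambda>w. single (C.basis_word w) 1) q) = lin concat_split q"
  by (simp add: lin_lin concat_word_def expand_basis)

lemma basis_word_vwords: "w \<in> lists irreducible_ubps \<Longrightarrow> C.basis_word w \<in> C.vwords"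
  by (induct w) (auto simp: keys_single)

text \<open>Every element of the tensor powers has a representative in words over the basis; this
  makes \<open>coalgebra_iso\<close> invertible.\<close>

lemma coset_eq_basis:
  assumes "keys p \<subseteq> C.vwords"
  shows "C.W.coset p = C.W.coset (lin (\<lambda>w. single (C.basis_word w) 1) (lin expand p))"
proof -
  have "lin (\<lambda>vs. single vs 1) p -
      lin (\<lambda>vs. lin (\<lambda>w. single (C.basis_word w) 1) (expand vs)) p \<in> word_kernel C.V"
  proof (rule C.W.K_lin_cong)
    fix vs
    assume "vs \<in> keys p"
    then have "vs \<in> C.vwords" using assms by blast
    then show "single vs 1 - lin (\<lambda>w. single (C.basis_word w) 1) (expand vs) \<in> word_kernel C.V"
      using C.word_expand[of "[]" vs] by simp
  qed
  then show ?thesis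
    by (simp add: C.W.coset_eq_iff lin_id lin_lin)
qed

text \<open>The inverse takes the iterated coproduct and reads each word of irreducible elements as
  a pure tensor of basis vectors.\<close>

lemma bij_betw_coalgebra_iso:
  "bij_betw coalgebra_iso (C.W.coset ` {p. keys p \<subseteq> C.vwords})
    {p :: ubp \<Rightarrow>\<^sub>0 'k::{comm_ring,comm_monoid_mult}. keys p \<subseteq> (\<Union>n. ubps n)}"
  (is "bij_betw _ ?C ?B")
proof -
  let ?g = "\<lambda>p. C.W.coset (lin (\<lambda>w. single (C.basis_word w) (1::'k)) (lin iterated_comult p))"
  show ?thesis
  proof (rule bij_betw_byWitness[where f' = ?g])
    have keys_it: "keys (lin iterated_comult p) \<subseteq> lists irreducible_ubps"
      if p: "keys p \<subseteq> (\<Union>n. ubps n)" for p :: "ubp \<Rightarrow>\<^sub>0 'k"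
    proof (rule keys_lin)
      fix f
      assume "f \<in> keys p"
      then obtain n where "f \<in> ubps n" using p by blast
      from iterated_comult_unitriangular(3)[OF this]
      show "keys (iterated_comult f :: _ \<Rightarrow>\<^sub>0 'k) \<subseteq> lists irreducible_ubps" by blast
    qed
    show "\<forall>T\<in>?C. C.W.coset (lin (\<lambda>w. single (C.basis_word w) 1)
        (lin iterated_comult (coalgebra_iso T :: _ \<Rightarrow>\<^sub>0 'k))) = T"
    proof
      fix T :: "((ubp \<Rightarrow>\<^sub>0 'k) list \<Rightarrow>\<^sub>0 'k) set"
      assume "T \<in> ?C"
      then obtain p where p: "keys p \<subseteq> C.vwords" "T = C.W.coset p" by blast
      have "lin concat_word p = lin concat_split (lin expand p)"
        by (simp add: lin_lin concat_word_def[abs_def])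
      moreover have "keys (lin expand p) \<subseteq> lists irreducible_ubps"
        using p(1) keys_expand_irreducible by (intro keys_lin) blast
      ultimately have "lin iterated_comult (coalgebra_iso T) = lin expand p"
        by (simp add: p(2) coalgebra_iso_coset lin_iterated_comult)
      then show "C.W.coset (lin (\<lambda>w. single (C.basis_word w) 1) (lin iterated_comult (coalgebra_iso T))) = T"
        using coset_eq_basis[OF p(1)] by (simp add: p(2))
    qed
    show "\<forall>p\<in>?B. coalgebra_iso
        (C.W.coset (lin (\<lambda>w. single (C.basis_word w) 1) (lin iterated_comult p))) = p"
      by (simp add: coalgebra_iso_coset lin_concat_word_basis lin_concat_split)
    show "coalgebra_iso ` ?C \<subseteq> ?B"
      unfolding image_image coalgebra_iso_coset using keys_lin_concat_word by blast
    show "?g ` ?B \<subseteq> ?C"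
    proof
      fix T
      assume "T \<in> ?g ` ?B"
      then obtain p :: "ubp \<Rightarrow>\<^sub>0 'k" where p: "keys p \<subseteq> (\<Union>n. ubps n)"
        "T = C.W.coset (lin (\<lambda>w. single (C.basis_word w) 1) (lin iterated_comult p))" by blast
      have "keys (lin (\<lambda>w. single (C.basis_word w) (1::'k)) (lin iterated_comult p)) \<subseteq> C.vwords"
        using keys_it[OF p(1)] by (intro keys_lin keys_single_subset basis_word_vwords) blast
      then show "T \<in> ?C"
        unfolding p(2) by blast
    qed
  qed
qed

text \<open>Extends \<open>split_sum_concat_split\<close> from basis words to arbitrary pure
  tensors: by \<open>expand_append\<close> the expansion of \<open>vs\<close> is cut at
  \<open>i\<close> by expanding both parts separately.\<close>

lemma split_sum_concat_word:
  assumes vs: "vs \<in> C.vwords"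
  shows "lin split_sum (concat_word vs) -
    (\<Sum>i\<in>{0..length vs}. single (concat_word (take i vs), concat_word (drop i vs)) 1) \<in>
    (ubp_tensor_kernel :: (_ \<Rightarrow>\<^sub>0 'k::{comm_ring,comm_monoid_mult}) set)"
proof -
  have keys: "keys (expand vs) \<subseteq> {w\<in>lists irreducible_ubps. length w = length vs}"
    by (rule keys_expand_irreducible[OF vs])
  have "lin split_sum (concat_word vs) - lin word_split_sum (expand vs) \<in> (ubp_tensor_kernel :: (_ \<Rightarrow>\<^sub>0 'k) set)"
    unfolding concat_word_def lin_lin
    by (rule P.K_lin_cong, rule split_sum_concat_split) (use keys in blast)
  moreover have "lin word_split_sum (expand vs) -
      (\<Sum>i\<in>{0..length vs}. single (concat_word (take i vs), concat_word (drop i vs)) 1) \<in>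
      (ubp_tensor_kernel :: (_ \<Rightarrow>\<^sub>0 'k) set)"
  proof -
    let ?s = "\<lambda>i w. single (concat_split (take i w), concat_split (drop i w)) (1::'k)"
    have "lin word_split_sum (expand vs) = lin (\<lambda>w. \<Sum>i\<in>{0..length vs}. ?s i w) (expand vs)"
      using keys by (intro lin_cong) (auto simp: word_split_sum_def)
    also have "\<dots> = (\<Sum>i\<in>{0..length vs}. lin (?s i) (expand vs))"
      by (rule lin_sum_fun)
    finally have eq: "lin word_split_sum (expand vs) = (\<Sum>i\<in>{0..length vs}. lin (?s i) (expand vs))" .
    have "single (concat_word (take i vs), concat_word (drop i vs)) 1 - lin (?s i) (expand vs)
        \<in> ubp_tensor_kernel" if i: "i \<in> {0..length vs}" for i
    proof -
      have t: "take i vs \<in> C.vwords" and d: "drop i vs \<in> C.vwords"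
        using C.take_drop_vwords[OF vs] by blast+
      \<comment> \<open>Words in the expansion of the left part have length exactly
        \<open>i\<close>, so cutting \<open>v\<close> followed by \<open>w\<close> at
        \<open>i\<close> gives back \<open>v\<close> and \<open>w\<close>.\<close>
      have kt: "keys (expand (take i vs)) \<subseteq> {w\<in>lists irreducible_ubps. length w = i}"
        using keys_expand_irreducible[OF t] i by simp
      have "lin (?s i) (expand vs) = lin (?s i) (expand (take i vs @ drop i vs))"
        by simp
      also have "\<dots> = lin (\<lambda>v. lin (\<lambda>w. ?s i (v @ w)) (expand (drop i vs))) (expand (take i vs))"
        unfolding expand_append by (simp add: lin_lin)
      also have "\<dots> = lin (\<lambda>v. lin (\<lambda>w. single (concat_split v, concat_split w) 1)
          (expand (drop i vs))) (expand (take i vs))"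
        using kt by (intro lin_cong) auto
      finally have eq': "lin (?s i) (expand vs) = lin (\<lambda>v. lin (\<lambda>w. single (concat_split v, concat_split w) 1)
          (expand (drop i vs))) (expand (take i vs))" .
      show ?thesis
        unfolding concat_word_def eq'
        by (rule concat_split_tensor) (use keys_expand_irreducible[OF t] keys_expand_irreducible[OF d] in blast)+
    qed
    then have "lin (?s i) (expand vs) - single (concat_word (take i vs), concat_word (drop i vs)) 1
        \<in> ubp_tensor_kernel" if "i \<in> {0..length vs}" for i
      using that P.K_sym by blast
    then show ?thesis
      unfolding eq sum_subtractf[symmetric] by (intro P.K_sum)
  qed
  ultimately show ?thesis
    by (rule P.K_trans)
qed

text \<open>Tensor products see only the carrier, the addition and the scalar multiplication, on
  which the two records agree.\<close>

lemma tensor_ubp_hopf_algebra: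
  fixes P :: "('k::{comm_ring,comm_monoid_mult}, ubp \<Rightarrow>\<^sub>0 'k) graded_coalgebra"
    and M :: "('k, ubp \<Rightarrow>\<^sub>0 'k) module"
  defines "P \<equiv> ubp_hopf_algebra" and "M \<equiv> ubp_module"
  shows "tensor_kernel P P = tensor_kernel M M" "tensor P P = tensor M M" "pure_tensor P P = pure_tensor M M"
proof -
  have c: "carrier P = carrier M"
    by (simp add: P_def M_def ubp_module_def)
  show k: "tensor_kernel P P = tensor_kernel M M"
    by (simp add: tensor_kernel_def tensor_rels_def P_def M_def ubp_module_def)
  show "tensor P P = tensor M M"
    unfolding tensor_def k c ..
  show "pure_tensor P P = pure_tensor M M"
    unfolding pure_tensor_def[abs_def] k c ..
qed

lemma ubp_comult_eq:
  assumes p: "keys p \<subseteq> (\<Union>n. ubps n)"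
  shows "ubp_comult p = P.coset (lin split_sum (p :: _ \<Rightarrow>\<^sub>0 'k::{comm_ring,comm_monoid_mult}))"
proof -
  have keys: "keys (single
      (single (fst (ubp_split f i)) (1::'k), single (snd (ubp_split f i)) (1::'k)) (1::'k)) \<subseteq>
      carrier ubp_module \<times> carrier ubp_module" if f: "f \<in> ubps n" and i: "i \<in> ubp_breaks f" for f n i
  proof -
    obtain u where u: "u \<in> codes" "f = ubp_of u"
      using f by (rule ubps_codeE)
    then obtain a b where ab: "splits u a b" "i = length a"
      using i ubp_breaks_ubp_of[OF u(1)] by blast
    have "ubp_of a \<in> (\<Union>n. ubps n)" "ubp_of b \<in> (\<Union>n. ubps n)"
      using splits_codes[OF ab(1)] ubp_of_codes by blast+
    then show ?thesis
      unfolding u(2) ab(2) ubp_split_ubp_of[OF ab(1)]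
      by (intro keys_single_subset SigmaI) (simp_all add: ubp_module_def keys_single_subset del: UN_iff)
  qed
  show ?thesis
    unfolding ubp_comult_def tensor_def
  proof (rule P.lin_ext_Q_cong)
    fix f
    assume "f \<in> keys p"
    then obtain n where f: "f \<in> ubps n"
      using p by blast
    show "(\<Oplus>\<^bsub>P.Q\<^esub>i\<in>ubp_breaks f. pure_tensor ubp_module ubp_module
        (single (fst (ubp_split f i)) 1) (single (snd (ubp_split f i)) 1)) =
      P.coset (split_sum f :: _ \<Rightarrow>\<^sub>0 'k)"
      unfolding pure_tensor_def split_sum_def by (rule P.finsum_Q, rule keys[OF f])
    show "keys (split_sum f :: _ \<Rightarrow>\<^sub>0 'k) \<subseteq> carrier ubp_module \<times> carrier ubp_module"
      unfolding split_sum_def by (rule keys_sum_subset, rule keys[OF f])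
  qed
qed

lemma comult_coalgebra_iso:
  assumes p: "keys p \<subseteq> C.vwords"
  shows "ubp_comult (coalgebra_iso (C.W.coset p) :: _ \<Rightarrow>\<^sub>0 'k::{comm_ring,comm_monoid_mult}) =
    tensor_map C.C ubp_hopf_algebra coalgebra_iso (comult C.C (C.W.coset p))"
proof -
  let ?h = "coalgebra_iso :: _ \<Rightarrow> _ \<Rightarrow>\<^sub>0 'k"
  let ?g = "\<lambda>(x, y). single (?h x, ?h y) (1::'k)"
  have "tensor_map C.C ubp_hopf_algebra ?h (comult C.C (C.W.coset p)) =
      tensor_map (tensor_powers C.V) ubp_module ?h (C.T.coset (lin C.deconc p))"
    unfolding C.comult_coset[OF p] tensor_map_def tensor_ubp_hopf_algebra ..
  also have "\<dots> = P.coset (lin ?g (lin C.deconc p))"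
  proof (rule tensor_map_coset[OF C.module_tensor_powers _ linear_map_coalgebra_iso])
    show "module scalars (ubp_module :: ('k, _) module)"
      unfolding ubp_module_def by (rule module_free_module)
    show "keys (lin C.deconc p) \<subseteq> carrier (tensor_powers C.V) \<times> carrier (tensor_powers C.V)"
      using p by (intro keys_lin C.keys_deconc) blast
  qed
  also have "lin ?g (lin C.deconc p) = lin (\<lambda>vs. \<Sum>i\<in>{0..length vs}.
      single (concat_word (take i vs), concat_word (drop i vs)) 1) p"
    by (simp add: lin_lin C.deconc_def lin_sum coalgebra_iso_pure_word)
  also have "P.coset \<dots> = P.coset (lin (\<lambda>vs. lin split_sum (concat_word vs)) p)"
    unfolding P.coset_eq_iff
    by (rule P.K_sym, rule P.K_lin_cong, rule split_sum_concat_word) (use p in blast)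
  also have "\<dots> = ubp_comult (?h (C.W.coset p))"
    using ubp_comult_eq[OF keys_lin_concat_word[OF p]] by (simp add: coalgebra_iso_coset lin_lin)
  finally show ?thesis by simp
qed

text \<open>Each basis word in the expansion takes its letters from the homogeneous entries, so it
  has the total degree, which \<open>concat_split\<close> preserves.\<close>

lemma concat_word_degree:
  assumes "list_all2 (\<lambda>v d. v \<in> ubp_irreducible_grade d) vs ds"
  shows "vs \<in> C.vwords"
    and "keys (concat_word vs :: _ \<Rightarrow>\<^sub>0 'k::{comm_ring,comm_monoid_mult}) \<subseteq> ubps (sum_list ds)"
proof -
  show vs: "vs \<in> C.vwords"
    using assms by (induct rule: list_all2_induct) (auto simp: ubp_irreducible_grade_def)
  have deg: "word_deg w = sum_list ds" if "list_all2 (\<lambda>v y. y \<in> keys v) vs w" for w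
    using assms that
  proof (induct arbitrary: w rule: list_all2_induct)
    case (Cons v vs d ds)
    then obtain y w' where "w = y # w'" "y \<in> keys v"
      "list_all2 (\<lambda>v y. y \<in> keys v) vs w'"
      by (auto simp: list_all2_Cons1)
    with Cons show ?case
      by (auto simp: ubp_irreducible_grade_def word_deg_def)
  qed (simp add: word_deg_def)
  show "keys (concat_word vs :: _ \<Rightarrow>\<^sub>0 'k) \<subseteq> ubps (sum_list ds)"
    unfolding concat_word_def
  proof (rule keys_lin)
    fix w
    assume w: "w \<in> keys (expand vs)"
    then have "w \<in> lists irreducible_ubps"
      using keys_expand_irreducible[OF vs] by blast
    from concat_split(1)[OF this, where 'k = 'k]
    show "keys (concat_split w :: _ \<Rightarrow>\<^sub>0 'k) \<subseteq> ubps (sum_list ds)"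
      using deg[OF keys_expand[OF w]] by simp
  qed
qed

lemma grade_coalgebra_iso:
  "coalgebra_iso ` grade C.C n = {p :: _ \<Rightarrow>\<^sub>0 'k::{comm_ring,comm_monoid_mult}. keys p \<subseteq> ubps n}"
proof -
  define gens :: "((ubp \<Rightarrow>\<^sub>0 'k) list \<Rightarrow>\<^sub>0 'k) set set" where
    "gens = {pure_word C.V vs | vs. \<exists>ds. list_all2 (\<lambda>v d. v \<in> ubp_irreducible_grade d) vs ds \<and> sum_list ds = n}"
  have grade: "grade C.C n = span_of C.W.Q gens"
    by (simp add: cotensor_coalgebra_def gens_def C.tensor_powers_eq)
  \<comment> \<open>Representatives whose image has degree \<open>n\<close>. They form a submodule
    containing the generators of the grade, so the whole span maps into degree
    \<open>n\<close>.\<close>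
  define D where "D = {p :: (ubp \<Rightarrow>\<^sub>0 'k) list \<Rightarrow>\<^sub>0 'k. keys p \<subseteq> C.vwords \<and>
    keys (lin concat_word p) \<subseteq> ubps n}"
  have D: "free_submodule D C.vwords"
    by (rule free_submodule.intro, unfold free_submodule_iff)
       (simp add: D_def lin_add lin_scale keys_add_subset order_trans[OF keys_scale])
  have "gens \<subseteq> C.W.coset ` D"
  proof
    fix T
    assume "T \<in> gens"
    then obtain vs ds where vs: "T = pure_word C.V vs" "list_all2 (\<lambda>v d. v \<in> ubp_irreducible_grade d) vs ds"
      "sum_list ds = n"
      by (auto simp: gens_def)
    then have "single vs 1 \<in> D"
      using concat_word_degree[OF vs(2)] by (simp add: D_def keys_single_subset)
    then show "T \<in> C.W.coset ` D"
      unfolding vs(1) C.pure_word_eq by blast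
  qed
  then have 1: "span_of C.W.Q gens \<subseteq> C.W.coset ` D"
    by (rule span_of_mono[OF C.W.submodule_Q[OF D]])
  \<comment> \<open>Conversely, the iterated coproduct of an element of degree \<open>n\<close>
    involves only basis words of total degree \<open>n\<close>, and these are among the
    generators.\<close>
  have 2: "p \<in> coalgebra_iso ` span_of C.W.Q gens" if p: "keys p \<subseteq> ubps n" for p :: "ubp \<Rightarrow>\<^sub>0 'k"
  proof -
    have keys: "keys (lin iterated_comult p :: _ \<Rightarrow>\<^sub>0 'k) \<subseteq> {w\<in>lists irreducible_ubps. word_deg w = n}"
      using p iterated_comult_unitriangular(3)[where 'k = 'k and n = n] by (intro keys_lin) blast
    have "C.W.coset (lin (\<lambda>w. single (C.basis_word w) (1::'k)) (lin iterated_comult p)) \<in> span_of C.W.Q gens"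
      (is "?T \<in> _")
    proof (rule C.W.coset_lin_span)
      fix w
      assume "w \<in> keys (lin iterated_comult p :: _ \<Rightarrow>\<^sub>0 'k)"
      then have w: "w \<in> lists irreducible_ubps" "word_deg w = n"
        using keys by blast+
      have "list_all2 (\<lambda>v d. v \<in> ubp_irreducible_grade d) (C.basis_word w) (map ubp_deg w)"
        using w(1) by (auto simp: list_all2_conv_all_nth ubp_irreducible_grade_def keys_single)
      moreover have "sum_list (map ubp_deg w) = n"
        using w(2) by (simp add: word_deg_def)
      ultimately have "pure_word C.V (C.basis_word w) \<in> gens"
        unfolding gens_def
        by (intro CollectI exI[of _ "C.basis_word w"] exI[of _ "map ubp_deg w"] conjI refl)
      then show "C.W.coset (single (C.basis_word w) (1::'k)) \<in> span_of C.W.Q gens"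
        unfolding C.pure_word_eq by (rule subsetD[OF span_of_superset])
    qed
    moreover have "coalgebra_iso ?T = p"
      using lin_concat_split[of p] p by (simp add: coalgebra_iso_coset lin_concat_word_basis) blast
    ultimately show ?thesis
      by (intro image_eqI[of _ _ ?T]) simp_all
  qed
  show ?thesis
    unfolding grade
  proof (intro equalityI subsetI)
    fix q :: "ubp \<Rightarrow>\<^sub>0 'k"
    assume "q \<in> coalgebra_iso ` span_of C.W.Q gens"
    then obtain p where "p \<in> D" "q = coalgebra_iso (C.W.coset p)"
      using 1 by blast
    then show "q \<in> {p. keys p \<subseteq> ubps n}"
      by (simp add: D_def coalgebra_iso_coset)
  qed (use 2 in simp)
qed

text \<open>A non-empty word of irreducible elements has positive degree, so its preimage has no
  component at the empty uniform block permutation; the empty word is sent to the unit.\<close>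

lemma counit_coalgebra_iso:
  assumes p: "keys p \<subseteq> C.vwords"
  shows "lookup (lin concat_word p) {} = lookup p ([] :: (ubp \<Rightarrow>\<^sub>0 'k::{comm_ring,comm_monoid_mult}) list)"
proof -
  have lookup: "lookup (concat_word vs) {} = (if vs = [] then 1 else (0::'k))" if vs: "vs \<in> C.vwords" for vs
  proof (cases "vs = []")
    case True
    then show ?thesis
      by (simp add: concat_word_def concat_split_Nil)
  next
    case False
    have "keys (concat_word vs) \<subseteq> - {{}}"
      unfolding concat_word_def
    proof (rule keys_lin)
      fix w
      assume "w \<in> keys (expand vs)"
      then have w: "w \<in> lists irreducible_ubps" "w \<noteq> []"
        using keys_expand_irreducible[OF vs] False by auto
      then obtain f w' where "w = f # w'" "f \<in> irreducible_ubps"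
        by (cases w) auto
      then have "word_deg w > 0"
        using ubp_deg_irreducible by (simp add: word_deg_def)
      moreover have "{} \<in> ubps 0"
        using ubp_of_ubps[of "[]"] by simp
      ultimately have "{} \<notin> ubps (word_deg w)"
        using ubps_degree_unique[of "{}" 0 "word_deg w"] by auto
      then show "keys (concat_split w :: _ \<Rightarrow>\<^sub>0 'k) \<subseteq> - {{}}"
        using concat_split(1)[OF w(1), where 'k = 'k] by blast
    qed
    then show ?thesis
      using False by (auto simp: in_keys_iff)
  qed
  have "lookup (lin concat_word p) {} =
      (\<Sum>vs\<in>keys p. if vs = [] then lookup p [] else 0)"
    unfolding lookup_lin
  proof (rule sum.cong[OF refl])
    fix vs
    assume "vs \<in> keys p"
    then have "vs \<in> C.vwords"
      using p by blast
    from lookup[OF this]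
    show "lookup p vs * lookup (concat_word vs) {} =
        (if vs = [] then lookup p [] else 0)"
      by simp
  qed
  then show ?thesis
    by (simp add: sum.delta in_keys_iff)
qed

lemma cofree_ubp_hopf_algebra:
  "cofree_as_graded_coalgebra (ubp_hopf_algebra :: ('k::{comm_ring,comm_monoid_mult}, ubp \<Rightarrow>\<^sub>0 'k) graded_coalgebra)"
proof -
  let ?P = "ubp_hopf_algebra :: ('k, ubp \<Rightarrow>\<^sub>0 'k) graded_coalgebra"
  have graded: "graded_module C.V (ubp_irreducible_grade :: nat \<Rightarrow> (ubp \<Rightarrow>\<^sub>0 'k) set)"
    unfolding ubp_irreducible_grade_def[abs_def] by (rule graded_free_module)
  have zero: "ubp_irreducible_grade 0 = {\<zero>\<^bsub>C.V :: ('k, ubp \<Rightarrow>\<^sub>0 'k) module\<^esub>}"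
  proof -
    have "{f\<in>irreducible_ubps. ubp_deg f = 0} = {}"
      using ubp_deg_irreducible by force
    then show ?thesis
      unfolding ubp_irreducible_grade_def by (simp only: free_module_simps) simp
  qed
  have "graded_coalgebra_iso C.C ?P coalgebra_iso"
    unfolding graded_coalgebra_iso_def
  proof (intro conjI allI ballI)
    show "linear_map C.C ?P coalgebra_iso"
      using linear_map_coalgebra_iso[where 'k = 'k] C.module_tensor_powers
      by (simp add: linear_map_def cotensor_coalgebra_def ubp_module_def)
    show "bij_betw coalgebra_iso (carrier C.C) (carrier ?P)"
      using bij_betw_coalgebra_iso by (simp add: C.cotensor_simps)
    show "coalgebra_iso ` grade C.C d = grade ?P d" for d
      by (simp add: grade_coalgebra_iso)
  next
    fix T
    assume "T \<in> carrier (C.C :: ('k, _) graded_coalgebra)"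
    then obtain p where p: "keys p \<subseteq> C.vwords" "T = C.W.coset p"
      by (auto simp: C.cotensor_simps)
    show "comult ?P (coalgebra_iso T) = tensor_map C.C ?P coalgebra_iso (comult C.C T)"
      using comult_coalgebra_iso[OF p(1)] by (simp add: p(2))
    show "counit ?P (coalgebra_iso T) = counit C.C T"
      using counit_coalgebra_iso[OF p(1)] by (simp add: p(2) C.counit_coset coalgebra_iso_coset)
  qed
  with graded zero show ?thesis
    unfolding cofree_as_graded_coalgebra_def by blast
qed

theorem corollary2p8:
  "free_as_algebra
     (ubp_hopf_algebra :: ('k::{comm_ring,comm_monoid_mult}, ubp \<Rightarrow>\<^sub>0 'k) graded_coalgebra) \<and>
   cofree_as_graded_coalgebra
     (ubp_hopf_algebra :: ('k, ubp \<Rightarrow>\<^sub>0 'k) graded_coalgebra)"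
  using free_as_algebra_ubp_hopf_algebra cofree_ubp_hopf_algebra by blast

end
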